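(* Let $M$ be a smooth manifold and let $F=\sqrt{L(\alpha_1^2,\alpha_2^2)}$ be an $(\alpha_1,\alpha_2)$-metric on $M$. If $F$ is a Landsberg metric, then the S-curvature of $F$ vanishes identically on $TM\backslash 0$.
   Context: A Minkowski norm on a finite-dimensional real vector space $\mathbf V$ with linear coordinates $(y^i)$ is a continuous function $F:\mathbf V\to\mathbb R$ with $F(y)\ge 0$, equality iff $y=0$; $F(\lambda y)=\lambda F(y)$ for $\lambda>0$; $F$ smooth on $\mathbf V\backslash\{0\}$, with the Hessian matrix $(g_{ij}(y))=(\frac12[F^2]_{y^iy^j}(y))$ positive definite for all $y\ne 0$. $(g^{ij})$ denotes the inverse of $(g_{ij})$; subscripts $y^i$, $x^i$ denote partial derivatives; repeated indices are summed. A Finsler metric on a smooth $n$-manifold $M$ is a continuous function $F$ on $TM$, smooth on the slit tangent bundle $TM\backslash 0$, whose restriction to each tangent space is a Minkowski norm. Local coordinates $x=(x^i)$ on $M$ induce coordinates $(x^i,y^j)$ on $TM$ by $y=y^j\partial_{x^j}$. $(\alpha_1,\alpha_2)$-metrics: Let $\alpha$ be a Riemannian metric on $M$ and $TM=\mathcal V_1\oplus\mathcal V_2$ an $\alpha$-orthogonal decomposition into smooth linear subbundles of ranks $n_1,n_2\ge1$ (rank $1$ is allowed). Regard $\alpha_i=\alpha|_{\mathcal V_i}$ as a function on $TM$: $\alpha_i(y)$ is the $\alpha$-length of the $\alpha$-orthogonal projection of $y$ to $\mathcal V_i$. An $(\alpha_1,\alpha_2)$-metric is a Finsler metric of the form $F=\sqrt{L(\alpha_1^2,\alpha_2^2)}$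 for a real function $L$ of two variables (necessarily positively homogeneous of degree $1$). Geodesic spray: $G=y^i\partial_{x^i}-2G^i\partial_{y^i}$ with $G^i=\frac14 g^{il}([F^2]_{x^ky^l}y^k-[F^2]_{x^l})$; it is a globally defined vector field on $TM\backslash 0$. $F$ is a Landsberg metric if in every local coordinate system $y^jg_{ij}[G^i]_{y^py^qy^r}=0$ for all $p,q,r$. S-curvature: let $\sigma(x)=\omega_n/\mathrm{Vol}\{(y^i)\in\mathbb R^n : F(x,y^i\partial_{x^i})<1\}$, where $\mathrm{Vol}$ is Euclidean volume and $\omega_n$ is the volume of the Euclidean unit $n$-ball. The distortion $\tau(x,y)=\ln\frac{\sqrt{\det(g_{ij}(x,y))}}{\sigma(x)}$ is a well-defined function on $TM\backslash0$, and the S-curvature $S(x,y)$ is the derivative of $\tau$ along the geodesic spray $G$. *)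

theory Defs
  imports "HOL-Analysis.Analysis"
begin

section \<open>Smooth functions and partial derivatives\<close>

text \<open>The domain \<open>S\<close> is always meant to be open. Differentiability together with the
  class \<open>C\<^sup>k\<close> of all directional derivatives gives \<open>C\<^sup>k\<^sup>+\<^sup>1\<close>.\<close>

fun Ck_on :: "nat \<Rightarrow> 'a::euclidean_space set \<Rightarrow> ('a \<Rightarrow> 'b::real_normed_vector) \<Rightarrow> bool" where
  "Ck_on 0 S f \<longleftrightarrow> continuous_on S f"
| "Ck_on (Suc k) S f \<longleftrightarrow> (\<forall>x\<in>S. f differentiable at x) \<and>
     (\<forall>v. Ck_on k S (\<lambda>x. frechet_derivative f (at x) v))"

definition smooth_on :: "'a::euclidean_space set \<Rightarrow> ('a \<Rightarrow> 'b::real_normed_vector) \<Rightarrow> bool" where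
  "smooth_on S f \<longleftrightarrow> (\<forall>k. Ck_on k S f)"

definition pd :: "'n \<Rightarrow> (real^'n::finite \<Rightarrow> real) \<Rightarrow> real^'n \<Rightarrow> real" where
  "pd i f x = frechet_derivative f (at x) (axis i 1)"

text \<open>For a function \<open>f x y\<close> on (a part of) the tangent bundle in induced coordinates:
  the partial derivatives with respect to \<open>x\<^sup>i\<close> and to \<open>y\<^sup>i\<close>.\<close>

definition dx :: "'n \<Rightarrow> (real^'n::finite \<Rightarrow> real^'n \<Rightarrow> real) \<Rightarrow> real^'n \<Rightarrow> real^'n \<Rightarrow> real" where
  "dx i f x y = pd i (\<lambda>x'. f x' y) x"

definition dy :: "'n \<Rightarrow> (real^'n::finite \<Rightarrow> real^'n \<Rightarrow> real) \<Rightarrow> real^'n \<Rightarrow> real^'n \<Rightarrow> real" where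
  "dy i f x y = pd i (f x) y"


section \<open>Minkowski norms\<close>

definition fundamental_tensor :: "(real^'n::finite \<Rightarrow> real) \<Rightarrow> real^'n \<Rightarrow> real^'n^'n" where
  "fundamental_tensor F y = (\<chi> i j. (1/2) * pd j (pd i (\<lambda>z. (F z)\<^sup>2)) y)"

definition positive_definite :: "real^'n^'n::finite \<Rightarrow> bool" where
  "positive_definite B \<longleftrightarrow> transpose B = B \<and> (\<forall>v. v \<noteq> 0 \<longrightarrow> 0 < v \<bullet> (B *v v))"

definition minkowski_norm :: "(real^'n::finite \<Rightarrow> real) \<Rightarrow> bool" where
  "minkowski_norm F \<longleftrightarrow>
     continuous_on UNIV F \<and>
     (\<forall>y. 0 \<le> F y) \<and> (\<forall>y. F y = 0 \<longleftrightarrow> y = 0) \<and>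
     (\<forall>y. \<forall>r>0. F (r *\<^sub>R y) = r * F y) \<and>
     smooth_on (- {0}) F \<and>
     (\<forall>y. y \<noteq> 0 \<longrightarrow> positive_definite (fundamental_tensor F y))"


section \<open>Smooth manifolds\<close>

text \<open>A chart is a pair of its domain and its coordinate map; the values of the coordinate map
  outside the domain are irrelevant.\<close>

type_synonym ('m, 'n) chart = "'m set \<times> ('m \<Rightarrow> real^'n)"

abbreviation chart_dom :: "('m, 'n) chart \<Rightarrow> 'm set" where
  "chart_dom c \<equiv> fst c"

abbreviation chart_map :: "('m, 'n) chart \<Rightarrow> 'm \<Rightarrow> real^'n" where
  "chart_map c \<equiv> snd c"

abbreviation chart_img :: "('m, 'n) chart \<Rightarrow> (real^'n) set" where
  "chart_img c \<equiv> chart_map c ` chart_dom c"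

abbreviation chart_inv :: "('m, 'n) chart \<Rightarrow> real^'n \<Rightarrow> 'm" where
  "chart_inv c \<equiv> inv_into (chart_dom c) (chart_map c)"

definition is_chart :: "'m topology \<Rightarrow> ('m, 'n::finite) chart \<Rightarrow> bool" where
  "is_chart X c \<longleftrightarrow> openin X (chart_dom c) \<and> open (chart_img c) \<and>
     homeomorphic_map (subtopology X (chart_dom c)) (top_of_set (chart_img c)) (chart_map c)"

definition transition :: "('m, 'n) chart \<Rightarrow> ('m, 'n) chart \<Rightarrow> real^'n \<Rightarrow> real^'n" where
  "transition c d = chart_map d \<circ> chart_inv c"

definition compatible :: "('m, 'n::finite) chart \<Rightarrow> ('m, 'n) chart \<Rightarrow> bool" where
  "compatible c d \<longleftrightarrow>
     smooth_on (chart_map c ` (chart_dom c \<inter> chart_dom d)) (transition c d) \<and>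
     smooth_on (chart_map d ` (chart_dom c \<inter> chart_dom d)) (transition d c)"

text \<open>The smooth structure \<open>A\<close> is a maximal atlas, so that the charts in \<open>A\<close> are
  all the local coordinate systems. The dimension of the manifold is \<open>CARD('n)\<close>.\<close>

definition smooth_manifold :: "'m topology \<Rightarrow> ('m, 'n::finite) chart set \<Rightarrow> bool" where
  "smooth_manifold X A \<longleftrightarrow>
     Hausdorff_space X \<and> second_countable X \<and>
     (\<forall>c\<in>A. is_chart X c) \<and>
     (\<Union>c\<in>A. chart_dom c) = topspace X \<and>
     (\<forall>c\<in>A. \<forall>d\<in>A. compatible c d) \<and>
     (\<forall>c. is_chart X c \<and> (\<forall>d\<in>A. compatible c d) \<longrightarrow> c \<in> A)"

definition charts_at :: "('m, 'n) chart set \<Rightarrow> 'm \<Rightarrow> ('m, 'n) chart set" where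
  "charts_at A p = {c \<in> A. p \<in> chart_dom c}"


section \<open>The tangent bundle\<close>

text \<open>A tangent vector at \<open>p\<close> is represented by the family of its component vectors in all charts
  at \<open>p\<close>, subject to the usual transformation rule. The type below is the ambient vector space of
  arbitrary such families; the tangent spaces are subspaces of it.\<close>

typedef ('m, 'n) tvec = "UNIV :: (('m, 'n::finite) chart \<Rightarrow> real^'n) set"
  morphisms components Tvec ..

lemma components_Tvec [simp]: "components (Tvec f) = f"
  by (simp add: Tvec_inverse)

lemma tvec_eq_iff: "u = v \<longleftrightarrow> (\<forall>c. components u c = components v c)"
  by (metis components_inject ext)

instantiation tvec :: (type, finite) real_vector
begin

definition "0 = Tvec (\<lambda>c. 0)"
definition "u + v = Tvec (\<lambda>c. components u c + components v c)"
definition "u - v = Tvec (\<lambda>c. components u c - components v c)"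
definition "- u = Tvec (\<lambda>c. - components u c)"
definition "r *\<^sub>R u = Tvec (\<lambda>c. r *\<^sub>R components u c)"

instance
  by standard
    (simp_all add: zero_tvec_def plus_tvec_def minus_tvec_def uminus_tvec_def scaleR_tvec_def
      tvec_eq_iff algebra_simps)

end

definition tangent_space :: "('m, 'n::finite) chart set \<Rightarrow> 'm \<Rightarrow> ('m, 'n) tvec set" where
  "tangent_space A p = {v.
     (\<forall>c\<in>charts_at A p. \<forall>d\<in>charts_at A p.
        components v d = frechet_derivative (transition c d) (at (chart_map c p)) (components v c)) \<and>
     (\<forall>c. c \<notin> charts_at A p \<longrightarrow> components v c = 0)}"

text \<open>The tangent vector \<open>y\<^sup>j \<partial>\<^sub>x\<^sub>j\<close> at \<open>p\<close> in the coordinates of a chart \<open>c\<close> at \<open>p\<close>.\<close>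

definition coord_vec ::
  "('m, 'n::finite) chart set \<Rightarrow> ('m, 'n) chart \<Rightarrow> 'm \<Rightarrow> real^'n \<Rightarrow> ('m, 'n) tvec" where
  "coord_vec A c p y = Tvec (\<lambda>d. if d \<in> charts_at A p
     then frechet_derivative (transition c d) (at (chart_map c p)) y else 0)"

definition tangent_bundle ::
  "'m topology \<Rightarrow> ('m, 'n::finite) chart set \<Rightarrow> ('m \<times> ('m, 'n) tvec) set" where
  "tangent_bundle X A = {(p, v). p \<in> topspace X \<and> v \<in> tangent_space A p}"

definition slit_tangent_bundle ::
  "'m topology \<Rightarrow> ('m, 'n::finite) chart set \<Rightarrow> ('m \<times> ('m, 'n) tvec) set" where
  "slit_tangent_bundle X A = {(p, v) \<in> tangent_bundle X A. v \<noteq> 0}"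

text \<open>A function on the tangent bundle, written in the coordinates \<open>(x, y)\<close> induced by a chart.\<close>

definition in_chart :: "('m, 'n::finite) chart set \<Rightarrow> ('m, 'n) chart \<Rightarrow>
    ('m \<times> ('m, 'n) tvec \<Rightarrow> real) \<Rightarrow> real^'n \<Rightarrow> real^'n \<Rightarrow> real" where
  "in_chart A c F x y = F (chart_inv c x, coord_vec A c (chart_inv c x) y)"

definition smooth_vector_field ::
  "('m, 'n::finite) chart set \<Rightarrow> 'm set \<Rightarrow> ('m \<Rightarrow> ('m, 'n) tvec) \<Rightarrow> bool" where
  "smooth_vector_field A W E \<longleftrightarrow> (\<forall>q\<in>W. E q \<in> tangent_space A q) \<and>
     (\<forall>c\<in>A. smooth_on (chart_map c ` (chart_dom c \<inter> W)) (\<lambda>x. components (E (chart_inv c x)) c))"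

definition smooth_subbundle :: "'m topology \<Rightarrow> ('m, 'n::finite) chart set \<Rightarrow> nat \<Rightarrow>
    ('m \<Rightarrow> ('m, 'n) tvec set) \<Rightarrow> bool" where
  "smooth_subbundle X A k V \<longleftrightarrow>
     (\<forall>p\<in>topspace X. \<exists>W E. openin X W \<and> p \<in> W \<and>
        (\<forall>i<k. smooth_vector_field A W (E i)) \<and>
        (\<forall>q\<in>W. inj_on (\<lambda>i. E i q) {..<k} \<and> independent ((\<lambda>i. E i q) ` {..<k}) \<and>
           V q = span ((\<lambda>i. E i q) ` {..<k})))"


section \<open>Riemannian and Finsler metrics\<close>

definition riemannian_metric :: "'m topology \<Rightarrow> ('m, 'n::finite) chart set \<Rightarrow>
    ('m \<Rightarrow> ('m, 'n) tvec \<Rightarrow> ('m, 'n) tvec \<Rightarrow> real) \<Rightarrow> bool" where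
  "riemannian_metric X A a \<longleftrightarrow>
     (\<forall>p\<in>topspace X.
        (\<forall>u\<in>tangent_space A p. \<forall>v\<in>tangent_space A p. a p u v = a p v u) \<and>
        (\<forall>u\<in>tangent_space A p. \<forall>v\<in>tangent_space A p. \<forall>w\<in>tangent_space A p.
           a p (u + v) w = a p u w + a p v w) \<and>
        (\<forall>u\<in>tangent_space A p. \<forall>v\<in>tangent_space A p. \<forall>r. a p (r *\<^sub>R u) v = r * a p u v) \<and>
        (\<forall>u\<in>tangent_space A p. u \<noteq> 0 \<longrightarrow> 0 < a p u u)) \<and>
     (\<forall>c\<in>A. \<forall>i j. smooth_on (chart_img c)
        (\<lambda>x. a (chart_inv c x) (coord_vec A c (chart_inv c x) (axis i 1))
                               (coord_vec A c (chart_inv c x) (axis j 1))))"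

definition finsler_metric :: "'m topology \<Rightarrow> ('m, 'n::finite) chart set \<Rightarrow>
    ('m \<times> ('m, 'n) tvec \<Rightarrow> real) \<Rightarrow> bool" where
  "finsler_metric X A F \<longleftrightarrow>
     (\<forall>c\<in>A. continuous_on (chart_img c \<times> UNIV) (\<lambda>(x, y). in_chart A c F x y) \<and>
        smooth_on (chart_img c \<times> (- {0})) (\<lambda>(x, y). in_chart A c F x y)) \<and>
     (\<forall>p\<in>topspace X. \<forall>c\<in>charts_at A p. minkowski_norm (\<lambda>y. F (p, coord_vec A c p y)))"


section \<open>Metrics built from an orthogonal decomposition\<close>

definition orthogonal_decomposition :: "'m topology \<Rightarrow> ('m, 'n::finite) chart set \<Rightarrow>
    ('m \<Rightarrow> ('m, 'n) tvec \<Rightarrow> ('m, 'n) tvec \<Rightarrow> real) \<Rightarrow> nat \<Rightarrow> nat \<Rightarrow>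
    ('m \<Rightarrow> ('m, 'n) tvec set) \<Rightarrow> ('m \<Rightarrow> ('m, 'n) tvec set) \<Rightarrow> bool" where
  "orthogonal_decomposition X A a n1 n2 V1 V2 \<longleftrightarrow>
     smooth_subbundle X A n1 V1 \<and> smooth_subbundle X A n2 V2 \<and>
     (\<forall>p\<in>topspace X.
        V1 p \<inter> V2 p = {0} \<and>
        {u + v | u v. u \<in> V1 p \<and> v \<in> V2 p} = tangent_space A p \<and>
        (\<forall>u\<in>V1 p. \<forall>v\<in>V2 p. a p u v = 0))"

definition orth_proj :: "('m \<Rightarrow> ('m, 'n::finite) tvec \<Rightarrow> ('m, 'n) tvec \<Rightarrow> real) \<Rightarrow>
    ('m \<Rightarrow> ('m, 'n) tvec set) \<Rightarrow> 'm \<Rightarrow> ('m, 'n) tvec \<Rightarrow> ('m, 'n) tvec" where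
  "orth_proj a V p u = (THE w. w \<in> V p \<and> (\<forall>z\<in>V p. a p (u - w) z = 0))"

definition alpha_part :: "('m \<Rightarrow> ('m, 'n::finite) tvec \<Rightarrow> ('m, 'n) tvec \<Rightarrow> real) \<Rightarrow>
    ('m \<Rightarrow> ('m, 'n) tvec set) \<Rightarrow> 'm \<times> ('m, 'n) tvec \<Rightarrow> real" where
  "alpha_part a V = (\<lambda>(p, u). sqrt (a p (orth_proj a V p u) (orth_proj a V p u)))"

text \<open>No condition is imposed on \<open>L\<close>: its homogeneity on the values taken by
  \<open>\<alpha>\<^sub>1\<^sup>2, \<alpha>\<^sub>2\<^sup>2\<close> is a consequence, as is its nonnegativity there
  (recall that \<open>sqrt\<close> is an odd function on the reals).\<close>

definition alpha12_metric :: "'m topology \<Rightarrow> ('m, 'n::finite) chart set \<Rightarrow>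
    ('m \<Rightarrow> ('m, 'n) tvec \<Rightarrow> ('m, 'n) tvec \<Rightarrow> real) \<Rightarrow> nat \<Rightarrow> nat \<Rightarrow>
    ('m \<Rightarrow> ('m, 'n) tvec set) \<Rightarrow> ('m \<Rightarrow> ('m, 'n) tvec set) \<Rightarrow>
    (real \<Rightarrow> real \<Rightarrow> real) \<Rightarrow> ('m \<times> ('m, 'n) tvec \<Rightarrow> real) \<Rightarrow> bool" where
  "alpha12_metric X A a n1 n2 V1 V2 L F \<longleftrightarrow>
     riemannian_metric X A a \<and>
     1 \<le> n1 \<and> 1 \<le> n2 \<and> orthogonal_decomposition X A a n1 n2 V1 V2 \<and>
     finsler_metric X A F \<and>
     (\<forall>v\<in>tangent_bundle X A. F v = sqrt (L ((alpha_part a V1 v)\<^sup>2) ((alpha_part a V2 v)\<^sup>2)))"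


section \<open>Geodesic spray, Landsberg condition and S-curvature in coordinates\<close>

text \<open>Here \<open>f x y\<close> is the expression of a Finsler metric in the coordinates induced by a chart.\<close>

definition g_mat :: "(real^'n::finite \<Rightarrow> real^'n \<Rightarrow> real) \<Rightarrow> real^'n \<Rightarrow> real^'n \<Rightarrow> real^'n^'n" where
  "g_mat f x y = fundamental_tensor (f x) y"

definition spray_coeff ::
  "(real^'n::finite \<Rightarrow> real^'n \<Rightarrow> real) \<Rightarrow> 'n \<Rightarrow> real^'n \<Rightarrow> real^'n \<Rightarrow> real" where
  "spray_coeff f i x y = (1/4) * (\<Sum>l\<in>UNIV. matrix_inv (g_mat f x y) $ i $ l *
     ((\<Sum>k\<in>UNIV. dy l (dx k (\<lambda>x y. (f x y)\<^sup>2)) x y * y $ k) - dx l (\<lambda>x y. (f x y)\<^sup>2) x y))"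

text \<open>The derivative of \<open>h\<close> along the geodesic spray \<open>y\<^sup>i \<partial>\<^sub>x\<^sub>i - 2 G\<^sup>i \<partial>\<^sub>y\<^sub>i\<close>.\<close>

definition spray_deriv :: "(real^'n::finite \<Rightarrow> real^'n \<Rightarrow> real) \<Rightarrow>
    (real^'n \<Rightarrow> real^'n \<Rightarrow> real) \<Rightarrow> real^'n \<Rightarrow> real^'n \<Rightarrow> real" where
  "spray_deriv f h x y =
     (\<Sum>i\<in>UNIV. y $ i * dx i h x y) - 2 * (\<Sum>i\<in>UNIV. spray_coeff f i x y * dy i h x y)"

definition vol_density :: "(real^'n::finite \<Rightarrow> real^'n \<Rightarrow> real) \<Rightarrow> real^'n \<Rightarrow> real" where
  "vol_density f x =
     measure lborel (ball (0 :: real^'n) 1) / measure lborel {y :: real^'n. f x y < 1}"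

definition distortion :: "(real^'n::finite \<Rightarrow> real^'n \<Rightarrow> real) \<Rightarrow> real^'n \<Rightarrow> real^'n \<Rightarrow> real" where
  "distortion f x y = ln (sqrt (det (g_mat f x y)) / vol_density f x)"

definition landsberg_metric :: "('m, 'n::finite) chart set \<Rightarrow>
    ('m \<times> ('m, 'n) tvec \<Rightarrow> real) \<Rightarrow> bool" where
  "landsberg_metric A F \<longleftrightarrow>
     (\<forall>c\<in>A. \<forall>x\<in>chart_img c. \<forall>y. y \<noteq> 0 \<longrightarrow>
        (let f = in_chart A c F in
          \<forall>p q r. (\<Sum>i\<in>UNIV. \<Sum>j\<in>UNIV.
            y $ j * g_mat f x y $ i $ j * dy r (dy q (dy p (spray_coeff f i))) x y) = 0))"

text \<open>The S-curvature at a tangent vector \<open>(p, v)\<close>, computed in a chart \<open>c\<close> at \<open>p\<close>. The value does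
  not depend on the chart; statements about it quantify over all charts at \<open>p\<close>.\<close>

definition S_curvature :: "('m, 'n::finite) chart set \<Rightarrow> ('m, 'n) chart \<Rightarrow>
    ('m \<times> ('m, 'n) tvec \<Rightarrow> real) \<Rightarrow> 'm \<times> ('m, 'n) tvec \<Rightarrow> real" where
  "S_curvature A c F = (\<lambda>(p, v). let f = in_chart A c F in
     spray_deriv f (distortion f) (chart_map c p) (components v c))"

end

theory Submission
  imports Defs
begin

text \<open>In coordinates around a point \<open>p\<close>, \<open>\<alpha>\<close>-orthonormal frames adapted to \<open>V1\<close> and \<open>V2\<close> identify
  all tangent spaces linearly and isometrically for \<open>F\<close>. The corresponding flat connection preserves the distortion, hence
  the S-curvature at \<open>y\<close> is minus the derivative of the distortion of the Minkowski norm at \<open>p\<close> along a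
  vector \<open>Y y\<close>, homogeneous of degree two in \<open>y\<close>, given by the torsion \<open>c\<close> of the connection.

  Write \<open>y = p u + q v\<close> with unit vectors \<open>u\<close> in \<open>V1\<close> and \<open>v\<close> in \<open>V2\<close>. The orthogonal reflection
  that fixes the plane of \<open>u\<close> and \<open>v\<close> is an isometry of the norm, so only the component of \<open>Y\<close> in this plane
  matters. If both components of \<open>c u v\<close> in the plane vanish, so does that of \<open>Y\<close>. Otherwise the Landsberg equation
  restricted to the plane is an ordinary differential equation, which says that the main scalar of
  the plane norm is constant. As that norm is symmetric in \<open>p\<close>, the main scalar is zero, \<open>F\<close> is Euclidean at the point,
  and the distortion is constant.\<close>

section \<open>Calculus of smooth functions\<close>

text \<open>The spray contains only first derivatives in \<open>x\<close>, and every further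
  derivative in the Landsberg condition is vertical. So the frames matter only to first order at one
  point, and the problem lives in a single vector space with a norm and a torsion.

  Three vertical derivatives kill the quadratic field of the flat connection, so the Landsberg
  equation constrains \<open>Y\<close> alone. Its contraction with \<open>g_ij y^j\<close>, half the
  differential of \<open>F^2\<close>, is blind to directions orthogonal to the plane; this is why it
  closes up on two components. Since the torsion is antisymmetric, \<open>Y\<close> is
  \<open>g\<close>-orthogonal to \<open>y\<close>, hence its plane part is a multiple of the rotated
  gradient of \<open>F^2\<close>, with a factor fixed by the norm and the two torsion components.
  Eliminating that factor leaves an equation for the norm itself, except where the factor vanishes;
  such points are handled separately.

  \<open>L\<close> carries no regularity of its own, so the equation is written for \<open>F\<close>
  on a line. One plane with nonzero torsion settles all directions at the point, because every
  vector has the same two lengths as some vector of that plane.\<close>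

lemma Ck_on_cong:
  assumes "open S" "\<And>x. x \<in> S \<Longrightarrow> f x = g x" "Ck_on k S f"
  shows "Ck_on k S g"
  using assms(2,3)
proof (induction k arbitrary: f g)
  case 0
  then show ?case by (metis Ck_on.simps(1) continuous_on_cong)
next
  case (Suc k)
  have *: "(g has_derivative frechet_derivative f (at x)) (at x)" if "x \<in> S" for x
    using Suc.prems that assms(1)
    by (auto simp: frechet_derivative_works intro: has_derivative_transform_within_open)
  then have "frechet_derivative f (at x) = frechet_derivative g (at x)" if "x \<in> S" for x
    using frechet_derivative_at that by blast
  with Suc.IH[of "\<lambda>x. frechet_derivative f (at x) v" "\<lambda>x. frechet_derivative g (at x) v" for v]
  show ?case
    using Suc.prems(2) * by (auto simp: differentiable_def)
qed

text \<open>\<open>Ck_on\<close> is phrased with the chosen \<open>frechet_derivative\<close>;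
  uniqueness of the derivative allows any explicit formula \<open>f'\<close> in its place. The
  closure lemmas below rest on this rule.\<close>

lemma Ck_on_SucI:
  assumes "open S"
    and "\<And>x. x \<in> S \<Longrightarrow> (f has_derivative f' x) (at x)"
    and "\<And>v. Ck_on k S (\<lambda>x. f' x v)"
  shows "Ck_on (Suc k) S f"
proof -
  have "frechet_derivative f (at x) = f' x" if "x \<in> S" for x
    using assms(2)[OF that] frechet_derivative_at by metis
  then show ?thesis
    using assms(2,3) Ck_on_cong[OF assms(1), of "\<lambda>x. f' x v" "\<lambda>x. frechet_derivative f (at x) v" for v]
    by (auto simp: differentiable_def)
qed

lemma Ck_on_has_derivative:
  "Ck_on (Suc k) S f \<Longrightarrow> x \<in> S \<Longrightarrow> (f has_derivative frechet_derivative f (at x)) (at x)"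
  by (simp add: frechet_derivative_works)

lemma Ck_on_SucD: "Ck_on (Suc k) S f \<Longrightarrow> Ck_on k S f"
proof (induction k arbitrary: f)
  case 0
  then show ?case
    by (auto intro!: continuous_at_imp_continuous_on differentiable_imp_continuous_within)
qed auto

lemma Ck_on_const: "open S \<Longrightarrow> Ck_on k S (\<lambda>x. c)"
proof (induction k arbitrary: c)
  case (Suc k)
  show ?case
    by (rule Ck_on_SucI[OF _ has_derivative_const]) (use Suc in auto)
qed auto

lemma Ck_on_add:
  assumes "open S" "Ck_on k S f" "Ck_on k S g"
  shows "Ck_on k S (\<lambda>x. f x + g x)"
  using assms(2,3)
proof (induction k arbitrary: f g)
  case 0
  then show ?case by (auto intro: continuous_on_add)
next
  case (Suc k)
  show ?case
    by (rule Ck_on_SucI[OF assms(1)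
          has_derivative_add[OF Suc.prems[THEN Ck_on_has_derivative]] Suc.IH])
      (use Suc.prems assms(1) in auto)
qed

lemma Ck_on_mult:
  fixes f g :: "'a::euclidean_space \<Rightarrow> real"
  assumes "open S" "Ck_on k S f" "Ck_on k S g"
  shows "Ck_on k S (\<lambda>x. f x * g x)"
  using assms(2,3)
proof (induction k arbitrary: f g)
  case 0
  then show ?case by (auto intro: continuous_on_mult)
next
  case (Suc k)
  note 1 = Suc.prems[THEN Ck_on_SucD]
  show ?case
    by (rule Ck_on_SucI[OF assms(1)
          has_derivative_mult[OF Suc.prems[THEN Ck_on_has_derivative]]])
      (use Suc.prems in \<open>auto intro!: Ck_on_add assms(1) Suc.IH 1\<close>)
qed

lemma Ck_on_inverse:
  fixes f :: "'a::euclidean_space \<Rightarrow> real"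
  assumes "open S" "Ck_on k S f" "\<And>x. x \<in> S \<Longrightarrow> f x \<noteq> 0"
  shows "Ck_on k S (\<lambda>x. inverse (f x))"
  using assms(2)
proof (induction k)
  case 0
  then show ?case using assms(3) by (auto intro: continuous_on_inverse)
next
  case (Suc k)
  note IH = Suc.IH[OF Ck_on_SucD[OF Suc.prems]]
  \<comment> \<open>The derivative of the reciprocal contains the reciprocal again, so the induction
    hypothesis feeds the product rule; the sign is written as the factor \<open>- 1\<close>.\<close>
  have "Ck_on k S (\<lambda>x. - 1 * (inverse (f x) * frechet_derivative f (at x) v * inverse (f x)))" for v
    using Suc.prems IH assms(1) by (intro Ck_on_mult Ck_on_const) auto
  then show ?case
    using assms(3)
    by (intro Ck_on_SucI[OF assms(1)
          Deriv.has_derivative_inverse[OF _ Ck_on_has_derivative[OF Suc.prems]]]) auto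
qed

text \<open>For an affine inner map the derivative in direction \<open>v\<close> is again such a
  composition, now of the derivative of \<open>f\<close> in the constant direction
  \<open>l v\<close>. The induction therefore closes without a chain rule of order
  \<open>k\<close>.\<close>

lemma Ck_on_affine_compose:
  fixes l :: "'c::euclidean_space \<Rightarrow> 'a::euclidean_space"
  assumes "open S" "open T" "bounded_linear l" "\<And>z. z \<in> T \<Longrightarrow> b + l z \<in> S" "Ck_on k S f"
  shows "Ck_on k T (\<lambda>z. f (b + l z))"
  using assms(5)
proof (induction k arbitrary: f)
  case 0
  have "continuous_on T (\<lambda>z. b + l z)"
    using assms(3) by (intro continuous_intros linear_continuous_on)
  with 0 show ?case
    using assms(4) by (auto intro: continuous_on_compose2)
next
  case (Suc k)
  show ?case
  proof (rule Ck_on_SucI[OF assms(2)])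
    show "((\<lambda>z. f (b + l z)) has_derivative (\<lambda>v. frechet_derivative f (at (b + l z)) (l v))) (at z)"
      if "z \<in> T" for z
    proof -
      have "((\<lambda>z. b + l z) has_derivative l) (at z)"
        using assms(3) by (auto intro!: derivative_eq_intros bounded_linear_imp_has_derivative)
      from has_derivative_compose[OF this Ck_on_has_derivative[OF Suc.prems assms(4)[OF that]]]
      show ?thesis .
    qed
  qed (use Suc assms(2) in auto)
qed

lemma smooth_on_cong:
  "open S \<Longrightarrow> (\<And>x. x \<in> S \<Longrightarrow> f x = g x) \<Longrightarrow> smooth_on S f \<Longrightarrow> smooth_on S g"
  unfolding smooth_on_def by (metis Ck_on_cong)

lemma smooth_on_has_derivative:
  "smooth_on S f \<Longrightarrow> x \<in> S \<Longrightarrow> (f has_derivative frechet_derivative f (at x)) (at x)"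
  unfolding smooth_on_def using Ck_on_has_derivative by blast

lemma smooth_on_differentiable: "smooth_on S f \<Longrightarrow> x \<in> S \<Longrightarrow> f differentiable at x"
  using smooth_on_has_derivative differentiable_def by blast

lemma smooth_on_frechet_derivative:
  "smooth_on S f \<Longrightarrow> smooth_on S (\<lambda>x. frechet_derivative f (at x) v)"
  unfolding smooth_on_def by (metis Ck_on.simps(2))

lemma smooth_on_const: "open S \<Longrightarrow> smooth_on S (\<lambda>x. c)"
  by (simp add: smooth_on_def Ck_on_const)

lemma smooth_on_add:
  "open S \<Longrightarrow> smooth_on S f \<Longrightarrow> smooth_on S g \<Longrightarrow> smooth_on S (\<lambda>x. f x + g x)"
  by (simp add: smooth_on_def Ck_on_add)

lemma smooth_on_mult:
  fixes f g :: "'a::euclidean_space \<Rightarrow> real"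
  shows "open S \<Longrightarrow> smooth_on S f \<Longrightarrow> smooth_on S g \<Longrightarrow> smooth_on S (\<lambda>x. f x * g x)"
  by (simp add: smooth_on_def Ck_on_mult)

lemma smooth_on_diff:
  fixes f g :: "'a::euclidean_space \<Rightarrow> real"
  assumes "open S" "smooth_on S f" "smooth_on S g"
  shows "smooth_on S (\<lambda>x. f x - g x)"
  using smooth_on_add[OF assms(1,2) smooth_on_mult[OF assms(1) smooth_on_const[of S "-1"] assms(3)]]
    assms(1) by simp

lemma smooth_on_divide:
  fixes f g :: "'a::euclidean_space \<Rightarrow> real"
  assumes "open S" "smooth_on S f" "smooth_on S g" "\<And>x. x \<in> S \<Longrightarrow> g x \<noteq> 0"
  shows "smooth_on S (\<lambda>x. f x / g x)"
  using assms unfolding divide_inverse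
  by (intro smooth_on_mult) (auto simp: smooth_on_def intro: Ck_on_inverse)

lemma smooth_on_sum:
  assumes "open S" "\<And>i. i \<in> I \<Longrightarrow> smooth_on S (f i)"
  shows "smooth_on S (\<lambda>x. \<Sum>i\<in>I. f i x)"
  using assms(2)
  by (induction I rule: infinite_finite_induct) (auto intro!: smooth_on_add smooth_on_const assms(1))

lemma smooth_on_prod:
  fixes f :: "'i \<Rightarrow> 'a::euclidean_space \<Rightarrow> real"
  assumes "open S" "\<And>i. i \<in> I \<Longrightarrow> smooth_on S (f i)"
  shows "smooth_on S (\<lambda>x. \<Prod>i\<in>I. f i x)"
  using assms(2)
  by (induction I rule: infinite_finite_induct) (auto intro!: smooth_on_mult smooth_on_const assms(1))

lemma smooth_on_affine_compose:
  fixes l :: "'c::euclidean_space \<Rightarrow> 'a::euclidean_space"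
  assumes "open S" "open T" "bounded_linear l" "\<And>z. z \<in> T \<Longrightarrow> b + l z \<in> S" "smooth_on S f"
  shows "smooth_on T (\<lambda>z. f (b + l z))"
  using assms Ck_on_affine_compose by (metis smooth_on_def)

lemma smooth_on_linear:
  fixes l :: "'a::euclidean_space \<Rightarrow> 'b::real_normed_vector"
  assumes "open S" "bounded_linear l"
  shows "smooth_on S l"
  unfolding smooth_on_def
proof
  fix k
  show "Ck_on k S l"
  proof (cases k)
    case 0
    then show ?thesis using assms(2) by (simp add: linear_continuous_on)
  next
    case (Suc k)
    show ?thesis
      unfolding Suc
      by (rule Ck_on_SucI[OF assms(1) bounded_linear_imp_has_derivative[OF assms(2)]])
        (rule Ck_on_const[OF assms(1)])
  qed
qed

lemma smooth_on_det:
  fixes M :: "'a::euclidean_space \<Rightarrow> real^'n^'n::finite"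
  assumes "open S" "\<And>i j. smooth_on S (\<lambda>x. M x $ i $ j)"
  shows "smooth_on S (\<lambda>x. det (M x))"
  unfolding det_def
  by (intro smooth_on_sum smooth_on_mult smooth_on_prod smooth_on_const assms)

lemma matrix_inv_right_det:
  fixes M :: "real^'n^'n::finite"
  assumes "det M \<noteq> 0"
  shows "M ** matrix_inv M = mat 1"
proof -
  have "\<exists>M'. M ** M' = mat 1 \<and> M' ** M = mat 1"
    using assms invertible_det_nz[of M] by (simp add: invertible_def)
  then show ?thesis
    unfolding matrix_inv_def by (rule someI2_ex) simp
qed

text \<open>Cramer's rule writes each component of the solution as a quotient of two determinants,
  which are polynomials in the entries.\<close>

lemma smooth_on_matrix_inv_mult:
  fixes M :: "'a::euclidean_space \<Rightarrow> real^'n^'n::finite"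
  assumes "open S" "\<And>i j. smooth_on S (\<lambda>x. M x $ i $ j)" "\<And>i. smooth_on S (\<lambda>x. b x $ i)"
    and "\<And>x. x \<in> S \<Longrightarrow> det (M x) \<noteq> 0"
  shows "smooth_on S (\<lambda>x. (matrix_inv (M x) *v b x) $ k)"
proof (rule smooth_on_cong[OF assms(1)])
  let ?C = "\<lambda>x. \<chi> i j. if j = k then b x $ i else M x $ i $ j"
  show "smooth_on S (\<lambda>x. det (?C x) / det (M x))"
  proof (rule smooth_on_divide[OF assms(1) _ smooth_on_det[OF assms(1,2)] assms(4)])
    have "smooth_on S (\<lambda>x. ?C x $ i $ j)" for i j
      using assms(2)[of i j] assms(3)[of i] by (cases "j = k") simp_all
    then show "smooth_on S (\<lambda>x. det (?C x))"
      by (rule smooth_on_det[OF assms(1)])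
  qed
  show "det (?C x) / det (M x) = (matrix_inv (M x) *v b x) $ k" if "x \<in> S" for x
  proof -
    have "M x *v (matrix_inv (M x) *v b x) = b x"
      using matrix_inv_right_det[OF assms(4)[OF that]]
      by (metis matrix_vector_mul_assoc matrix_vector_mul_lid)
    then have e: "matrix_inv (M x) *v b x = (\<chi> k. det (\<chi> i j. if j = k then b x $ i else M x $ i $ j) / det (M x))"
      using cramer[OF assms(4)[OF that]] by blast
    show ?thesis unfolding e vec_lambda_beta ..
  qed
qed

lemma smooth_on_real_derivative:
  fixes \<phi> :: "real \<Rightarrow> real"
  assumes "smooth_on UNIV \<phi>"
  shows "(\<phi> has_real_derivative deriv \<phi> x) (at x)" "smooth_on UNIV (deriv \<phi>)"
proof -
  have D: "(\<phi> has_real_derivative frechet_derivative \<phi> (at x) 1) (at x)" for x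
  proof -
    note d = smooth_on_has_derivative[OF assms UNIV_I, of x]
    have "h * frechet_derivative \<phi> (at x) 1 = frechet_derivative \<phi> (at x) h" for h
      using linear_cmul[OF has_derivative_linear[OF d], of h 1] by simp
    then show ?thesis
      by (rule has_derivative_imp_has_field_derivative[OF d])
  qed
  have e: "deriv \<phi> = (\<lambda>x. frechet_derivative \<phi> (at x) 1)"
    by (rule ext, rule DERIV_imp_deriv, rule D)
  show "(\<phi> has_real_derivative deriv \<phi> x) (at x)"
    unfolding e by (rule D)
  show "smooth_on UNIV (deriv \<phi>)"
    unfolding e by (rule smooth_on_frechet_derivative[OF assms])
qed

section \<open>The Landsberg equation in dimension two\<close>

lemma deriv_even_odd:
  fixes f :: "real \<Rightarrow> real"
  assumes "\<And>x. (f has_real_derivative f' x) (at x)"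
  shows "(\<And>x. f (- x) = f x) \<Longrightarrow> f' (- x) = - f' x"
    and "(\<And>x. f (- x) = - f x) \<Longrightarrow> f' (- x) = f' x"
proof -
  have *: "((\<lambda>x. f (- x)) has_real_derivative - f' (- x)) (at x)"
    using assms DERIV_mirror[where f = f and x = x] by blast
  show "f' (- x) = - f' x" if even: "\<And>x. f (- x) = f x"
  proof -
    have "(f has_real_derivative - f' (- x)) (at x)" using * unfolding even .
    from DERIV_unique[OF assms this] show ?thesis by simp
  qed
  show "f' (- x) = f' x" if odd: "\<And>x. f (- x) = - f x"
  proof -
    have "((\<lambda>x. - f x) has_real_derivative - f' (- x)) (at x)" using * unfolding odd .
    from DERIV_unique[OF DERIV_minus[OF assms] this] show ?thesis by simp
  qed
qed

lemma linear_derivative_imp_quadratic: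
  fixes f f' :: "real \<Rightarrow> real"
  assumes "\<And>x. (f has_real_derivative f' x) (at x)" and "\<And>x. f' x = c * x"
  shows "f x = f 0 + c / 2 * x\<^sup>2"
proof -
  have "((\<lambda>x. f x - c / 2 * x\<^sup>2) has_real_derivative 0) (at x)" for x
    by (auto intro!: derivative_eq_intros assms(1) simp: assms(2))
  then have "f x - c / 2 * x\<^sup>2 = f 0 - c / 2 * 0\<^sup>2"
    by (intro DERIV_isconst_all[of "\<lambda>x. f x - c / 2 * x\<^sup>2"] allI)
  then show ?thesis by simp
qed

text \<open>In a plane with coordinates \<open>(p, q)\<close> and \<open>E = F\<^sup>2 / 2\<close>, the function \<open>\<phi>\<close> is the restriction of \<open>E\<close>
  to the line \<open>q = 1\<close>; by homogeneity \<open>E\<^sub>p = \<phi>'\<close>, \<open>E\<^sub>q = 2 \<phi> - p \<phi>'\<close> and \<open>2 \<phi> \<phi>'' - \<phi>'\<^sup>2\<close> is the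
  determinant of the Hessian of \<open>E\<close>. The hypothesis is that the vector field
  \<open>(-m E\<^sub>q, m E\<^sub>p)\<close> satisfies the Landsberg equation. It forces the main scalar
  \<open>\<phi> D' / D powr (3/2)\<close> to be constant (its derivative is a multiple of \<open>K\<close> below),
  and the symmetry of \<open>\<phi>\<close> forces this constant to be \<open>0\<close>.\<close>

lemma landsberg_plane_quadratic:
  fixes \<phi> m :: "real \<Rightarrow> real" and a b :: real
  assumes smooth: "smooth_on UNIV \<phi>" "smooth_on UNIV m"
    and even: "\<And>p. \<phi> (- p) = \<phi> p" and pos: "\<And>p. \<phi> p > 0"
    and D_pos: "\<And>p. 2 * \<phi> p * deriv (deriv \<phi>) p - (deriv \<phi> p)\<^sup>2 > 0"
    and m: "\<And>p. m p * (2 * \<phi> p * deriv (deriv \<phi>) p - (deriv \<phi> p)\<^sup>2) =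
      a * deriv \<phi> p + b * (2 * \<phi> p - p * deriv \<phi> p)"
    and ab: "a \<noteq> 0 \<or> b \<noteq> 0"
    and landsberg: "\<And>p. deriv \<phi> p * (deriv ^^ 3) (\<lambda>p. - m p * (2 * \<phi> p - p * deriv \<phi> p)) p +
      (2 * \<phi> p - p * deriv \<phi> p) * (deriv ^^ 3) (\<lambda>p. m p * deriv \<phi> p) p = 0"
  shows "\<exists>\<kappa>. \<forall>p. \<phi> p = \<phi> 0 + \<kappa> * p\<^sup>2"
proof -
  define f1 f2 f3 f4 f5 where f: "f1 = deriv \<phi>" "f2 = deriv f1" "f3 = deriv f2" "f4 = deriv f3" "f5 = deriv f4"
  define m1 m2 m3 where ms: "m1 = deriv m" "m2 = deriv m1" "m3 = deriv m2"
  note smooth_deriv = smooth_on_real_derivative(2)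
  have sm: "smooth_on UNIV f1" "smooth_on UNIV m1"
    unfolding f(1) ms(1) using smooth[THEN smooth_deriv] .
  have sm2: "smooth_on UNIV f2" "smooth_on UNIV m2"
    unfolding f(2) ms(2) using sm[THEN smooth_deriv] .
  have sm3: "smooth_on UNIV f3" unfolding f(3) using smooth_deriv[OF sm2(1)] .
  have sm4: "smooth_on UNIV f4" unfolding f(4) using smooth_deriv[OF sm3] .
  note D = smooth_on_real_derivative(1)
  have d [derivative_intros]: "(\<phi> has_real_derivative f1 x) (at x)" "(f1 has_real_derivative f2 x) (at x)"
     "(f2 has_real_derivative f3 x) (at x)" "(f3 has_real_derivative f4 x) (at x)" "(f4 has_real_derivative f5 x) (at x)"
     "(m has_real_derivative m1 x) (at x)" "(m1 has_real_derivative m2 x) (at x)" "(m2 has_real_derivative m3 x) (at x)"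
    for x
    using D[OF smooth(1)] D[OF sm(1)] D[OF sm2(1)] D[OF sm3] D[OF sm4] D[OF smooth(2)] D[OF sm(2)] D[OF sm2(2)]
    by (simp_all only: f[symmetric] ms[symmetric])
  have cube: "(deriv ^^ 3) g = g3" if "\<And>x. (g has_real_derivative g1 x) (at x)"
    "\<And>x. (g1 has_real_derivative g2 x) (at x)" "\<And>x. (g2 has_real_derivative g3 x) (at x)"
    for g g1 g2 g3 :: "real \<Rightarrow> real"
  proof -
    have "deriv g = g1" "deriv g1 = g2" "deriv g2 = g3"
      by (rule ext, rule DERIV_imp_deriv, rule that)+
    then show ?thesis by (simp add: numeral_3_eq_3)
  qed
  define Y1 where "Y1 = (\<lambda>p. - m p * (2 * \<phi> p - p * f1 p))"
  define Y1''' where "Y1''' = (\<lambda>p. - m3 p * (2 * \<phi> p - p * f1 p) - 3 * m2 p * (f1 p - p * f2 p)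
    + 3 * m1 p * p * f3 p + m p * (f3 p + p * f4 p))"
  define Y2''' where "Y2''' = (\<lambda>p. m3 p * f1 p + 3 * m2 p * f2 p + 3 * m1 p * f3 p + m p * f4 p)"
  have Y1: "(deriv ^^ 3) Y1 = Y1'''"
    unfolding Y1_def Y1'''_def
    by (rule cube[where
          ?g1.0 = "\<lambda>p. - m1 p * (2 * \<phi> p - p * f1 p) - m p * (f1 p - p * f2 p)" and
          ?g2.0 = "\<lambda>p. - m2 p * (2 * \<phi> p - p * f1 p) - 2 * m1 p * (f1 p - p * f2 p) + m p * p * f3 p"])
      (auto intro!: derivative_eq_intros simp: algebra_simps)
  have Y2: "(deriv ^^ 3) (\<lambda>p. m p * f1 p) = Y2'''"
    unfolding Y2'''_def
    by (rule cube[where ?g1.0 = "\<lambda>p. m1 p * f1 p + m p * f2 p"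
          and ?g2.0 = "\<lambda>p. m2 p * f1 p + 2 * m1 p * f2 p + m p * f3 p"])
      (auto intro!: derivative_eq_intros simp: algebra_simps)
  have eq: "f1 p * Y1''' p + (2 * \<phi> p - p * f1 p) * Y2''' p = 0" for p
    using landsberg[of p] Y1 Y2 by (simp only: f(1)[symmetric] Y1_def[symmetric])
  \<comment> \<open>\<open>D\<close> is the Hessian determinant of \<open>E\<close> on the line. In
    its derivative the terms \<open>2 * f1 p * f2 p\<close> cancel, which leaves
    \<open>D'\<close>.\<close>
  define D D' D'' where Ds: "D p = 2 * \<phi> p * f2 p - (f1 p)\<^sup>2" "D' p = 2 * \<phi> p * f3 p"
    "D'' p = 2 * f1 p * f3 p + 2 * \<phi> p * f4 p" for p
  define H H1 H2 where Hs: "H p = a * f1 p + b * (2 * \<phi> p - p * f1 p)"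
    "H1 p = a * f2 p + b * (f1 p - p * f2 p)" "H2 p = a * f3 p - b * p * f3 p" for p
  \<comment> \<open>\<open>K\<close> is what remains of the Landsberg equation once
    \<open>m\<close>, \<open>m1\<close> and \<open>m2\<close> are eliminated through
    \<open>m * D = H\<close> and its first two derivatives.\<close>
  define K where "K p = 3 * (D' p)\<^sup>2 - 2 * D p * D'' p - 4 * f1 p * f3 p * D p" for p
  have D_abs: "D = (\<lambda>p. 2 * \<phi> p * f2 p - (f1 p)\<^sup>2)" "D' = (\<lambda>p. 2 * \<phi> p * f3 p)"
    "D'' = (\<lambda>p. 2 * f1 p * f3 p + 2 * \<phi> p * f4 p)"
    and H_abs: "H = (\<lambda>p. a * f1 p + b * (2 * \<phi> p - p * f1 p))"
    "H1 = (\<lambda>p. a * f2 p + b * (f1 p - p * f2 p))" "H2 = (\<lambda>p. a * f3 p - b * p * f3 p)"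
    by (simp_all add: fun_eq_iff Ds Hs)
  have Dd [derivative_intros]: "(D has_real_derivative D' x) (at x)" "(D' has_real_derivative D'' x) (at x)" for x
    unfolding D_abs by (auto intro!: derivative_eq_intros simp: algebra_simps power2_eq_square)
  have Hd [derivative_intros]: "(H has_real_derivative H1 x) (at x)" "(H1 has_real_derivative H2 x) (at x)" for x
    unfolding H_abs by (auto intro!: derivative_eq_intros simp: algebra_simps)
  have Dp: "D p > 0" for p using D_pos[of p] by (simp add: Ds f)
  have mD: "(\<lambda>p. m p * D p) = H" using m by (simp add: Ds Hs f fun_eq_iff)
  have mD': "(\<lambda>p. m1 p * D p + m p * D' p) = H1"
  proof
    fix p
    have "((\<lambda>p. m p * D p) has_real_derivative m1 p * D p + m p * D' p) (at p)"
      by (auto intro!: derivative_eq_intros simp: algebra_simps)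
    then show "m1 p * D p + m p * D' p = H1 p"
      unfolding mD by (rule DERIV_unique) (rule Hd)
  qed
  have mD'': "(\<lambda>p. m2 p * D p + 2 * m1 p * D' p + m p * D'' p) = H2"
  proof
    fix p
    have "((\<lambda>p. m1 p * D p + m p * D' p) has_real_derivative m2 p * D p + 2 * m1 p * D' p + m p * D'' p) (at p)"
      by (auto intro!: derivative_eq_intros simp: algebra_simps)
    then show "m2 p * D p + 2 * m1 p * D' p + m p * D'' p = H2 p"
      unfolding mD' by (rule DERIV_unique) (rule Hd)
  qed
  have HK: "H p * K p = 0" for p
  proof -
    \<comment> \<open>The terms in \<open>m3\<close> cancel because the field is a multiple of the
      rotated gradient, which the differential of \<open>E\<close> annihilates.\<close>
    have "f1 p * Y1''' p + (2 * \<phi> p - p * f1 p) * Y2''' p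
        = 3 * D p * m2 p + 3 * D' p * m1 p + (D'' p - f1 p * f3 p) * m p"
      unfolding Y1'''_def Y2'''_def Ds by (simp add: algebra_simps power2_eq_square)
    then have e: "3 * D p * m2 p + 3 * D' p * m1 p + (D'' p - f1 p * f3 p) * m p = 0"
      using eq[of p] by simp
    \<comment> \<open>Both \<open>f1\<close> and \<open>2 * \<phi> p - p * f1 p\<close> solve this
      linear equation of second order, hence so does their combination \<open>H\<close>.\<close>
    have h: "D p * H2 p = D' p * H1 p - f1 p * f3 p * H p"
      unfolding Ds Hs by (simp add: algebra_simps power2_eq_square)
    have "H p * K p = (D p)\<^sup>2 * (3 * D p * m2 p + 3 * D' p * m1 p + (D'' p - f1 p * f3 p) * m p)
      - 3 * D p * (D p * H2 p - (D' p * H1 p - f1 p * f3 p * H p))"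
      unfolding K_def mD[symmetric] mD'[symmetric] mD''[symmetric]
      by (simp add: algebra_simps power2_eq_square)
    with e h show ?thesis by simp
  qed
  \<comment> \<open>Where \<open>H\<close> vanishes, differentiating \<open>H * K = 0\<close> gives
    \<open>H1 * K = 0\<close>. The zeros of \<open>H\<close> are simple, because the Wronskian of
    the two solutions that it combines is \<open>D\<close> up to sign.\<close>
  have K0: "K p = 0" for p
  proof (cases "H p = 0")
    case True
    define K' where "K' = 6 * D' p * D'' p - 2 * D' p * D'' p - 2 * D p * (2 * f2 p * f3 p + 4 * f1 p * f4 p + 2 * \<phi> p * f5 p)
      - 4 * f2 p * f3 p * D p - 4 * f1 p * f4 p * D p - 4 * f1 p * f3 p * D' p"
    have "(D'' has_real_derivative (2 * f2 p * f3 p + 4 * f1 p * f4 p + 2 * \<phi> p * f5 p)) (at p)"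
      unfolding D_abs by (auto intro!: derivative_eq_intros simp: algebra_simps)
    then have "(K has_real_derivative K') (at p)"
      unfolding K_def[abs_def] K'_def
      by (auto intro!: derivative_eq_intros simp: algebra_simps)
    then have "((\<lambda>p. H p * K p) has_real_derivative H1 p * K p + H p * K') (at p)"
      by (auto intro!: derivative_eq_intros simp: algebra_simps)
    then have "((\<lambda>p. 0) has_real_derivative H1 p * K p) (at p)"
      by (simp add: HK True)
    then have "H1 p * K p = 0"
      by (rule DERIV_unique[OF _ DERIV_const])
    moreover have "H1 p \<noteq> 0"
    proof
      assume 1: "H1 p = 0"
      have "b * D p = f2 p * H p - f1 p * H1 p"
        unfolding Hs Ds by (simp add: algebra_simps power2_eq_square)
      then have "b * D p = 0" using 1 True by simp
      then have "b = 0" using Dp[of p] by simp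
      moreover from this ab have "a \<noteq> 0" by simp
      ultimately have "f1 p = 0" "f2 p = 0" using 1 True by (simp_all add: Hs)
      then show False using Dp[of p] by (simp add: Ds)
    qed
    ultimately show ?thesis by simp
  qed (use HK[of p] in simp)
  \<comment> \<open>This is the square of the main scalar; squaring avoids the fractional power of
    \<open>D\<close> and still detects vanishing.\<close>
  define Q where "Q p = (\<phi> p * D' p)\<^sup>2 / (D p)^3" for p
  have "(Q has_real_derivative 0) (at p)" for p
  proof -
    have "((\<lambda>p. (\<phi> p * D' p)\<^sup>2) has_real_derivative 2 * (\<phi> p * D' p) * (f1 p * D' p + \<phi> p * D'' p)) (at p)"
      by (auto intro!: derivative_eq_intros simp: algebra_simps power2_eq_square)
    moreover have "((\<lambda>p. (D p)^3) has_real_derivative 3 * (D p)\<^sup>2 * D' p) (at p)"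
      by (auto intro!: derivative_eq_intros)
    ultimately have "(Q has_real_derivative
        (2 * (\<phi> p * D' p) * (f1 p * D' p + \<phi> p * D'' p) * (D p)^3 - (\<phi> p * D' p)\<^sup>2 * (3 * (D p)\<^sup>2 * D' p))
          / ((D p)^3 * (D p)^3)) (at p)"
      unfolding Q_def[abs_def] using Dp[of p] by (intro DERIV_divide) auto
    moreover have "2 * (\<phi> p * D' p) * (f1 p * D' p + \<phi> p * D'' p) * (D p)^3 - (\<phi> p * D' p)\<^sup>2 * (3 * (D p)\<^sup>2 * D' p)
        = - ((D p)\<^sup>2 * (\<phi> p)\<^sup>2 * D' p * K p)"
      unfolding K_def Ds(2) by (simp add: algebra_simps power2_eq_square power3_eq_cube)
    ultimately show ?thesis by (simp add: K0)
  qed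
  then have Qc: "Q p = Q 0" for p using DERIV_isconst_all[of Q p 0] by blast
  have o1: "f1 (- p) = - f1 p" for p using deriv_even_odd(1)[OF d(1)] even .
  have e2: "f2 (- p) = f2 p" for p using deriv_even_odd(2)[OF d(2)] o1 .
  have o3: "f3 (- p) = - f3 p" for p using deriv_even_odd(1)[OF d(3)] e2 .
  have "Q 0 = 0" using o3[of 0] by (simp add: Q_def Ds)
  then have "f3 p = 0" for p
  proof -
    have "Q p = 0" using Qc \<open>Q 0 = 0\<close> by simp
    then have "\<phi> p * D' p = 0" using Dp[of p] by (simp add: Q_def)
    then show ?thesis using pos[of p] by (simp add: Ds)
  qed
  then have "(f2 has_real_derivative 0) (at p)" for p using d(3)[of p] by simp
  then have f2c: "f2 p = f2 0" for p using DERIV_isconst_all[of f2 p 0] by blast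
  have "((\<lambda>p. f1 p - f2 0 * p) has_real_derivative 0) (at p)" for p
    by (auto intro!: derivative_eq_intros f2c)
  then have "f1 p - f2 0 * p = f1 0 - f2 0 * 0" for p
    using DERIV_isconst_all[of "\<lambda>p. f1 p - f2 0 * p" p 0] by blast
  then have f1e: "f1 p = f2 0 * p" for p using o1[of 0] by simp
  have "\<phi> p = \<phi> 0 + f2 0 / 2 * p\<^sup>2" for p
    by (rule linear_derivative_imp_quadratic[where f' = f1]) (rule d(1), rule f1e)
  then show ?thesis by blast
qed

section \<open>Minkowski norms\<close>

lemma det_eq_0_iff_kernel:
  fixes M :: "real^'n^'n::finite"
  shows "det M = 0 \<longleftrightarrow> (\<exists>v. v \<noteq> 0 \<and> M *v v = 0)"
  using invertible_det_nz[of M] matrix_left_invertible_ker[of M] invertible_left_inverse[of M] by blast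

text \<open>The library version, \<open>measure_linear_image\<close>, needs a wellordered index type.\<close>

lemma measure_matrix_image:
  fixes M :: "real^'n^'n::finite"
  assumes "S \<in> lmeasurable"
  shows "(*v) M ` S \<in> lmeasurable \<and> measure lebesgue ((*v) M ` S) = \<bar>det M\<bar> * measure lebesgue S"
  using assms
proof (induction M arbitrary: S rule: induct_matrix_elementary_alt)
  case (1 A B)
  have "(*v) (A ** B) ` S = (*v) A ` (*v) B ` S"
    by (simp add: image_comp matrix_vector_mult_matrix_matrix_mult_compose)
  then show ?case
    using 1 by (simp add: det_mul abs_mult)
next
  case (2 A i)
  then have det: "det A = 0" by (simp add: det_zero_row(2))
  then obtain v where "v \<noteq> 0" "A *v v = 0" using det_eq_0_iff_kernel by blast
  then have "\<not> inj ((*v) A)" by (metis injD matrix_vector_mult_0_right)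
  then have "negligible ((*v) A ` S)"
    by (intro negligible_linear_singular_image) auto
  then show ?case
    by (simp add: det negligible_iff_measure)
next
  case (3 A)
  have "A *v x = (\<chi> k. A $ k $ k * x $ k)" for x
  proof -
    have "(\<Sum>j\<in>UNIV. A $ k $ j * x $ j) = (\<Sum>j\<in>UNIV. if j = k then A $ k $ k * x $ k else 0)" for k
      using 3 by (intro sum.cong) auto
    then show ?thesis by (simp add: matrix_vector_mult_def vec_eq_iff)
  qed
  then have "(*v) A = (\<lambda>x. \<chi> k. A $ k $ k * x $ k)" by blast
  moreover have "det A = (\<Prod>k\<in>UNIV. A $ k $ k)" using 3 by (simp add: det_diagonal)
  ultimately show ?case
    using measurable_stretch[OF 3(2)] measure_stretch[OF 3(2)] by metis
next
  case (4 m n)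
  let ?A = "\<chi> i j. (mat 1 :: real^'n^'n) $ i $ Transposition.transpose m n j"
  let ?h = "\<lambda>x :: real^'n. \<chi> i. x $ Transposition.transpose m n i"
  have A: "(*v) ?A = ?h"
  proof (intro ext, simp only: vec_eq_iff, intro allI)
    fix x i
    have "(?A *v x) $ i = (\<Sum>j\<in>UNIV. if j = Transposition.transpose m n i then x $ j else 0)"
    proof -
      have "i = Transposition.transpose m n j \<longleftrightarrow> j = Transposition.transpose m n i" for j
        by (metis transpose_involutory)
      then show ?thesis
        by (simp add: matrix_vector_mult_def mat_def if_distrib[of "\<lambda>t. t * _"] cong: if_cong)
    qed
    also have "\<dots> = ?h x $ i" by simp
    finally show "(?A *v x) $ i = ?h x $ i" .
  qed
  have d: "\<bar>det ?A\<bar> = 1"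
    by (simp add: det_permute_columns permutes_swap_id sign_swap_id abs_mult)
  \<comment> \<open>By \<open>measure_linear_sufficient\<close> boxes are enough, and this map sends
    a box to the box with permuted sides.\<close>
  have "measure lebesgue (?h ` cbox a b) = 1 * measure lebesgue (cbox a b)" for a b
  proof -
    have hh: "?h (?h x) = x" for x by (simp add: vec_eq_iff)
    have mem: "?h x \<in> cbox (?h a) (?h b) \<longleftrightarrow> x \<in> cbox a b" for x a b
      unfolding mem_box_cart vec_lambda_beta by (metis transpose_involutory)
    have eq: "?h ` cbox a b = cbox (?h a) (?h b)"
    proof (intro equalityI subsetI)
      fix y assume "y \<in> cbox (?h a) (?h b)"
      then have "?h y \<in> cbox a b" using mem[of y "?h a" "?h b"] unfolding hh by (simp add: mem hh)
      then show "y \<in> ?h ` cbox a b" using hh[of y] by (metis image_eqI)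
    qed (use mem in blast)
    have "(\<Prod>i\<in>UNIV. (b - a) $ Transposition.transpose m n i) = (\<Prod>i\<in>UNIV. (b - a) $ i)"
      using prod.permute[OF permutes_swap_id, where S = UNIV and g = "\<lambda>i. (b - a) $ i"] by (simp add: o_def)
    moreover have "cbox (?h a) (?h b) = {} \<longleftrightarrow> cbox a b = {}" using eq by (metis image_is_empty)
    ultimately show ?thesis
      unfolding eq by (simp add: content_cbox_if_cart)
  qed
  from measure_linear_sufficient[OF _ 4(2) this] show ?case
    unfolding A d by (simp add: linear_iff vec_eq_iff)
next
  case (5 m n)
  let ?A = "\<chi> i j. of_bool (i = m \<and> j = n \<or> i = j) :: real^'n^'n"
  let ?h = "\<lambda>x :: real^'n. \<chi> i. if i = m then x $ m + x $ n else x $ i"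
  have A: "(*v) ?A = ?h"
  proof (intro ext, simp only: vec_eq_iff, intro allI)
    fix x i
    have "(?A *v x) $ i = (\<Sum>j\<in>UNIV. (if j = i then x $ j else 0) + (if j = n then if i = m then x $ j else 0 else 0))"
      unfolding matrix_vector_mult_def using 5 by (auto intro!: sum.cong)
    then show "(?A *v x) $ i = ?h x $ i" by (simp add: sum.distrib)
  qed
  have lin: "linear ?h" unfolding A[symmetric] by simp
  have "?A = (\<chi> k. if k = m then row m (mat 1) + 1 *s row n (mat 1) else row k (mat 1))"
    using 5 by (auto simp: vec_eq_iff row_def mat_def)
  then have d: "\<bar>det ?A\<bar> = 1" using det_row_operation[OF 5(1), of "mat 1" "1 :: real"] by simp
  have "measure lebesgue (?h ` cbox a b) = 1 * measure lebesgue (cbox a b)" for a b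
  proof (cases "cbox a b = {}")
    case False
    \<comment> \<open>\<open>measure_shear_interval\<close> wants the lower
      \<open>n\<close>-coordinate of the box to be nonnegative; this translation moves it to
      \<open>0\<close>.\<close>
    let ?v = "axis n (- a $ n) :: real^'n"
    have "?h ` cbox (?v + a) (?v + b) = (+) (?h ?v) ` ?h ` cbox a b"
      unfolding cbox_translation image_image by (simp add: linear_add[OF lin])
    then have "measure lebesgue (?h ` cbox a b) = measure lebesgue (?h ` cbox (?v + a) (?v + b))"
      by (simp only: measure_translation)
    also have "\<dots> = measure lebesgue (cbox (?v + a) (?v + b))"
      using 5 False by (intro measure_shear_interval) (auto simp: cbox_translation)
    also have "\<dots> = measure lebesgue (cbox a b)"
      unfolding cbox_translation by (rule measure_translation)
    finally show ?thesis by simp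
  qed simp
  from measure_linear_sufficient[OF lin 5(2) this] show ?case
    unfolding A d by simp
qed

text \<open>The segment from the identity to \<open>B\<close> consists of injective matrices, since
  the quadratic form stays positive along it, so the determinant cannot change sign.\<close>

lemma positive_definite_det_pos:
  fixes B :: "real^'n^'n::finite"
  assumes "positive_definite B"
  shows "det B > 0"
proof -
  define M where "M t = (\<chi> i j. (1 - t) * (mat 1 :: real^'n^'n) $ i $ j + t * B $ i $ j)" for t :: real
  have M: "M t *v v = (1 - t) *\<^sub>R v + t *\<^sub>R (B *v v)" for t v
  proof -
    have "M t = (1 - t) *\<^sub>R mat 1 + t *\<^sub>R B" by (simp add: M_def vec_eq_iff)
    then show ?thesis
      by (simp add: matrix_vector_mult_add_rdistrib scaleR_matrix_vector_assoc[symmetric])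
  qed
  have "det (M t) \<noteq> 0" if "0 \<le> t" "t \<le> 1" for t
  proof
    assume "det (M t) = 0"
    then obtain v where v: "v \<noteq> 0" "M t *v v = 0"
      using det_eq_0_iff_kernel by blast
    then have "(1 - t) * (v \<bullet> v) + t * (v \<bullet> (B *v v)) = 0"
      using M[of t v] by (metis inner_add_right inner_scaleR_right inner_zero_right)
    moreover have "v \<bullet> v > 0" "v \<bullet> (B *v v) > 0" using v assms by (auto simp: positive_definite_def)
    moreover have "t = 1 \<or> 1 - t > 0" using that by auto
    ultimately show False
      using that by (metis add_nonneg_pos add_pos_nonneg diff_self less_irrefl less_le_not_le linorder_not_less
          mult_1 mult_nonneg_nonneg mult_pos_pos mult_zero_left add_0)
  qed
  moreover have "continuous_on {0..1} (\<lambda>t. det (M t))"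
    unfolding det_def M_def by (auto intro!: continuous_intros)
  moreover have "M 0 = mat 1" "M 1 = B" by (simp_all add: M_def vec_eq_iff)
  ultimately show ?thesis
    using IVT2'[of "\<lambda>t. det (M t)" 1 0 0] by (force simp: not_less)
qed

lemma linear_axis_sum:
  fixes l :: "real^'n::finite \<Rightarrow> real"
  assumes "linear l"
  shows "l z = (\<Sum>i\<in>UNIV. z $ i * l (axis i 1))"
proof -
  have "l z = l (\<Sum>i\<in>UNIV. z $ i *\<^sub>R axis i 1)"
    by (metis basis_expansion scalar_mult_eq_scaleR)
  then show ?thesis
    by (simp add: linear_sum[OF assms] linear_cmul[OF assms])
qed

locale minkowski =
  fixes F :: "real^'n::finite \<Rightarrow> real"
  assumes minkowski: "minkowski_norm F"
begin

definition N :: "real^'n \<Rightarrow> real" where "N y = (F y)\<^sup>2"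

definition dN :: "real^'n \<Rightarrow> real^'n \<Rightarrow> real" where "dN y z = frechet_derivative N (at y) z"

definition g :: "real^'n \<Rightarrow> real^'n \<Rightarrow> real^'n \<Rightarrow> real" where
  "g y z w = z \<bullet> (fundamental_tensor F y *v w)"

lemma open_slit: "open (- {0 :: real^'n})" by auto

lemma smooth_N: "smooth_on (- {0}) N"
  using minkowski smooth_on_mult[of "- {0}" F F]
  by (simp add: minkowski_norm_def N_def[abs_def] power2_eq_square open_slit)

lemma smooth_dN: "smooth_on (- {0}) (\<lambda>y. dN y z)"
  unfolding dN_def by (rule smooth_on_frechet_derivative[OF smooth_N])

lemma N_has_derivative: "y \<noteq> 0 \<Longrightarrow> (N has_derivative dN y) (at y)"
  using smooth_on_has_derivative[OF smooth_N, of y] by (simp add: dN_def[abs_def])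

lemma linear_dN: "y \<noteq> 0 \<Longrightarrow> linear (dN y)"
  using N_has_derivative has_derivative_linear by blast

lemmas dN_simps = linear_add[OF linear_dN] linear_diff[OF linear_dN] linear_cmul[OF linear_dN]
  linear_neg[OF linear_dN] linear_0[OF linear_dN]

lemma fundamental_tensor_nth:
  "fundamental_tensor F y $ i $ j = (1/2) * frechet_derivative (\<lambda>y. dN y (axis i 1)) (at y) (axis j 1)"
  by (simp add: fundamental_tensor_def pd_def[abs_def] dN_def N_def[abs_def])

lemma smooth_fundamental_tensor: "smooth_on (- {0}) (\<lambda>y. fundamental_tensor F y $ i $ j)"
  unfolding fundamental_tensor_nth
  by (intro smooth_on_mult smooth_on_const smooth_on_frechet_derivative smooth_dN open_slit)

lemma g_sum: "g y z w = (\<Sum>i\<in>UNIV. \<Sum>j\<in>UNIV. z $ i * fundamental_tensor F y $ i $ j * w $ j)"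
  by (simp add: g_def inner_vec_def matrix_vector_mult_def sum_distrib_left mult.assoc)

lemma g_linear [simp]:
  "g y (z + z') w = g y z w + g y z' w" "g y z (w + w') = g y z w + g y z w'"
  "g y (z - z') w = g y z w - g y z' w" "g y z (w - w') = g y z w - g y z w'"
  "g y (r *\<^sub>R z) w = r * g y z w" "g y z (r *\<^sub>R w) = r * g y z w"
  by (simp_all add: g_def inner_add_left inner_diff_left algebra_simps inner_add_right
      matrix_vector_right_distrib matrix_vector_mult_diff_distrib inner_diff_right
      matrix_vector_mult_scaleR)

lemma g_pos: "y \<noteq> 0 \<Longrightarrow> z \<noteq> 0 \<Longrightarrow> g y z z > 0"
  using minkowski by (simp add: minkowski_norm_def positive_definite_def g_def)

lemma g_commute: "y \<noteq> 0 \<Longrightarrow> g y z w = g y w z"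
  using minkowski by (metis minkowski_norm_def positive_definite_def g_def dot_lmul_matrix inner_commute
      transpose_matrix_vector)

lemma det_fundamental_tensor_pos: "y \<noteq> 0 \<Longrightarrow> det (fundamental_tensor F y) > 0"
  using minkowski unfolding minkowski_norm_def by (blast intro: positive_definite_det_pos)

text \<open>\<open>fundamental_tensor\<close> collects second partials in coordinates; expanding
  \<open>z\<close> over the axes upgrades them to the full derivative of \<open>dN\<close>. The
  factor 2 undoes the 1/2 in the tensor.\<close>

lemma dN_has_derivative:
  assumes "y \<noteq> 0"
  shows "((\<lambda>y. dN y z) has_derivative (\<lambda>w. 2 * g y z w)) (at y)"
proof -
  let ?D = "\<lambda>i. frechet_derivative (\<lambda>y. dN y (axis i 1)) (at y)"
  have D: "((\<lambda>y. dN y (axis i 1)) has_derivative ?D i) (at y)" for i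
    using smooth_on_has_derivative[OF smooth_dN] assms by blast
  have "((\<lambda>y. \<Sum>i\<in>UNIV. z $ i * dN y (axis i 1)) has_derivative (\<lambda>w. \<Sum>i\<in>UNIV. z $ i * ?D i w)) (at y)"
    by (intro has_derivative_sum has_derivative_mult_right D)
  then have "((\<lambda>y. dN y z) has_derivative (\<lambda>w. \<Sum>i\<in>UNIV. z $ i * ?D i w)) (at y)"
    by (rule has_derivative_transform_within_open[OF _ open_slit])
      (use assms linear_axis_sum[OF linear_dN, of _ z] in auto)
  moreover have "(\<Sum>i\<in>UNIV. z $ i * ?D i w) = 2 * g y z w" for w
  proof -
    have "?D i w = (\<Sum>j\<in>UNIV. w $ j * (2 * fundamental_tensor F y $ i $ j))" for i
      using linear_axis_sum[OF has_derivative_linear[OF D], of i w]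
      by (simp add: fundamental_tensor_nth)
    then show ?thesis
      by (simp add: g_sum sum_distrib_left mult_ac)
  qed
  ultimately show ?thesis by simp
qed

lemma N_scaleR: "r > 0 \<Longrightarrow> N (r *\<^sub>R y) = r\<^sup>2 * N y"
  using minkowski by (simp add: minkowski_norm_def N_def power_mult_distrib)

lemma N_pos: "y \<noteq> 0 \<Longrightarrow> N y > 0"
  using minkowski by (simp add: minkowski_norm_def N_def)

lemma dN_scaleR:
  assumes "r > 0" "y \<noteq> 0"
  shows "dN (r *\<^sub>R y) z = r * dN y z"
proof -
  have "((\<lambda>y. N (r *\<^sub>R y)) has_derivative (\<lambda>z. dN (r *\<^sub>R y) (r *\<^sub>R z))) (at y)"
    using assms by (intro has_derivative_compose[OF _ N_has_derivative]) (auto intro!: derivative_eq_intros)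
  moreover have "((\<lambda>y. N (r *\<^sub>R y)) has_derivative (\<lambda>z. r\<^sup>2 * dN y z)) (at y)"
    using assms by (simp add: N_scaleR) (intro has_derivative_mult_right N_has_derivative)
  ultimately have "dN (r *\<^sub>R y) (r *\<^sub>R z) = r\<^sup>2 * dN y z"
    using has_derivative_unique by metis
  then show ?thesis
    using assms by (simp add: dN_simps power2_eq_square)
qed

text \<open>Euler's relation in degree two, read off from the \<open>r\<close>-derivative of
  \<open>N_scaleR\<close> at \<open>r = 1\<close>; \<open>euler_dN\<close> does the same in degree
  one.\<close>

lemma euler_N:
  assumes "y \<noteq> 0"
  shows "dN y y = 2 * N y"
proof -
  have s: "((\<lambda>r. r *\<^sub>R y) has_derivative (\<lambda>h. h *\<^sub>R y)) (at 1)"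
    by (auto intro!: derivative_eq_intros)
  have "((\<lambda>r. N (r *\<^sub>R y)) has_derivative (\<lambda>h. dN y (h *\<^sub>R y))) (at 1)"
    using has_derivative_compose[OF s, of N "dN y"] N_has_derivative[OF assms] by simp
  moreover have "((\<lambda>r. N (r *\<^sub>R y)) has_derivative (\<lambda>h. 2 * h * N y)) (at 1)"
    by (rule has_derivative_transform_within_open[of "\<lambda>r. r\<^sup>2 * N y" _ _ _ "{0<..}"])
      (auto intro!: derivative_eq_intros simp: N_scaleR)
  ultimately have "dN y (1 *\<^sub>R y) = 2 * 1 * N y"
    using has_derivative_unique by metis
  then show ?thesis by simp
qed

lemma euler_dN:
  assumes "y \<noteq> 0"
  shows "2 * g y z y = dN y z"
proof -
  have s: "((\<lambda>r. r *\<^sub>R y) has_derivative (\<lambda>h. h *\<^sub>R y)) (at 1)"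
    by (auto intro!: derivative_eq_intros)
  have "((\<lambda>r. dN (r *\<^sub>R y) z) has_derivative (\<lambda>h. 2 * g y z (h *\<^sub>R y))) (at 1)"
    using has_derivative_compose[OF s, of "\<lambda>y. dN y z" "\<lambda>w. 2 * g y z w"] dN_has_derivative[OF assms]
    by simp
  moreover have "((\<lambda>r. dN (r *\<^sub>R y) z) has_derivative (\<lambda>h. h * dN y z)) (at 1)"
    by (rule has_derivative_transform_within_open[of "\<lambda>r. r * dN y z" _ _ _ "{0<..}"])
      (use assms in \<open>auto intro!: derivative_eq_intros simp: dN_scaleR\<close>)
  ultimately have "2 * g y z (1 *\<^sub>R y) = 1 * dN y z"
    using has_derivative_unique by metis
  then show ?thesis by simp
qed

text \<open>Two applications of the chain rule show that the Hessian transforms by congruence.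
  Invertibility of \<open>M\<close> keeps the image of a nonzero vector away from the
  origin.\<close>

lemma fundamental_tensor_compose:
  fixes M :: "real^'n^'n"
  assumes "\<And>y. F' y = F (M *v y)" "det M \<noteq> 0" "y \<noteq> 0"
  shows "fundamental_tensor F' y = transpose M ** fundamental_tensor F (M *v y) ** M"
proof -
  have nz: "M *v y \<noteq> 0" if "y \<noteq> 0" for y
    using assms(2) that det_eq_0_iff_kernel by blast
  have M: "((*v) M has_derivative (*v) M) (at y)" for y
    by (simp add: bounded_linear_imp_has_derivative)
  have 1: "((\<lambda>z. (F' z)\<^sup>2) has_derivative (\<lambda>h. dN (M *v z) (M *v h))) (at z)" if "z \<noteq> 0" for z
    using has_derivative_compose[OF M N_has_derivative[OF nz[OF that]]]
    by (simp add: assms(1) N_def)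
  have p1: "pd i (\<lambda>z. (F' z)\<^sup>2) z = dN (M *v z) (M *v axis i 1)" if "z \<noteq> 0" for i z
    using frechet_derivative_at[OF 1[OF that]] by (simp add: pd_def fun_eq_iff)
  have 2: "((\<lambda>z. dN (M *v z) (M *v axis i 1)) has_derivative
      (\<lambda>h. 2 * g (M *v y) (M *v axis i 1) (M *v h))) (at y)" for i
    using has_derivative_compose[OF M dN_has_derivative[OF nz[OF assms(3)]]] .
  have "(pd i (\<lambda>z. (F' z)\<^sup>2) has_derivative (\<lambda>h. 2 * g (M *v y) (M *v axis i 1) (M *v h))) (at y)" for i
    by (rule has_derivative_transform_within_open[OF 2 open_slit]) (use assms(3) p1 in auto)
  then have "pd j (pd i (\<lambda>z. (F' z)\<^sup>2)) y = 2 * g (M *v y) (M *v axis i 1) (M *v axis j 1)" for i j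
    using frechet_derivative_at by (metis pd_def)
  then have "fundamental_tensor F' y $ i $ j = g (M *v y) (M *v axis i 1) (M *v axis j 1)" for i j
    by (simp add: fundamental_tensor_def)
  moreover have "g (M *v y) (M *v axis i 1) (M *v axis j 1)
      = (transpose M ** fundamental_tensor F (M *v y) ** M) $ i $ j" for i j
  proof -
    have "(transpose M ** fundamental_tensor F (M *v y) ** M) $ i $ j
        = axis i 1 \<bullet> ((transpose M ** fundamental_tensor F (M *v y) ** M) *v axis j 1)"
      by (simp add: inner_axis' matrix_vector_mul_component inner_axis)
    also have "\<dots> = axis i 1 \<bullet> (transpose M *v (fundamental_tensor F (M *v y) *v (M *v axis j 1)))"
      by (simp only: matrix_vector_mul_assoc matrix_mul_assoc)
    also have "\<dots> = g (M *v y) (M *v axis i 1) (M *v axis j 1)"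
      unfolding g_def by (metis dot_lmul_matrix inner_commute transpose_matrix_vector)
    finally show ?thesis by simp
  qed
  ultimately show ?thesis by (simp add: vec_eq_iff)
qed

lemma open_unit_ball: "open {y. F y < 1}"
  using minkowski by (auto simp: minkowski_norm_def intro!: open_Collect_less continuous_on_const)

text \<open>By compactness \<open>F\<close> has a positive minimum on the Euclidean unit sphere, and
  homogeneity turns this into a norm bound. The ball thus has finite volume, as the change of
  variables requires.\<close>

lemma bounded_unit_ball: "bounded {y. F y < 1}"
proof -
  have "continuous_on (sphere 0 1) F"
    using minkowski by (auto simp: minkowski_norm_def intro: continuous_on_subset)
  moreover have "sphere (0::real^'n) 1 \<noteq> {}" by simp
  ultimately obtain a where a: "norm a = 1" "\<And>y. norm y = 1 \<Longrightarrow> F a \<le> F y"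
    using continuous_attains_inf[of "sphere (0::real^'n) 1" F] by auto
  have F_a: "F a > 0"
    using minkowski a(1) by (metis minkowski_norm_def norm_zero order_le_less zero_neq_one)
  have "norm y \<le> 1 / F a" if "F y < 1" for y
  proof (cases "y = 0")
    case False
    then have "F y = norm y * F (y /\<^sub>R norm y)"
      using minkowski by (simp add: minkowski_norm_def)
    moreover have "F a \<le> F (y /\<^sub>R norm y)" using False by (intro a) simp
    ultimately have "norm y * F a \<le> F y" by (simp add: mult_left_mono)
    then show ?thesis using that F_a by (simp add: field_simps)
  qed (use F_a in simp)
  then show ?thesis by (auto simp: bounded_iff)
qed

text \<open>The root of the Hessian determinant and the volume density both pick up the factor
  \<open>\<bar>det M\<bar>\<close>, which cancels in the quotient. So linear isometries preserve the
  distortion.\<close>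

lemma distortion_compose:
  fixes M :: "real^'n^'n"
  assumes "\<And>y. f x y = F (M *v y)" "det M \<noteq> 0" "y \<noteq> 0"
  shows "distortion f x y = ln (sqrt (det (fundamental_tensor F (M *v y))) /
    (measure lborel (ball (0 :: real^'n) 1) / measure lborel {y. F y < 1}))"
proof -
  have lm: "{y. F y < 1} \<in> lmeasurable"
    by (intro bounded_set_imp_lmeasurable bounded_unit_ball) (simp add: open_unit_ball borel_open)
  have inv: "invertible M" using assms(2) by (simp add: invertible_det_nz)
  have "(*v) M ` {y. f x y < 1} = {y. F y < 1}"
  proof (intro equalityI subsetI)
    fix z assume z: "z \<in> {y. F y < 1}"
    obtain y where "z = M *v y"
      using inv by (metis invertible_right_inverse matrix_vector_mul_assoc matrix_vector_mul_lid)
    then show "z \<in> (*v) M ` {y. f x y < 1}" using z by (auto simp: assms(1))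
  qed (auto simp: assms(1))
  moreover have lm': "{y. f x y < 1} \<in> lmeasurable"
  proof -
    obtain M' where M': "M' ** M = mat 1" "M ** M' = mat 1" using inv by (auto simp: invertible_def)
    have "{y. f x y < 1} = (*v) M' ` {y. F y < 1}"
    proof (intro equalityI subsetI)
      fix y assume "y \<in> {y. f x y < 1}"
      moreover have "y = M' *v (M *v y)" by (simp add: matrix_vector_mul_assoc M')
      ultimately show "y \<in> (*v) M' ` {y. F y < 1}" by (auto simp: assms(1))
    qed (auto simp: assms(1) matrix_vector_mul_assoc M')
    then show ?thesis using measure_matrix_image[OF lm, of M'] by simp
  qed
  ultimately have "measure lebesgue {y. F y < 1} = \<bar>det M\<bar> * measure lebesgue {y. f x y < 1}"
    using measure_matrix_image[OF lm', of M] by simp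
  \<comment> \<open>The change of variables is stated for Lebesgue measure and the density for
    \<open>lborel\<close>; on open sets the two agree.\<close>
  moreover have "measure lebesgue S = measure lborel S" if "open S" for S :: "(real^'n) set"
    using that by (simp add: borel_open)
  moreover have "open {y. f x y < 1}"
  proof -
    have "continuous_on UNIV ((*v) M)" by (simp add: linear_continuous_on)
    from open_vimage[OF open_unit_ball this] show ?thesis
      by (simp add: vimage_def assms(1))
  qed
  ultimately have vol: "measure lborel {y. F y < 1} = \<bar>det M\<bar> * measure lborel {y. f x y < 1}"
    by (simp add: open_unit_ball)
  have "f x = (\<lambda>y. F (M *v y))" using assms(1) by blast
  then have "det (g_mat f x y) = (det M)\<^sup>2 * det (fundamental_tensor F (M *v y))"
    unfolding g_mat_def using fundamental_tensor_compose[OF assms]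
    by (simp add: det_mul det_transpose power2_eq_square)
  then have "sqrt (det (g_mat f x y)) = \<bar>det M\<bar> * sqrt (det (fundamental_tensor F (M *v y)))"
    by (simp add: real_sqrt_mult)
  then show ?thesis
    using assms(2) by (simp add: distortion_def vol_density_def vol mult_ac)
qed

end

section \<open>The geodesic spray of a family of linearly equivalent norms\<close>

lemma pd_eq: "(h has_derivative D) (at x) \<Longrightarrow> pd i h x = D (axis i 1)"
  unfolding pd_def using frechet_derivative_at[of h D x] by simp

text \<open>The family is written as \<open>f x y = F (\<Theta> x y)\<close> with \<open>\<Theta> x0 = 1\<close>, and \<open>A\<close> is the derivative of
  \<open>\<Theta>\<close> at \<open>x0\<close>. The spray differs from that of the flat connection \<open>A\<close>, which preserves the norm,
  by the field \<open>Y\<close>, determined by the torsion \<open>c\<close> of that connection.\<close>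

locale linear_family = minkowski F for F :: "real^'n::finite \<Rightarrow> real" +
  fixes f :: "real^'n \<Rightarrow> real^'n \<Rightarrow> real" and x0 :: "real^'n"
    and W :: "(real^'n) set" and \<Theta> A :: "real^'n \<Rightarrow> real^'n^'n"
  assumes W: "open W" "x0 \<in> W" and f: "\<And>x y. x \<in> W \<Longrightarrow> f x y = F (\<Theta> x *v y)"
    and \<Theta>_x0: "\<Theta> x0 = mat 1" and \<Theta>: "(\<Theta> has_derivative A) (at x0)"
begin

definition c :: "real^'n \<Rightarrow> real^'n \<Rightarrow> real^'n" where "c y z = A y *v z - A z *v y"

definition G :: "real^'n \<Rightarrow> real^'n" where "G y = (\<chi> i. spray_coeff f i x0 y)"

definition Y :: "real^'n \<Rightarrow> real^'n" where "Y y = 2 *\<^sub>R G y - A y *v y"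

lemma linear_A: "linear A"
  using \<Theta> has_derivative_linear by blast

lemma A_simps: "A (y + z) = A y + A z" "A (r *\<^sub>R y) = r *\<^sub>R A y"
  using linear_A by (simp_all add: linear_add linear_cmul)

lemma A_mult_simps: "A (y + z) *v w = A y *v w + A z *v w" "A (r *\<^sub>R y) *v w = r *\<^sub>R (A y *v w)"
  by (simp_all add: A_simps matrix_vector_mult_add_rdistrib scaleR_matrix_vector_assoc[symmetric])

lemma A_mult_sum: "A y *v w = (\<Sum>k\<in>UNIV. y $ k *\<^sub>R (A (axis k 1) *v w))"
proof -
  have "linear (\<lambda>y. A y *v w)" by (rule linearI) (rule A_mult_simps)+
  then show ?thesis
    using linear_sum[of "\<lambda>y. A y *v w" "\<lambda>k. y $ k *\<^sub>R axis k 1" UNIV]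
    by (simp add: A_mult_simps basis_expansion[of y, unfolded scalar_mult_eq_scaleR])
qed

lemma f_x0: "f x0 = F"
  using f[OF W(2)] \<Theta>_x0 by auto

lemma has_derivative_\<Theta>_mult: "((\<lambda>x. \<Theta> x *v y) has_derivative (\<lambda>h. A h *v y)) (at x0)"
proof -
  have "linear (\<lambda>M :: real^'n^'n. M *v y)"
    by (rule linearI) (simp_all add: matrix_vector_mult_add_rdistrib scaleR_matrix_vector_assoc)
  then have "bounded_linear (\<lambda>M :: real^'n^'n. M *v y)"
    by (simp add: linear_conv_bounded_linear)
  from bounded_linear.has_derivative[OF this \<Theta>] show ?thesis .
qed

lemma dx_f_squared:
  assumes "y \<noteq> 0"
  shows "dx k (\<lambda>x y. (f x y)\<^sup>2) x0 y = dN y (A (axis k 1) *v y)"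
proof -
  have "((\<lambda>x. N (\<Theta> x *v y)) has_derivative (\<lambda>h. dN y (A h *v y))) (at x0)"
    using has_derivative_compose[OF has_derivative_\<Theta>_mult, of N "dN y" y] N_has_derivative[OF assms]
    by (simp add: \<Theta>_x0)
  then have "((\<lambda>x. (f x y)\<^sup>2) has_derivative (\<lambda>h. dN y (A h *v y))) (at x0)"
    by (rule has_derivative_transform_within_open[OF _ W]) (simp add: N_def f)
  then show ?thesis
    unfolding dx_def by (rule pd_eq)
qed

lemma dy_dx_f_squared:
  assumes "y \<noteq> 0"
  shows "dy l (dx k (\<lambda>x y. (f x y)\<^sup>2)) x0 y =
    2 * g y (A (axis k 1) *v y) (axis l 1) + dN y (A (axis k 1) *v axis l 1)"
proof -
  let ?B = "\<lambda>y. A (axis k 1) *v y"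
  have B: "(?B has_derivative ?B) (at y)" by (simp add: bounded_linear_imp_has_derivative)
  have B_nth: "((\<lambda>y. ?B y $ i) has_derivative (\<lambda>h. ?B h $ i)) (at y)" for i
    by (rule bounded_linear.has_derivative[OF bounded_linear_vec_nth B])
  have sum: "dN y v = (\<Sum>i\<in>UNIV. v $ i * dN y (axis i 1))" if "y \<noteq> 0" for y v
    by (rule linear_axis_sum[OF linear_dN[OF that]])
  \<comment> \<open>Here \<open>y\<close> enters both as the base point of \<open>dN\<close> and
    through its argument; the expansion over the axes makes the product rule applicable.\<close>
  have "((\<lambda>y. \<Sum>i\<in>UNIV. ?B y $ i * dN y (axis i 1)) has_derivative
      (\<lambda>h. \<Sum>i\<in>UNIV. ?B y $ i * (2 * g y (axis i 1) h) + ?B h $ i * dN y (axis i 1))) (at y)"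
    by (intro has_derivative_sum has_derivative_mult B_nth dN_has_derivative assms)
  then have "(dx k (\<lambda>x y. (f x y)\<^sup>2) x0 has_derivative
      (\<lambda>h. \<Sum>i\<in>UNIV. ?B y $ i * (2 * g y (axis i 1) h) + ?B h $ i * dN y (axis i 1))) (at y)"
    by (rule has_derivative_transform_within_open[OF _ open_slit])
      (use assms in \<open>simp_all add: dx_f_squared sum\<close>)
  moreover have "(\<Sum>i\<in>UNIV. ?B y $ i * (2 * g y (axis i 1) h) + ?B h $ i * dN y (axis i 1))
      = 2 * g y (?B y) h + dN y (?B h)" for h
  proof -
    have lin: "linear (\<lambda>v. g y v h)" by (rule linearI) simp_all
    have "(\<Sum>i\<in>UNIV. ?B y $ i * (2 * g y (axis i 1) h) + ?B h $ i * dN y (axis i 1))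
      = 2 * (\<Sum>i\<in>UNIV. ?B y $ i * g y (axis i 1) h) + (\<Sum>i\<in>UNIV. ?B h $ i * dN y (axis i 1))"
      by (simp only: sum.distrib sum_distrib_left mult.left_commute)
    then show ?thesis
      by (simp only: linear_axis_sum[OF lin, of "?B y"] sum[OF assms, of "?B h"])
  qed
  ultimately have "(dx k (\<lambda>x y. (f x y)\<^sup>2) x0 has_derivative (\<lambda>h. 2 * g y (?B y) h + dN y (?B h))) (at y)"
    by simp
  then show ?thesis
    unfolding dy_def by (rule pd_eq)
qed

text \<open>This is the spray with its index lowered by \<open>g\<close>. The torsion appears
  because the two terms of the spray formula leave the difference of \<open>A y *v axis l 1\<close>
  and \<open>A (axis l 1) *v y\<close> under \<open>dN y\<close>.\<close>

definition b :: "real^'n \<Rightarrow> real^'n" where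
  "b y = (\<chi> l. 1/2 * g y (A y *v y) (axis l 1) + 1/4 * dN y (c y (axis l 1)))"

lemma spray_coeff_eq:
  assumes "y \<noteq> 0"
  shows "G y = matrix_inv (fundamental_tensor F y) *v b y"
proof -
  have "(\<Sum>k\<in>UNIV. dy l (dx k (\<lambda>x y. (f x y)\<^sup>2)) x0 y * y $ k) - dx l (\<lambda>x y. (f x y)\<^sup>2) x0 y = 4 * b y $ l" for l
  proof -
    have l1: "linear (\<lambda>v. g y v (axis l 1))" by (rule linearI) simp_all
    have "(\<Sum>k\<in>UNIV. dy l (dx k (\<lambda>x y. (f x y)\<^sup>2)) x0 y * y $ k)
      = 2 * g y (\<Sum>k\<in>UNIV. y $ k *\<^sub>R (A (axis k 1) *v y)) (axis l 1)
        + dN y (\<Sum>k\<in>UNIV. y $ k *\<^sub>R (A (axis k 1) *v axis l 1))"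
      using assms by (simp add: dy_dx_f_squared linear_sum[OF l1] linear_sum[OF linear_dN] linear_cmul[OF linear_dN]
          algebra_simps sum.distrib sum_distrib_left)
    then show ?thesis
      using assms by (simp add: A_mult_sum[symmetric] dx_f_squared b_def c_def dN_simps)
  qed
  then show ?thesis
    by (simp add: G_def spray_coeff_def g_mat_def f_x0 vec_eq_iff matrix_vector_mult_def sum_distrib_left mult_ac)
qed

lemma smooth_A_mult: "smooth_on (- {0}) (\<lambda>y. (A y *v w y) $ i)" if "\<And>j. smooth_on (- {0}) (\<lambda>y. w y $ j)"
proof -
  have "bounded_linear (\<lambda>y. A y $ i $ j)" for j
    using linear_A by (intro linear_conv_bounded_linear[THEN iffD1] linearI) (simp_all add: A_simps)
  then show ?thesis
    unfolding matrix_vector_mult_def vec_lambda_beta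
    by (intro smooth_on_sum smooth_on_mult that smooth_on_linear open_slit)
qed

lemma smooth_nth: "open S \<Longrightarrow> smooth_on S (\<lambda>y :: real^'n. y $ j)"
  by (intro smooth_on_linear bounded_linear_vec_nth)

text \<open>This is what lets third vertical derivatives of the spray be taken along lines. Cramer's
  rule takes care of the inverse of the fundamental tensor.\<close>

lemma smooth_G: "smooth_on (- {0}) (\<lambda>y. G y $ i)"
proof (rule smooth_on_cong[OF open_slit])
  let ?b = "\<lambda>y. \<chi> l. 1/2 * (\<Sum>i\<in>UNIV. \<Sum>j\<in>UNIV. (A y *v y) $ i * fundamental_tensor F y $ i $ j * axis l 1 $ j)
      + 1/4 * (\<Sum>i\<in>UNIV. (A y *v axis l 1 - A (axis l 1) *v y) $ i * dN y (axis i 1))"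
  have b: "b y = ?b y" if "y \<noteq> 0" for y
    using that by (simp add: b_def g_sum c_def linear_axis_sum[OF linear_dN, of y "A y *v axis l 1 - A (axis l 1) *v y" for l])
  have "bounded_linear (\<lambda>y. (M *v y) $ i)" for M :: "real^'n^'n" and i
    by (intro linear_conv_bounded_linear[THEN iffD1] linearI)
      (simp_all add: matrix_vector_right_distrib matrix_vector_mult_scaleR)
  then have "smooth_on (- {0}) (\<lambda>y. ?b y $ l)" for l
    unfolding vec_lambda_beta vector_minus_component
    by (intro smooth_on_add smooth_on_mult smooth_on_const smooth_on_sum smooth_on_diff smooth_A_mult
        smooth_fundamental_tensor smooth_dN smooth_nth smooth_on_linear open_slit)
  then show "smooth_on (- {0}) (\<lambda>y. (matrix_inv (fundamental_tensor F y) *v ?b y) $ i)"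
    using det_fundamental_tensor_pos
    by (intro smooth_on_matrix_inv_mult open_slit smooth_fundamental_tensor) (auto simp: less_imp_neq[symmetric])
  show "(matrix_inv (fundamental_tensor F y) *v ?b y) $ i = G y $ i" if "y \<in> - {0}" for y
    using that b by (simp add: spray_coeff_eq)
qed

text \<open>Twice the first term of \<open>b\<close> is the pairing with \<open>A y *v y\<close>,
  which the subtraction in \<open>Y\<close> removes; only the torsion term stays.\<close>

lemma g_Y:
  assumes "y \<noteq> 0"
  shows "g y (Y y) z = 1/2 * dN y (c y z)"
proof -
  have "fundamental_tensor F y *v G y = b y"
    using det_fundamental_tensor_pos[OF assms] matrix_inv_right_det[of "fundamental_tensor F y"]
    by (simp add: spray_coeff_eq[OF assms] matrix_vector_mul_assoc)
  then have "g y (G y) z = z \<bullet> b y"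
    using g_commute[OF assms] by (simp add: g_def)
  also have "\<dots> = 1/2 * g y (A y *v y) z + 1/4 * dN y (c y z)"
  proof -
    have "linear (\<lambda>z. 1/2 * g y (A y *v y) z + 1/4 * dN y (c y z))"
      using assms by (intro linearI) (simp_all add: c_def A_mult_simps matrix_vector_right_distrib
          matrix_vector_mult_scaleR dN_simps algebra_simps scaleR_diff_right)
    from linear_axis_sum[OF this, of z] show ?thesis
      by (simp add: inner_vec_def b_def)
  qed
  finally show ?thesis by (simp add: Y_def)
qed

text \<open>The distortion is invariant under the flat connection, so only \<open>Y\<close> contributes to the S-curvature.\<close>

lemma spray_deriv_distortion:
  assumes "y \<noteq> 0"
  obtains dT where "(distortion f x0 has_derivative dT) (at y)"
    and "spray_deriv f (distortion f) x0 y = - dT (Y y)"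
proof -
  define s where "s = measure lborel (ball (0 :: real^'n) 1) / measure lborel {y. F y < 1}"
  let ?T = "\<lambda>y. ln (sqrt (det (fundamental_tensor F y)) / s)"
  have dist: "distortion f x y = ?T (\<Theta> x *v y)" if "x \<in> W" "det (\<Theta> x) \<noteq> 0" "y \<noteq> 0" for x y
    using that unfolding s_def by (intro distortion_compose f)
  have s: "s \<ge> 0" by (simp add: s_def)
  have "\<exists>dT. (?T has_derivative dT) (at y)"
  \<comment> \<open>For \<open>s = 0\<close> the quotient is \<open>0\<close> by convention and
    \<open>?T\<close> is constant.\<close>
  proof (cases "s = 0")
    case True
    then show ?thesis by (intro exI[of _ "\<lambda>_. 0"]) simp
  next
    case False
    have "((\<lambda>y. det (fundamental_tensor F y)) has_derivative frechet_derivative (\<lambda>y. det (fundamental_tensor F y)) (at y)) (at y)"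
      using smooth_on_has_derivative[OF smooth_on_det[OF open_slit smooth_fundamental_tensor]] assms by blast
    moreover have "det (fundamental_tensor F y) > 0" "s > 0"
      using False s det_fundamental_tensor_pos[OF assms] by linarith+
    ultimately show ?thesis
      by (intro exI) (rule derivative_eq_intros refl | simp)+
  qed
  then obtain dT where T: "(?T has_derivative dT) (at y)" by blast
  have "det (\<Theta> x0) \<noteq> 0" by (simp add: \<Theta>_x0)
  then have T': "(distortion f x0 has_derivative dT) (at y)"
    by (intro has_derivative_transform_within_open[OF T open_slit])
      (use assms dist[OF W(2)] in \<open>auto simp: \<Theta>_x0\<close>)
  \<comment> \<open>Taken at \<open>h = y\<close>, this is the term that turns
    \<open>- 2 * dT (G y)\<close> into \<open>- dT (Y y)\<close>.\<close>
  have "((\<lambda>x. ?T (\<Theta> x *v y)) has_derivative (\<lambda>h. dT (A h *v y))) (at x0)"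
    using has_derivative_compose[OF has_derivative_\<Theta>_mult, of ?T dT y] T by (simp add: \<Theta>_x0)
  \<comment> \<open>The formula \<open>dist\<close> asks for an invertible
    \<open>\<Theta> x\<close>; the determinant is continuous at \<open>x0\<close> and equals 1
    there.\<close>
  moreover have "eventually (\<lambda>x. x \<in> W \<and> det (\<Theta> x) \<noteq> 0) (at x0)"
  proof -
    have "isCont \<Theta> x0" using \<Theta> has_derivative_continuous by blast
    then have "isCont (\<lambda>x. det (\<Theta> x)) x0"
      unfolding det_def by (intro continuous_intros) auto
    then have "((\<lambda>x. det (\<Theta> x)) \<longlongrightarrow> 1) (at x0)"
      by (simp add: isCont_def \<Theta>_x0)
    then have "eventually (\<lambda>x. det (\<Theta> x) \<noteq> 0) (at x0)"
      by (rule tendsto_imp_eventually_ne) simp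
    then show ?thesis
      using eventually_at_in_open'[OF W] by (rule eventually_conj[rotated])
  qed
  ultimately have "((\<lambda>x. distortion f x y) has_derivative (\<lambda>h. dT (A h *v y))) (at x0)"
    using assms dist \<open>det (\<Theta> x0) \<noteq> 0\<close> W
    by (elim has_derivative_transform_eventually) (auto elim!: eventually_mono)
  then have dx: "dx k (distortion f) x0 y = dT (A (axis k 1) *v y)" for k
    unfolding dx_def by (rule pd_eq)
  have dy: "dy k (distortion f) x0 y = dT (axis k 1)" for k
    unfolding dy_def by (rule pd_eq[OF T'])
  have lin: "linear dT" using T has_derivative_linear by blast
  have "dT (A y *v y) = (\<Sum>k\<in>UNIV. y $ k * dT (A (axis k 1) *v y))"
    by (subst A_mult_sum) (simp add: linear_sum[OF lin] linear_cmul[OF lin])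
  moreover have "dT (G y) = (\<Sum>k\<in>UNIV. spray_coeff f k x0 y * dT (axis k 1))"
    using linear_axis_sum[OF lin, of "G y"] by (simp add: G_def)
  ultimately have "spray_deriv f (distortion f) x0 y = dT (A y *v y) - 2 * dT (G y)"
    by (simp add: spray_deriv_def dx dy)
  also have "\<dots> = - dT (Y y)"
    by (simp add: Y_def linear_diff[OF lin] linear_cmul[OF lin])
  finally show thesis using that T' by blast
qed

end

section \<open>Third derivatives along a line\<close>

lemma line_has_derivative:
  assumes "(k has_derivative D) (at (v + p *\<^sub>R u))"
  shows "((\<lambda>p. k (v + p *\<^sub>R u)) has_real_derivative D u) (at p)"
proof -
  have "((\<lambda>p. v + p *\<^sub>R u) has_derivative (\<lambda>h. h *\<^sub>R u)) (at p)"
    by (auto intro!: derivative_eq_intros)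
  from has_derivative_compose[OF this assms]
  have *: "((\<lambda>p. k (v + p *\<^sub>R u)) has_derivative (\<lambda>h. D (h *\<^sub>R u))) (at p)" .
  show ?thesis
    by (rule has_derivative_imp_has_field_derivative[OF *])
      (simp add: linear_cmul[OF has_derivative_linear[OF assms]])
qed

lemma smooth_on_line:
  assumes "open S" "smooth_on S k" "\<And>p. v + p *\<^sub>R u \<in> S"
  shows "smooth_on UNIV (\<lambda>p :: real. k (v + p *\<^sub>R u))"
  using assms by (intro smooth_on_affine_compose[where l = "\<lambda>p. p *\<^sub>R u" and S = S])
    (auto intro: bounded_linear_scaleR_left)

lemma smooth_on_pd: "smooth_on S k \<Longrightarrow> smooth_on S (pd i k)"
  unfolding pd_def[abs_def] by (rule smooth_on_frechet_derivative)

lemma deriv_sum_cmult: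
  fixes k :: "'i \<Rightarrow> real \<Rightarrow> real"
  assumes "\<And>i. i \<in> I \<Longrightarrow> smooth_on UNIV (k i)"
  shows "deriv (\<lambda>p. \<Sum>i\<in>I. c i * k i p) = (\<lambda>p. \<Sum>i\<in>I. c i * deriv (k i) p)"
  by (rule ext, rule DERIV_imp_deriv)
    (intro DERIV_sum DERIV_cmult smooth_on_real_derivative(1) assms)

lemma deriv3_sum_cmult:
  fixes k :: "'i \<Rightarrow> real \<Rightarrow> real"
  assumes "\<And>i. i \<in> I \<Longrightarrow> smooth_on UNIV (k i)"
  shows "(deriv ^^ 3) (\<lambda>p. \<Sum>i\<in>I. c i * k i p) = (\<lambda>p. \<Sum>i\<in>I. c i * (deriv ^^ 3) (k i) p)"
  using assms by (simp add: numeral_3_eq_3 deriv_sum_cmult smooth_on_real_derivative(2))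

lemma deriv_line:
  fixes k :: "real^'n::finite \<Rightarrow> real"
  assumes "open S" "smooth_on S k" "\<And>p. v + p *\<^sub>R u \<in> S"
  shows "deriv (\<lambda>p. k (v + p *\<^sub>R u)) = (\<lambda>p. \<Sum>a\<in>UNIV. u $ a * pd a k (v + p *\<^sub>R u))"
proof (rule ext, rule DERIV_imp_deriv)
  fix p
  have D: "(k has_derivative frechet_derivative k (at (v + p *\<^sub>R u))) (at (v + p *\<^sub>R u))"
    using smooth_on_has_derivative[OF assms(2,3)] .
  show "((\<lambda>p. k (v + p *\<^sub>R u)) has_real_derivative (\<Sum>a\<in>UNIV. u $ a * pd a k (v + p *\<^sub>R u))) (at p)"
    using line_has_derivative[OF D] linear_axis_sum[OF has_derivative_linear[OF D], of u]
    by (simp add: pd_def)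
qed

text \<open>The Landsberg condition is stated with iterated coordinate partials; their threefold
  contraction with \<open>u\<close> is the ordinary third derivative along the line.\<close>

lemma deriv3_line:
  fixes k :: "real^'n::finite \<Rightarrow> real"
  assumes "open S" "smooth_on S k" "\<And>p. v + p *\<^sub>R u \<in> S"
  shows "(deriv ^^ 3) (\<lambda>p. k (v + p *\<^sub>R u)) = (\<lambda>p. \<Sum>a\<in>UNIV. u $ a * (\<Sum>b\<in>UNIV. u $ b *
    (\<Sum>c\<in>UNIV. u $ c * pd c (pd b (pd a k)) (v + p *\<^sub>R u))))"
proof -
  note sm = smooth_on_line[OF assms(1) _ assms(3)]
  have 2: "deriv (\<lambda>p. \<Sum>a\<in>UNIV. u $ a * pd a k (v + p *\<^sub>R u))
     = (\<lambda>p. \<Sum>a\<in>UNIV. u $ a * (\<Sum>b\<in>UNIV. u $ b * pd b (pd a k) (v + p *\<^sub>R u)))"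
    if "smooth_on S k" for k
    by (subst deriv_sum_cmult) (use that in \<open>simp_all add: sm smooth_on_pd deriv_line[OF assms(1) _ assms(3)]\<close>)
  have "deriv (\<lambda>p. \<Sum>a\<in>UNIV. u $ a * (\<Sum>b\<in>UNIV. u $ b * pd b (pd a k) (v + p *\<^sub>R u)))
     = (\<lambda>p. \<Sum>a\<in>UNIV. u $ a * (\<Sum>b\<in>UNIV. u $ b *
    (\<Sum>c\<in>UNIV. u $ c * pd c (pd b (pd a k)) (v + p *\<^sub>R u))))"
    by (subst deriv_sum_cmult)
      (auto intro!: smooth_on_sum smooth_on_mult smooth_on_const sm smooth_on_pd assms(1,2) simp: 2 smooth_on_pd[OF assms(2)])
  then show ?thesis
    by (simp add: numeral_3_eq_3 deriv_line[OF assms] 2[OF assms(2)])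
qed

text \<open>Along a line \<open>Y\<close> is \<open>2 * G\<close> minus a quadratic polynomial in
  the parameter, which the third derivative kills.\<close>

lemma deriv3_diff_quadratic:
  fixes k :: "real \<Rightarrow> real"
  assumes "smooth_on UNIV k"
  shows "(deriv ^^ 3) (\<lambda>p. r * k p - (a + b * p + c * p\<^sup>2)) = (\<lambda>p. r * (deriv ^^ 3) k p)"
proof -
  note s1 = smooth_on_real_derivative(2)[OF assms]
  note s2 = smooth_on_real_derivative(2)[OF s1]
  note [derivative_intros] = smooth_on_real_derivative(1)[OF assms]
    smooth_on_real_derivative(1)[OF s1] smooth_on_real_derivative(1)[OF s2]
  have "deriv (\<lambda>p. r * k p - (a + b * p + c * p\<^sup>2)) = (\<lambda>p. r * deriv k p - (b + 2 * c * p))"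
    by (rule ext, rule DERIV_imp_deriv) (auto intro!: derivative_eq_intros)
  moreover have "deriv (\<lambda>p. r * deriv k p - (b + 2 * c * p)) = (\<lambda>p. r * deriv (deriv k) p - 2 * c)"
    by (rule ext, rule DERIV_imp_deriv) (auto intro!: derivative_eq_intros)
  moreover have "deriv (\<lambda>p. r * deriv (deriv k) p - 2 * c) = (\<lambda>p. r * deriv (deriv (deriv k)) p)"
    by (rule ext, rule DERIV_imp_deriv) (auto intro!: derivative_eq_intros)
  ultimately show ?thesis by (simp add: numeral_3_eq_3)
qed

text \<open>Here \<open>h\<close> is the value of the Riemannian metric at \<open>x0\<close> and \<open>P\<close> is the orthogonal projection to the
  first subbundle.\<close>

locale landsberg_family = linear_family F f x0 W \<Theta> A
  for F :: "real^'n::finite \<Rightarrow> real" and f x0 W \<Theta> A +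
  fixes h :: "real^'n \<Rightarrow> real^'n \<Rightarrow> real" and P :: "real^'n \<Rightarrow> real^'n" and \<psi> :: "real \<Rightarrow> real \<Rightarrow> real"
  assumes linear_h: "\<And>w. linear (\<lambda>z. h z w)" and h_commute: "\<And>z w. h z w = h w z"
    and h_pos: "\<And>z. z \<noteq> 0 \<Longrightarrow> h z z > 0"
    and linear_P: "linear P" and P_P: "\<And>z. P (P z) = P z" and h_P: "\<And>z w. h (P z) w = h z (P w)"
    and P_nontrivial: "\<exists>u. u \<noteq> 0 \<and> P u = u" "\<exists>v. v \<noteq> 0 \<and> P v = 0"
    and F_eq: "\<And>y. F y = \<psi> (h (P y) (P y)) (h (y - P y) (y - P y))"
    and landsberg: "\<And>y p q r. y \<noteq> 0 \<Longrightarrow> (\<Sum>i\<in>UNIV. \<Sum>j\<in>UNIV. y $ j * g_mat f x0 y $ i $ j *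
      dy r (dy q (dy p (spray_coeff f i))) x0 y) = 0"
begin

lemma h_linear:
  "h (z + z') w = h z w + h z' w" "h (z - z') w = h z w - h z' w" "h (r *\<^sub>R z) w = r * h z w"
  "h w (z + z') = h w z + h w z'" "h w (z - z') = h w z - h w z'" "h w (r *\<^sub>R z) = r * h w z"
  "h 0 w = 0" "h w 0 = 0" "h (- z) w = - h z w" "h w (- z) = - h w z"
proof -
  note l = linear_add[OF linear_h] linear_diff[OF linear_h] linear_cmul[OF linear_h] linear_0[OF linear_h] linear_neg[OF linear_h]
  show "h (z + z') w = h z w + h z' w" "h (z - z') w = h z w - h z' w" "h (r *\<^sub>R z) w = r * h z w" "h 0 w = 0" "h (- z) w = - h z w"
    by (simp_all add: l)
  then show "h w (z + z') = h w z + h w z'" "h w (z - z') = h w z - h w z'" "h w (r *\<^sub>R z) = r * h w z" "h w 0 = 0" "h w (- z) = - h w z"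
    using h_commute by metis+
qed

lemma P_linear: "P (z + w) = P z + P w" "P (z - w) = P z - P w" "P (r *\<^sub>R z) = r *\<^sub>R P z" "P 0 = 0"
  using linear_P by (simp_all add: linear_add linear_diff linear_cmul linear_0)

lemma distortion_eq:
  assumes "y \<noteq> 0"
  shows "distortion f x0 y = ln (sqrt (det (fundamental_tensor F y)) /
    (measure lborel (ball (0 :: real^'n) 1) / measure lborel {y. F y < 1}))"
  using distortion_compose[of f x0 "mat 1" y] assms by (simp add: f_x0)

text \<open>The contraction \<open>y^j g_ij\<close> is half the value of \<open>dN y\<close> on the
  axis \<open>i\<close>. Contracting the Landsberg equations three times with \<open>u\<close>
  therefore makes \<open>dN\<close> annihilate the third derivative of \<open>G\<close>, hence that
  of \<open>Y\<close>, along the line.\<close>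

lemma landsberg_line:
  assumes nz: "\<And>p. v + p *\<^sub>R u \<noteq> 0"
  shows "dN (v + p *\<^sub>R u) (\<chi> i. (deriv ^^ 3) (\<lambda>p. Y (v + p *\<^sub>R u) $ i) p) = 0"
proof -
  let ?y = "v + p *\<^sub>R u"
  have mem: "v + p *\<^sub>R u \<in> - {0}" for p using nz by blast
  have G3: "(deriv ^^ 3) (\<lambda>p. G (v + p *\<^sub>R u) $ i) p =
     (\<Sum>a\<in>UNIV. u $ a * (\<Sum>b\<in>UNIV. u $ b * (\<Sum>c\<in>UNIV. u $ c *
        dy c (dy b (dy a (spray_coeff f i))) x0 ?y)))" for i
    using deriv3_line[OF open_slit smooth_G[of i] mem]
    by (simp add: G_def dy_def[abs_def] fun_eq_iff)
  have Y3: "(deriv ^^ 3) (\<lambda>p. Y (v + p *\<^sub>R u) $ i) p = 2 * (deriv ^^ 3) (\<lambda>p. G (v + p *\<^sub>R u) $ i) p" for i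
  proof -
    have "Y (v + p *\<^sub>R u) $ i = 2 * G (v + p *\<^sub>R u) $ i -
        ((A v *v v) $ i + (A u *v v + A v *v u) $ i * p + (A u *v u) $ i * p\<^sup>2)" for p
      by (simp add: Y_def A_mult_simps matrix_vector_right_distrib matrix_vector_mult_scaleR
          algebra_simps power2_eq_square)
    then show ?thesis
      using deriv3_diff_quadratic[OF smooth_on_line[OF open_slit smooth_G mem]] by simp
  qed
  have "dN ?y (\<chi> i. (deriv ^^ 3) (\<lambda>p. Y (v + p *\<^sub>R u) $ i) p) =
      (\<Sum>i\<in>UNIV. 2 * (deriv ^^ 3) (\<lambda>p. G (v + p *\<^sub>R u) $ i) p * dN ?y (axis i 1))"
    by (subst linear_axis_sum[OF linear_dN[OF nz]]) (simp add: Y3)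
  also have "\<dots> = (\<Sum>i\<in>UNIV. \<Sum>a\<in>UNIV. \<Sum>b\<in>UNIV. \<Sum>c\<in>UNIV. 2 * 2 * u $ a * u $ b * u $ c *
      (\<Sum>j\<in>UNIV. ?y $ j * g_mat f x0 ?y $ i $ j * dy c (dy b (dy a (spray_coeff f i))) x0 ?y))"
  proof (rule sum.cong[OF refl])
    fix i
    have "dN ?y (axis i 1) = 2 * (\<Sum>j\<in>UNIV. ?y $ j * g_mat f x0 ?y $ i $ j)"
    proof -
      have "g ?y (axis i 1) ?y = (\<Sum>j\<in>UNIV. ?y $ j * g_mat f x0 ?y $ i $ j)"
        by (simp only: g_def inner_axis' g_mat_def f_x0 matrix_vector_mult_def vec_lambda_beta mult.commute)
          (simp add: mult.commute)
      then show ?thesis using euler_dN[OF nz, of p "axis i 1"] by simp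
    qed
    then show "2 * (deriv ^^ 3) (\<lambda>p. G (v + p *\<^sub>R u) $ i) p * dN ?y (axis i 1) =
      (\<Sum>a\<in>UNIV. \<Sum>b\<in>UNIV. \<Sum>c\<in>UNIV. 2 * 2 * u $ a * u $ b * u $ c *
      (\<Sum>j\<in>UNIV. ?y $ j * g_mat f x0 ?y $ i $ j * dy c (dy b (dy a (spray_coeff f i))) x0 ?y))"
      by (simp only: G3 sum_distrib_left sum_distrib_right mult_ac)
  qed
  \<comment> \<open>With the sum over \<open>i\<close> innermost, each triple \<open>a\<close>,
    \<open>b\<close>, \<open>c\<close> contributes a multiple of one Landsberg equation.\<close>
  also have "\<dots> = (\<Sum>a\<in>UNIV. \<Sum>b\<in>UNIV. \<Sum>c\<in>UNIV. \<Sum>i\<in>UNIV. 2 * 2 * u $ a * u $ b * u $ c *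
      (\<Sum>j\<in>UNIV. ?y $ j * g_mat f x0 ?y $ i $ j * dy c (dy b (dy a (spray_coeff f i))) x0 ?y))"
    by (subst sum.swap, rule sum.cong[OF refl], subst sum.swap, rule sum.cong[OF refl], rule sum.swap)
  also have "\<dots> = 0"
    by (simp only: sum_distrib_left[symmetric] landsberg[OF nz] mult_zero_right sum.neutral_const)
  finally show ?thesis .
qed

end

section \<open>Reflection and torsion in an adapted plane\<close>

locale orthonormal_plane = landsberg_family F f x0 W \<Theta> A h P \<psi>
  for F :: "real^'n::finite \<Rightarrow> real" and f x0 W \<Theta> A h P \<psi> +
  fixes u v :: "real^'n"
  assumes u: "P u = u" "h u u = 1" and v: "P v = 0" "h v v = 1"
begin

lemma h_u_v: "h u v = 0" "h v u = 0"
  using h_P[of u v] h_commute[of u v] by (simp_all add: u v h_linear)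

definition pr :: "real^'n \<Rightarrow> real^'n" where "pr z = h z u *\<^sub>R u + h z v *\<^sub>R v"

definition R :: "real^'n \<Rightarrow> real^'n" where "R z = 2 *\<^sub>R pr z - z"

lemma pr_plane: "pr (p *\<^sub>R u + q *\<^sub>R v) = p *\<^sub>R u + q *\<^sub>R v"
  by (simp add: pr_def h_linear u v h_u_v)

lemma linear_R: "linear R"
  by (rule linearI) (simp_all add: R_def pr_def h_linear algebra_simps scaleR_add_left)

lemma R_R: "R (R z) = z"
proof -
  have "pr (pr z) = pr z" using pr_plane by (simp add: pr_def[of z])
  moreover have "pr (2 *\<^sub>R pr z - z) = 2 *\<^sub>R pr (pr z) - pr z"
    by (simp add: pr_def h_linear algebra_simps scaleR_diff_left scaleR_add_left)
  ultimately show ?thesis by (simp add: R_def algebra_simps scaleR_2)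
qed

lemma R_nz: "z \<noteq> 0 \<Longrightarrow> R z \<noteq> 0"
  using R_R[of z] linear_0[OF linear_R] by force

text \<open>\<open>u\<close> lies in the image of \<open>P\<close> and \<open>v\<close> in its
  kernel, so \<open>R\<close> respects the splitting and acts on the two summands as the reflections
  in the lines of \<open>u\<close> and \<open>v\<close>. Both lengths entering \<open>F_eq\<close>
  are preserved.\<close>

lemma F_R: "F (R z) = F z"
proof -
  have P_R: "P (R z) = (2 * h z u) *\<^sub>R u - P z"
    by (simp add: R_def pr_def P_linear u v)
  have 1: "h (P (R z)) (P (R z)) = h (P z) (P z)"
    unfolding P_R using h_P[of z u] h_commute[of u "P z"] by (simp add: h_linear u algebra_simps)
  have Q_R: "R z - P (R z) = (2 * h z v) *\<^sub>R v - (z - P z)"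
    unfolding P_R by (simp add: R_def pr_def algebra_simps)
  have zv: "h (z - P z) v = h z v" "h v (z - P z) = h z v"
    using h_P[of z v] h_commute[of v "z - P z"] by (simp_all add: h_linear v)
  have "h ((2 * h z v) *\<^sub>R v - w) ((2 * h z v) *\<^sub>R v - w) = h w w" if "h w v = h z v" "h v w = h z v" for w
    using that by (simp add: h_linear v algebra_simps)
  from this[OF zv] have 2: "h (R z - P (R z)) (R z - P (R z)) = h (z - P z) (z - P z)"
    unfolding Q_R .
  show ?thesis unfolding F_eq[of "R z"] F_eq[of z] 1 2 ..
qed

lemma R_has_derivative: "(R has_derivative R) (at z)"
  using linear_R by (simp add: linear_conv_bounded_linear bounded_linear_imp_has_derivative)

lemma dN_R:
  assumes "y \<noteq> 0"
  shows "dN (R y) (R z) = dN y z"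
proof -
  have "((\<lambda>y. N (R y)) has_derivative (\<lambda>z. dN (R y) (R z))) (at y)"
    by (rule has_derivative_compose[OF R_has_derivative N_has_derivative[OF R_nz[OF assms]]])
  moreover have "(\<lambda>y. N (R y)) = N" by (simp add: N_def F_R fun_eq_iff)
  ultimately have "(N has_derivative (\<lambda>z. dN (R y) (R z))) (at y)" by simp
  from has_derivative_unique[OF this N_has_derivative[OF assms]] show ?thesis by metis
qed

lemma g_R:
  assumes "y \<noteq> 0"
  shows "g (R y) (R z) (R w) = g y z w"
proof -
  have "((\<lambda>y. dN (R y) (R z)) has_derivative (\<lambda>w. 2 * g (R y) (R z) (R w))) (at y)"
    by (rule has_derivative_compose[OF R_has_derivative dN_has_derivative[OF R_nz[OF assms]]])
  then have "((\<lambda>y. dN y z) has_derivative (\<lambda>w. 2 * g (R y) (R z) (R w))) (at y)"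
    by (rule has_derivative_transform_within_open[OF _ open_slit]) (use assms dN_R in auto)
  from has_derivative_unique[OF this dN_has_derivative[OF assms]]
  have "2 * g (R y) (R z) (R w) = 2 * g y z w" by metis
  then show ?thesis by simp
qed

text \<open>\<open>R\<close> is an involution, so its determinant squares to 1 and the congruence
  leaves the Hessian determinant unchanged.\<close>

lemma distortion_R:
  assumes "y \<noteq> 0"
  shows "distortion f x0 (R y) = distortion f x0 y"
proof -
  have mult: "matrix R *v z = R z" for z by (rule matrix_works) (simp add: linear_R linear_matrix_vector_mul_eq)
  have "matrix R ** matrix R = mat 1"
    by (simp add: matrix_eq matrix_vector_mul_assoc[symmetric] mult R_R)
  then have d: "det (matrix R) * det (matrix R) = 1" by (metis det_mul det_I)
  then have "det (matrix R) \<noteq> 0" by auto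
  from fundamental_tensor_compose[of F "matrix R", OF _ this assms]
  have "fundamental_tensor F y = transpose (matrix R) ** fundamental_tensor F (R y) ** matrix R"
    by (simp add: mult F_R)
  then have "det (fundamental_tensor F y) = det (matrix R) * det (matrix R) * det (fundamental_tensor F (R y))"
    by (simp add: det_mul det_transpose)
  then show ?thesis
    using d by (simp add: distortion_eq assms R_nz)
qed

context
  fixes y :: "real^'n"
  assumes y: "y \<noteq> 0" "pr y = y"
begin

lemma R_fixed: "pr w = w \<Longrightarrow> R w = w"
  by (simp add: R_def scaleR_2)

lemma R_y: "R y = y"
  by (rule R_fixed[OF y(2)])

text \<open>Since \<open>R\<close> fixes \<open>y\<close>, the form \<open>dN y\<close> is invariant
  under \<open>R\<close>, which is twice \<open>pr\<close> minus the identity; so it vanishes on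
  \<open>z - pr z\<close>. The next two lemmas repeat the argument for \<open>g\<close> and for the
  distortion.\<close>

lemma dN_pr: "dN y z = dN y (pr z)"
  using dN_R[OF y(1), of z] by (simp add: R_y R_def[of z] dN_simps[OF y(1)])

lemma g_pr: "pr w = w \<Longrightarrow> g y z w = g y (pr z) w"
  using g_R[OF y(1), of z w] R_fixed[of w] by (simp add: R_y R_def[of z])

lemma distortion_derivative_pr:
  assumes "(distortion f x0 has_derivative dT) (at y)"
  shows "dT z = dT (pr z)"
proof -
  have "((\<lambda>y. distortion f x0 (R y)) has_derivative (\<lambda>z. dT (R z))) (at y)"
    using has_derivative_compose[OF R_has_derivative, of "distortion f x0" dT y] assms by (simp add: R_y)
  then have "(distortion f x0 has_derivative (\<lambda>z. dT (R z))) (at y)"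
    by (rule has_derivative_transform_within_open[OF _ open_slit]) (use y distortion_R in auto)
  from has_derivative_unique[OF this assms] have "dT (R z) = dT z" by metis
  moreover have "linear dT" using assms has_derivative_linear by blast
  ultimately show ?thesis
    by (simp add: R_def linear_diff linear_cmul)
qed

end

text \<open>This is \<open>g_Y\<close> tested on \<open>u\<close> and \<open>v\<close>. Antisymmetry
  of \<open>c\<close> reduces both torsion terms to \<open>c u v\<close>, with coefficients
  \<open>- q\<close> and \<open>p\<close>, and \<open>pr\<close> discards the components outside the
  plane. The result is a two by two linear system for the plane part of \<open>Y\<close>.\<close>

lemma g_Y_plane:
  assumes "y = p *\<^sub>R u + q *\<^sub>R v" "y \<noteq> 0"
  shows "h (Y y) u * g y u u + h (Y y) v * g y u v
      = - q / 2 * (h (c u v) u * dN y u + h (c u v) v * dN y v)"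
    and "h (Y y) u * g y u v + h (Y y) v * g y v v
      = p / 2 * (h (c u v) u * dN y u + h (c u v) v * dN y v)"
proof -
  have y: "pr y = y" using pr_plane by (simp add: assms(1))
  have dN_c: "dN y (c u v) = h (c u v) u * dN y u + h (c u v) v * dN y v"
    by (subst dN_pr[OF assms(2) y]) (simp add: pr_def dN_simps[OF assms(2)])
  have "c y u = (- q) *\<^sub>R c u v" "c y v = p *\<^sub>R c u v"
    by (simp_all add: assms(1) c_def A_mult_simps matrix_vector_right_distrib matrix_vector_mult_scaleR algebra_simps)
  then have c: "g y (Y y) u = - q / 2 * dN y (c u v)" "g y (Y y) v = p / 2 * dN y (c u v)"
    by (simp_all add: g_Y[OF assms(2)] dN_simps[OF assms(2)])
  have "pr u = u" "pr v = v" using pr_plane[of 1 0] pr_plane[of 0 1] by simp_all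
  then have "g y (Y y) u = h (Y y) u * g y u u + h (Y y) v * g y v u"
    "g y (Y y) v = h (Y y) u * g y u v + h (Y y) v * g y v v"
    using g_pr[OF assms(2) y, of _ "Y y"] by (simp_all add: pr_def[of "Y y"])
  then show "h (Y y) u * g y u u + h (Y y) v * g y u v
      = - q / 2 * (h (c u v) u * dN y u + h (c u v) v * dN y v)"
    "h (Y y) u * g y u v + h (Y y) v * g y v v
      = p / 2 * (h (c u v) u * dN y u + h (c u v) v * dN y v)"
    using c dN_c g_commute[OF assms(2), of u v] by simp_all
qed

lemma spray_deriv_distortion_zero:
  assumes "y = p *\<^sub>R u + q *\<^sub>R v" "y \<noteq> 0" and zero: "h (c u v) u = 0" "h (c u v) v = 0"
  shows "spray_deriv f (distortion f) x0 y = 0"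
proof -
  have y: "pr y = y" using pr_plane by (simp add: assms(1))
  \<comment> \<open>The two equations, weighted by the components of \<open>Y y\<close>, add up to
    the squared \<open>g\<close>-length of \<open>pr (Y y)\<close>.\<close>
  have "g y (pr (Y y)) (pr (Y y)) = h (Y y) u * (h (Y y) u * g y u u + h (Y y) v * g y u v)
    + h (Y y) v * (h (Y y) u * g y u v + h (Y y) v * g y v v)"
    by (simp add: pr_def g_commute[OF assms(2), of v u] algebra_simps)
  also have "\<dots> = 0" using g_Y_plane[OF assms(1,2)] zero by simp
  finally have "pr (Y y) = 0" using g_pos[OF assms(2)] by force
  obtain dT where dT: "(distortion f x0 has_derivative dT) (at y)"
    "spray_deriv f (distortion f) x0 y = - dT (Y y)"
    using spray_deriv_distortion[OF assms(2)] .
  have "dT (Y y) = 0"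
    using distortion_derivative_pr[OF assms(2) y dT(1)] \<open>pr (Y y) = 0\<close>
      linear_0[OF has_derivative_linear[OF dT(1)]] by metis
  then show ?thesis using dT(2) by simp
qed

lemma line_nz: "v + p *\<^sub>R u \<noteq> 0"
proof
  assume "v + p *\<^sub>R u = 0"
  then have "h (v + p *\<^sub>R u) v = 0" by (simp add: h_linear)
  then show False by (simp add: h_linear v h_u_v)
qed

lemma line_mem: "v + p *\<^sub>R u \<in> - {0}"
  using line_nz by blast

text \<open>The line \<open>q = 1\<close> avoids the origin and, by homogeneity, carries the whole
  open half plane. On it the system of \<open>g_Y_plane\<close> supplies the function
  \<open>m\<close>, and the torsion components become the constants \<open>a\<close> and
  \<open>b\<close> of \<open>landsberg_plane_quadratic\<close>.\<close>

lemma N_quadratic_on_line: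
  assumes ab: "h (c u v) u \<noteq> 0 \<or> h (c u v) v \<noteq> 0"
  shows "\<exists>\<kappa>. \<forall>p. N (v + p *\<^sub>R u) = N v + \<kappa> * p\<^sup>2"
proof -
  let ?y = "\<lambda>p. v + p *\<^sub>R u"
  let ?a = "h (c u v) u" and ?b = "h (c u v) v"
  define \<phi> where "\<phi> p = 1/2 * N (?y p)" for p
  note nz = line_nz
  have d1: "deriv \<phi> = (\<lambda>p. 1/2 * dN (?y p) u)"
    unfolding \<phi>_def by (rule ext, rule DERIV_imp_deriv, rule DERIV_cmult, rule line_has_derivative, rule N_has_derivative[OF nz])
  have d2: "deriv (deriv \<phi>) = (\<lambda>p. g (?y p) u u)"
    unfolding d1
  proof (rule ext, rule DERIV_imp_deriv)
    fix p
    show "((\<lambda>p. 1/2 * dN (?y p) u) has_real_derivative g (?y p) u u) (at p)"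
      using DERIV_cmult[OF line_has_derivative[OF dN_has_derivative[OF nz]], of "1/2" u p] by simp
  qed
  have dv: "2 * \<phi> p - p * deriv \<phi> p = 1/2 * dN (?y p) v" for p
    using euler_N[OF nz, of p] unfolding d1 \<phi>_def by (simp add: dN_simps[OF nz])
  have guu: "g (?y p) u u = deriv (deriv \<phi>) p" for p by (simp add: d2)
  \<comment> \<open>Euler's relations at \<open>?y p\<close> recover the entries of the Hessian that
    involve \<open>v\<close> from \<open>\<phi>\<close> and its derivatives.\<close>
  have guv: "g (?y p) u v = deriv \<phi> p - p * deriv (deriv \<phi>) p" for p
    using euler_dN[OF nz, of p u] unfolding d2 unfolding d1 by simp
  have gvv: "g (?y p) v v = (2 * \<phi> p - p * deriv \<phi> p) - p * g (?y p) u v" for p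
    using euler_dN[OF nz, of p v] g_commute[OF nz, of p u v] unfolding dv by simp
  define D where "D p = 2 * \<phi> p * deriv (deriv \<phi>) p - (deriv \<phi> p)\<^sup>2" for p
  have D: "D p = g (?y p) u u * g (?y p) v v - (g (?y p) u v)\<^sup>2" for p
    unfolding D_def gvv guv guu by (simp add: algebra_simps power2_eq_square)
  have u_nz: "u \<noteq> 0" using u h_linear(7) by force
  have D_pos: "D p > 0" for p
  proof -
    \<comment> \<open>This vector is \<open>g\<close>-orthogonal to \<open>u\<close>, and its
      squared \<open>g\<close>-length is \<open>g (?y p) u u * D p\<close>.\<close>
    let ?z = "g (?y p) u v *\<^sub>R u - g (?y p) u u *\<^sub>R v"
    have guu_pos: "g (?y p) u u > 0" by (rule g_pos[OF nz u_nz])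
    have "h ?z v = - g (?y p) u u" by (simp add: h_linear v h_u_v)
    with guu_pos have "?z \<noteq> 0" using h_linear(7)[of v] by force
    from g_pos[OF nz this, of p] have "g (?y p) u u * D p > 0"
      unfolding D by (simp add: g_commute[OF nz, of p v u] algebra_simps power2_eq_square)
    then show ?thesis using guu_pos by (simp add: zero_less_mult_iff)
  qed
  define m where "m p = (?a * deriv \<phi> p + ?b * (2 * \<phi> p - p * deriv \<phi> p)) / D p" for p
  have sm: "smooth_on UNIV \<phi>"
    unfolding \<phi>_def[abs_def] by (intro smooth_on_mult smooth_on_const smooth_on_line[OF open_slit smooth_N line_mem] open_UNIV)
  note sm1 = smooth_on_real_derivative(2)[OF sm]
  note sm2 = smooth_on_real_derivative(2)[OF sm1]
  have id: "smooth_on UNIV (\<lambda>p :: real. p)" by (intro smooth_on_linear bounded_linear_ident open_UNIV)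
  have sm_D: "smooth_on UNIV D"
    unfolding D_def[abs_def] power2_eq_square
    by (intro smooth_on_diff smooth_on_mult smooth_on_const sm sm1 sm2 open_UNIV)
  have sm_m: "smooth_on UNIV m"
    unfolding m_def[abs_def] using D_pos
    by (intro smooth_on_divide smooth_on_add smooth_on_diff smooth_on_mult smooth_on_const sm sm1 sm_D id open_UNIV)
      (simp add: less_imp_neq[symmetric])
  have even: "\<phi> (- p) = \<phi> p" for p
  proof -
    have "F (?y (- p)) = F (?y p)"
      unfolding F_eq[of "?y _"] by (simp add: P_linear u v h_linear)
    then show ?thesis by (simp add: \<phi>_def N_def)
  qed
  have Y: "h (Y (?y p)) u = - m p * (2 * \<phi> p - p * deriv \<phi> p)" "h (Y (?y p)) v = m p * deriv \<phi> p" for p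
  proof -
    let ?H = "?a * deriv \<phi> p + ?b * (2 * \<phi> p - p * deriv \<phi> p)"
    have y: "?y p = p *\<^sub>R u + 1 *\<^sub>R v" by simp
    have e1: "h (Y (?y p)) u * g (?y p) u u + h (Y (?y p)) v * g (?y p) u v = - ?H"
      using g_Y_plane(1)[OF y nz] unfolding dv unfolding d1 by (simp add: algebra_simps)
    have e2: "h (Y (?y p)) u * g (?y p) u v + h (Y (?y p)) v * g (?y p) v v = p * ?H"
      using g_Y_plane(2)[OF y nz] unfolding dv unfolding d1 by (simp add: algebra_simps)
    \<comment> \<open>Cramer's rule for \<open>e1\<close> and \<open>e2\<close>. The brackets are
      the pairings of \<open>v\<close> and \<open>u\<close> with \<open>?y p\<close>, that is, the
      two partial derivatives of \<open>E\<close>; this is how the rotated gradient arises.\<close>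
    have "h (Y (?y p)) u * D p = - ?H * (g (?y p) v v + p * g (?y p) u v)"
      using e1 e2 unfolding D by algebra
    moreover have "h (Y (?y p)) v * D p = ?H * (p * g (?y p) u u + g (?y p) u v)"
      using e1 e2 unfolding D by algebra
    ultimately have "h (Y (?y p)) u * D p = - ?H * (2 * \<phi> p - p * deriv \<phi> p)"
      "h (Y (?y p)) v * D p = ?H * deriv \<phi> p"
      unfolding gvv guv guu by simp_all
    then show "h (Y (?y p)) u = - m p * (2 * \<phi> p - p * deriv \<phi> p)" "h (Y (?y p)) v = m p * deriv \<phi> p"
      using D_pos[of p] by (simp_all add: m_def field_simps)
  qed
  have landsberg_\<phi>: "deriv \<phi> p * (deriv ^^ 3) (\<lambda>p. - m p * (2 * \<phi> p - p * deriv \<phi> p)) p +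
      (2 * \<phi> p - p * deriv \<phi> p) * (deriv ^^ 3) (\<lambda>p. m p * deriv \<phi> p) p = 0" for p
  proof -
    let ?\<eta> = "\<chi> i. (deriv ^^ 3) (\<lambda>p. Y (?y p) $ i) p"
    have smY: "smooth_on UNIV (\<lambda>p. Y (?y p) $ i)" for i
    proof -
      have "smooth_on (- {0}) (\<lambda>y. 2 * G y $ i - (A y *v y) $ i)"
        by (intro smooth_on_diff smooth_on_mult smooth_on_const smooth_G smooth_A_mult smooth_nth open_slit)
      from smooth_on_line[OF open_slit this line_mem] show ?thesis by (simp add: Y_def)
    qed
    have comp: "(deriv ^^ 3) (\<lambda>p. h (Y (?y p)) w) p = h ?\<eta> w" for w
    proof -
      have "(\<lambda>p. h (Y (?y p)) w) = (\<lambda>p. \<Sum>i\<in>UNIV. h (axis i 1) w * Y (?y p) $ i)"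
        by (rule ext, subst linear_axis_sum[OF linear_h]) (simp only: mult.commute)
      then have "(deriv ^^ 3) (\<lambda>p. h (Y (?y p)) w) p
          = (\<Sum>i\<in>UNIV. h (axis i 1) w * (deriv ^^ 3) (\<lambda>p. Y (?y p) $ i) p)"
        by (simp only: deriv3_sum_cmult[OF smY])
      also have "\<dots> = h ?\<eta> w"
        by (subst linear_axis_sum[OF linear_h, of ?\<eta>]) (simp only: vec_lambda_beta mult.commute)
      finally show ?thesis .
    qed
    have "pr (?y p) = ?y p" using pr_plane[of p 1] by (simp add: add.commute)
    from dN_pr[OF nz this, of ?\<eta>] have "h ?\<eta> u * dN (?y p) u + h ?\<eta> v * dN (?y p) v = 0"
      using landsberg_line[OF nz, of p] by (simp add: pr_def dN_simps[OF nz])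
    moreover have "(deriv ^^ 3) (\<lambda>p. - m p * (2 * \<phi> p - p * deriv \<phi> p)) p = h ?\<eta> u"
      using comp[of u] unfolding Y .
    moreover have "(deriv ^^ 3) (\<lambda>p. m p * deriv \<phi> p) p = h ?\<eta> v"
      using comp[of v] unfolding Y .
    ultimately show ?thesis
      unfolding dv unfolding d1 by (simp add: mult.commute)
  qed
  have "\<exists>\<kappa>. \<forall>p. \<phi> p = \<phi> 0 + \<kappa> * p\<^sup>2"
  proof (rule landsberg_plane_quadratic[OF sm sm_m even _ _ _ ab landsberg_\<phi>])
    show "\<phi> p > 0" for p using N_pos[OF nz] by (simp add: \<phi>_def)
    show "2 * \<phi> p * deriv (deriv \<phi>) p - (deriv \<phi> p)\<^sup>2 > 0" for p using D_pos by (simp add: D_def)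
    show "m p * (2 * \<phi> p * deriv (deriv \<phi>) p - (deriv \<phi> p)\<^sup>2) =
      ?a * deriv \<phi> p + ?b * (2 * \<phi> p - p * deriv \<phi> p)" for p
      using D_pos[of p] unfolding D_def[symmetric] m_def by simp
  qed
  then obtain \<kappa> where "\<And>p. \<phi> p = \<phi> 0 + \<kappa> * p\<^sup>2" by blast
  then have "N (?y p) = N v + (2 * \<kappa>) * p\<^sup>2" for p by (simp add: \<phi>_def field_simps)
  then show ?thesis by blast
qed

text \<open>By \<open>F_eq\<close> only the two lengths matter, and every \<open>y\<close> shares
  them with a vector of the plane having nonnegative coordinates. The coefficient
  \<open>\<mu>\<close> is \<open>N v\<close>.\<close>

lemma N_quadratic:
  assumes "h (c u v) u \<noteq> 0 \<or> h (c u v) v \<noteq> 0"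
  obtains \<kappa> \<mu> where "\<And>y. N y = \<kappa> * h (P y) (P y) + \<mu> * h (y - P y) (y - P y)"
proof -
  obtain \<kappa> where \<kappa>: "\<And>p. N (v + p *\<^sub>R u) = N v + \<kappa> * p\<^sup>2" using N_quadratic_on_line[OF assms] by blast
  have N_pos_q: "N (p *\<^sub>R u + q *\<^sub>R v) = \<kappa> * p\<^sup>2 + N v * q\<^sup>2" if "q > 0" for p q
  proof -
    have "p *\<^sub>R u + q *\<^sub>R v = q *\<^sub>R (v + (p / q) *\<^sub>R u)" using that by (simp add: algebra_simps)
    then have "N (p *\<^sub>R u + q *\<^sub>R v) = q\<^sup>2 * (N v + \<kappa> * (p / q)\<^sup>2)"
      by (simp only: N_scaleR[OF that] \<kappa>)
    also have "\<dots> = \<kappa> * p\<^sup>2 + N v * q\<^sup>2"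
      using that by (simp add: field_simps)
    finally show ?thesis .
  qed
  have "N (p *\<^sub>R u + q *\<^sub>R v) = \<kappa> * p\<^sup>2 + N v * q\<^sup>2" if "q \<ge> 0" for p q
  \<comment> \<open>Rescaling the line \<open>q = 1\<close> reaches only \<open>q > 0\<close>; the
    boundary value follows from the right by continuity of \<open>N\<close>.\<close>
  proof (cases "q = 0")
    case True
    have "continuous_on UNIV N"
      using minkowski unfolding N_def[abs_def] minkowski_norm_def by (intro continuous_on_power) auto
    then have N_cont: "isCont N x" for x by (simp add: continuous_on_eq_continuous_at)
    have "((\<lambda>q. p *\<^sub>R u + q *\<^sub>R v) \<longlongrightarrow> p *\<^sub>R u + 0 *\<^sub>R v) (at_right 0)"
      by (intro tendsto_intros)
    then have "((\<lambda>q. N (p *\<^sub>R u + q *\<^sub>R v)) \<longlongrightarrow> N (p *\<^sub>R u + 0 *\<^sub>R v)) (at_right 0)"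
      by (rule isCont_tendsto_compose[OF N_cont])
    moreover have "((\<lambda>q. N (p *\<^sub>R u + q *\<^sub>R v)) \<longlongrightarrow> \<kappa> * p\<^sup>2 + N v * 0\<^sup>2) (at_right 0)"
    proof (rule Lim_transform_eventually)
      show "((\<lambda>q. \<kappa> * p\<^sup>2 + N v * q\<^sup>2) \<longlongrightarrow> \<kappa> * p\<^sup>2 + N v * 0\<^sup>2) (at_right 0)"
        by (intro tendsto_intros)
      show "\<forall>\<^sub>F q in at_right 0. \<kappa> * p\<^sup>2 + N v * q\<^sup>2 = N (p *\<^sub>R u + q *\<^sub>R v)"
        using eventually_at_right_less by (rule eventually_mono) (simp add: N_pos_q)
    qed
    ultimately show ?thesis
      using tendsto_unique[OF trivial_limit_at_right_real] True by force
  qed (use N_pos_q that in simp)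
  note N_plane = this
  have h_nonneg: "h z z \<ge> 0" for z
    using h_pos[of z] by (cases "z = 0") (auto simp: h_linear less_imp_le)
  have "N y = \<kappa> * h (P y) (P y) + N v * h (y - P y) (y - P y)" for y
  proof -
    define p q where pq: "p = sqrt (h (P y) (P y))" "q = sqrt (h (y - P y) (y - P y))"
    have sq: "p * p = h (P y) (P y)" "q * q = h (y - P y) (y - P y)" and "q \<ge> 0"
      using h_nonneg unfolding pq by simp_all
    have "P (p *\<^sub>R u + q *\<^sub>R v) = p *\<^sub>R u" by (simp add: P_linear u v)
    then have "F (p *\<^sub>R u + q *\<^sub>R v) = \<psi> (p * p) (q * q)"
      unfolding F_eq[of "p *\<^sub>R u + q *\<^sub>R v"] by (simp add: h_linear u v)
    then have "N y = N (p *\<^sub>R u + q *\<^sub>R v)" unfolding N_def F_eq[of y] sq by simp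
    then show ?thesis
      using N_plane[OF \<open>q \<ge> 0\<close>, of p] by (simp only: sq power2_eq_square)
  qed
  then show thesis using that by blast
qed

text \<open>For a quadratic \<open>N\<close> the fundamental tensor is the constant form
  \<open>B\<close>, so the distortion at \<open>x0\<close> does not vary with the direction and its
  differential vanishes. The conclusion covers every nonzero \<open>y\<close>, inside the plane or
  not.\<close>

lemma spray_deriv_distortion_quadratic:
  assumes "h (c u v) u \<noteq> 0 \<or> h (c u v) v \<noteq> 0" "y \<noteq> 0"
  shows "spray_deriv f (distortion f) x0 y = 0"
proof -
  obtain \<kappa> \<mu> where N: "\<And>y. N y = \<kappa> * h (P y) (P y) + \<mu> * h (y - P y) (y - P y)"
    using N_quadratic[OF assms(1)] by blast
  define B where "B a b = \<kappa> * h (P a) (P b) + \<mu> * h (a - P a) (b - P b)" for a b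
  have B_lin: "linear (\<lambda>a. B a b)" for b
    by (rule linearI) (simp_all add: B_def P_linear h_linear algebra_simps)
  have B_commute: "B a b = B b a" for a b by (simp add: B_def h_commute)
  have B_has_derivative: "((\<lambda>a. B a b) has_derivative (\<lambda>a. B a b)) (at y)" for b y
    using B_lin by (simp add: linear_conv_bounded_linear bounded_linear_imp_has_derivative)
  have N_B: "N y = B y y" for y by (simp add: N B_def)
  have dN_B: "dN y z = 2 * B y z" if "y \<noteq> 0" for y z
  proof -
    have "bilinear B"
      unfolding bilinear_def using B_lin B_commute by (metis (no_types, lifting) ext)
    then have "bounded_bilinear B" by (simp add: bilinear_conv_bounded_bilinear)
    from bounded_bilinear.FDERIV[OF this has_derivative_ident has_derivative_ident, of y UNIV]
    have "(N has_derivative (\<lambda>z. B y z + B z y)) (at y)"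
      by (simp add: N_B[abs_def])
    from has_derivative_unique[OF this N_has_derivative[OF that]] show ?thesis
      using B_commute by (metis mult_2)
  qed
  have ft: "fundamental_tensor F y $ i $ j = B (axis j 1) (axis i 1)" if "y \<noteq> 0" for y i j
  proof -
    have "((\<lambda>y. 2 * B y (axis i 1)) has_derivative (\<lambda>z. 2 * B z (axis i 1))) (at y)"
      by (intro has_derivative_mult_right B_has_derivative)
    then have "((\<lambda>y. dN y (axis i 1)) has_derivative (\<lambda>z. 2 * B z (axis i 1))) (at y)"
      by (rule has_derivative_transform_within_open[OF _ open_slit]) (use that in \<open>auto simp: dN_B\<close>)
    from fun_cong[OF frechet_derivative_at[OF this], of "axis j 1"] show ?thesis
      by (simp add: fundamental_tensor_nth)
  qed
  have ft_const: "fundamental_tensor F z = fundamental_tensor F y" if "z \<noteq> 0" for z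
  proof -
    have "fundamental_tensor F z $ i $ j = fundamental_tensor F y $ i $ j" for i j
      unfolding ft[OF that] ft[OF assms(2)] ..
    then show ?thesis by (simp add: vec_eq_iff)
  qed
  have const: "distortion f x0 z = distortion f x0 y" if "z \<noteq> 0" for z
    unfolding distortion_eq[OF that] distortion_eq[OF assms(2)] ft_const[OF that] ..
  obtain dT where dT: "(distortion f x0 has_derivative dT) (at y)"
    "spray_deriv f (distortion f) x0 y = - dT (Y y)"
    using spray_deriv_distortion[OF assms(2)] .
  have "(distortion f x0 has_derivative (\<lambda>_. 0)) (at y)"
  proof (rule has_derivative_transform_within_open[OF has_derivative_const[of "distortion f x0 y"] open_slit])
    show "distortion f x0 y = distortion f x0 z" if "z \<in> - {0}" for z
      using const[of z] that by simp
  qed (use assms(2) in simp)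
  then have "dT = (\<lambda>_. 0)" using dT(1) has_derivative_unique by blast
  then show ?thesis using dT(2) by simp
qed

end

context landsberg_family
begin

text \<open>Every \<open>y\<close> lies in an adapted plane, spanned by the normalised vectors
  \<open>P y\<close> and \<open>y - P y\<close>, and either alternative for the torsion of that
  plane gives the claim.\<close>

theorem spray_deriv_distortion_eq_0:
  assumes "y \<noteq> 0"
  shows "spray_deriv f (distortion f) x0 y = 0"
proof -
  have unit: "\<exists>z. Q z \<and> h z z = 1 \<and> w = sqrt (h w w) *\<^sub>R z"
    if ex: "\<exists>z. z \<noteq> 0 \<and> Q z" and w: "Q w" and scale: "\<And>r z. Q z \<Longrightarrow> Q (r *\<^sub>R z)" for Q w
  proof -
    obtain z0 where z0: "z0 \<noteq> 0" "Q z0" using ex by blast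
    \<comment> \<open>A vanishing part gives no direction; any unit vector of that summand then
      serves, with coefficient \<open>0\<close>.\<close>
    define z where "z = (if w = 0 then z0 else w)"
    have z: "z \<noteq> 0" "Q z" using z0 w by (auto simp: z_def)
    let ?e = "(1 / sqrt (h z z)) *\<^sub>R z"
    have "h ?e ?e = 1" using h_pos[OF z(1)] by (simp add: h_linear)
    moreover have "w = sqrt (h w w) *\<^sub>R ?e"
      using h_pos[of w] by (cases "w = 0") (auto simp: h_linear z_def)
    ultimately show ?thesis using scale[OF z(2)] by blast
  qed
  obtain u where u: "P u = u" "h u u = 1" "P y = sqrt (h (P y) (P y)) *\<^sub>R u"
    using unit[of "\<lambda>u. P u = u" "P y"] P_nontrivial(1) P_P P_linear(3) by auto
  obtain v where v: "P v = 0" "h v v = 1" "y - P y = sqrt (h (y - P y) (y - P y)) *\<^sub>R v"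
    using unit[of "\<lambda>v. P v = 0" "y - P y"] P_nontrivial(2) P_P P_linear by auto
  have y: "y = sqrt (h (P y) (P y)) *\<^sub>R u + sqrt (h (y - P y) (y - P y)) *\<^sub>R v"
    using u(3) v(3) by (metis diff_add_cancel add.commute)
  interpret orthonormal_plane F f x0 W \<Theta> A h P \<psi> u v
    by unfold_locales (use u v in auto)
  show ?thesis
    using spray_deriv_distortion_zero[OF y assms] spray_deriv_distortion_quadratic[OF _ assms] by blast
qed

end

section \<open>Orthonormal frames\<close>

lemma differentiable_scaleR:
  fixes r :: "'a::real_normed_vector \<Rightarrow> real" and v :: "'a \<Rightarrow> 'b::real_normed_vector"
  assumes "r differentiable (at x)" "v differentiable (at x)"
  shows "(\<lambda>x. r x *\<^sub>R v x) differentiable (at x)"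
  using assms unfolding differentiable_def by (blast intro: has_derivative_scaleR)

lemma differentiable_inverse_sqrt:
  fixes r :: "'a::real_normed_vector \<Rightarrow> real"
  assumes "r differentiable (at x)" "r x > 0"
  shows "(\<lambda>x. inverse (sqrt (r x))) differentiable (at x)"
proof -
  from assms(1) obtain r' where r': "(r has_derivative r') (at x)" by (auto simp: differentiable_def)
  show ?thesis
    unfolding differentiable_def using assms(2)
    by (intro exI) (rule derivative_eq_intros r' refl | simp)+
qed

text \<open>The last assumption is the form in which Gram-Schmidt uses the metric: the pairing of
  two fields differentiable at \<open>x0\<close> is differentiable there. First order at one point
  is all that \<open>linear_family\<close> asks of \<open>\<Theta>\<close>.\<close>

locale inner_product_family =
  fixes h :: "'a::real_normed_vector \<Rightarrow> 'b::real_normed_vector \<Rightarrow> 'b \<Rightarrow> real"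
    and W :: "'a set" and x0 :: 'a
  assumes x0: "x0 \<in> W"
    and linear_h: "\<And>x b. x \<in> W \<Longrightarrow> linear (\<lambda>a. h x a b)"
    and h_commute: "\<And>x a b. x \<in> W \<Longrightarrow> h x a b = h x b a"
    and h_pos: "\<And>x a. x \<in> W \<Longrightarrow> a \<noteq> 0 \<Longrightarrow> h x a a > 0"
    and differentiable_h: "\<And>f g. f differentiable (at x0) \<Longrightarrow> g differentiable (at x0) \<Longrightarrow>
      (\<lambda>x. h x (f x) (g x)) differentiable (at x0)"
begin

lemma linear_h': "x \<in> W \<Longrightarrow> linear (h x a)"
  using linear_h[of x a] h_commute[of x a] by presburger

lemmas h_simps = linear_add[OF linear_h] linear_diff[OF linear_h] linear_cmul[OF linear_h]
  linear_0[OF linear_h] linear_sum[OF linear_h] linear_add[OF linear_h'] linear_diff[OF linear_h']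
  linear_cmul[OF linear_h'] linear_0[OF linear_h'] linear_sum[OF linear_h']

definition orthonormal_frame :: "nat \<Rightarrow> (nat \<Rightarrow> 'a \<Rightarrow> 'b) \<Rightarrow> bool" where
  "orthonormal_frame m w \<longleftrightarrow> (\<forall>k<m. w k differentiable (at x0)) \<and>
    (\<forall>x\<in>W. \<forall>i<m. \<forall>j<m. h x (w i x) (w j x) = (if i = j then 1 else 0))"

lemma orthonormal_frame_sum:
  assumes "orthonormal_frame m w" "x \<in> W" "j < m"
  shows "(\<Sum>i<m. t i * h x (w i x) (w j x)) = t j"
proof -
  have "(\<Sum>i<m. t i * h x (w i x) (w j x)) = (\<Sum>i<m. if i = j then t i else 0)"
    using assms by (intro sum.cong) (auto simp: orthonormal_frame_def)
  then show ?thesis using assms(3) by simp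
qed

text \<open>Linear independence is stated in the form that the induction consumes: it keeps the
  residual \<open>v x\<close> nonzero on all of \<open>W\<close>, so that it can be normalised,
  differentiably at \<open>x0\<close>.\<close>

lemma gram_schmidt:
  assumes "\<And>k. k < m \<Longrightarrow> e k differentiable (at x0)"
    and "\<And>x k. x \<in> W \<Longrightarrow> k < m \<Longrightarrow> e k x \<notin> span ((\<lambda>i. e i x) ` {..<k})"
  shows "\<exists>w. orthonormal_frame m w \<and>
    (\<forall>x\<in>W. span ((\<lambda>i. w i x) ` {..<m}) = span ((\<lambda>i. e i x) ` {..<m}))"
  using assms
proof (induction m)
  case 0
  then show ?case by (auto simp: orthonormal_frame_def)
next
  case (Suc m)
  then obtain w where w: "orthonormal_frame m w"
    and span_w: "\<And>x. x \<in> W \<Longrightarrow> span ((\<lambda>i. w i x) ` {..<m}) = span ((\<lambda>i. e i x) ` {..<m})"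
    by force
  define v where "v x = e m x - (\<Sum>i<m. h x (e m x) (w i x) *\<^sub>R w i x)" for x
  define r where "r x = inverse (sqrt (h x (v x) (v x)))" for x
  define w' where "w' = w(m := \<lambda>x. r x *\<^sub>R v x)"
  have sum_in: "(\<Sum>i<m. h x (e m x) (w i x) *\<^sub>R w i x) \<in> span ((\<lambda>i. w i x) ` {..<m})" for x
    by (intro span_sum span_scale span_base) auto
  have v_nz: "v x \<noteq> 0" if "x \<in> W" for x
    using sum_in[of x] Suc.prems(2)[OF that, of m] span_w[OF that] by (auto simp: v_def)
  then have hv: "h x (v x) (v x) > 0" if "x \<in> W" for x using h_pos that by blast
  then have r: "r x > 0" if "x \<in> W" for x using that by (simp add: r_def)
  have h_v_w: "h x (v x) (w j x) = 0" if "x \<in> W" "j < m" for x j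
    using orthonormal_frame_sum[OF w that] that by (simp add: v_def h_simps)
  have diff_v: "v differentiable (at x0)"
    unfolding v_def[abs_def] using w Suc.prems(1)
    by (intro differentiable_diff differentiable_sum ballI differentiable_scaleR differentiable_h)
      (auto simp: orthonormal_frame_def)
  have "orthonormal_frame (Suc m) w'"
    unfolding orthonormal_frame_def
  proof (intro conjI allI ballI impI)
    fix k assume "k < Suc m"
    show "w' k differentiable at x0"
    proof (cases "k = m")
      case True
      then show ?thesis
        unfolding w'_def r_def using diff_v hv[OF x0]
        by (auto intro!: differentiable_scaleR differentiable_inverse_sqrt differentiable_h)
    qed (use \<open>k < Suc m\<close> w in \<open>auto simp: w'_def orthonormal_frame_def\<close>)
  next
    fix x i j assume *: "x \<in> W" "i < Suc m" "j < Suc m"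
    have "h x (w' m x) (w' m x) = 1"
      using hv[OF *(1)] by (simp add: w'_def h_simps *(1) r_def field_simps)
    moreover have "h x (w' m x) (w' j x) = 0" "h x (w' j x) (w' m x) = 0" if "j < m" for j
      using that h_v_w[OF *(1) that] h_commute[OF *(1), of "w j x" "v x"]
      by (simp_all add: w'_def h_simps *(1))
    moreover have "h x (w' i x) (w' j x) = (if i = j then 1 else 0)" if "i < m" "j < m"
      using w that *(1) by (simp add: w'_def orthonormal_frame_def)
    ultimately show "h x (w' i x) (w' j x) = (if i = j then 1 else 0)"
      using * by (auto simp: less_Suc_eq)
  qed
  moreover have "span ((\<lambda>i. w' i x) ` {..<Suc m}) = span ((\<lambda>i. e i x) ` {..<Suc m})" if "x \<in> W" for x
  proof -
    let ?w = "(\<lambda>i. w i x) ` {..<m}" and ?e = "(\<lambda>i. e i x) ` {..<m}"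
    have img: "(\<lambda>i. w' i x) ` {..<Suc m} = insert (r x *\<^sub>R v x) ?w" "(\<lambda>i. e i x) ` {..<Suc m} = insert (e m x) ?e"
      by (auto simp: w'_def lessThan_Suc)
    let ?z = "\<Sum>i<m. h x (e m x) (w i x) *\<^sub>R w i x"
    have e_sub: "span ?w \<subseteq> span (insert (e m x) ?e)"
      unfolding span_w[OF that] by (rule span_mono) (rule subset_insertI)
    have w_sub: "span ?w \<subseteq> span (insert (r x *\<^sub>R v x) ?w)"
      by (rule span_mono) (rule subset_insertI)
    have "?w \<subseteq> span (insert (e m x) ?e)"
      using span_superset e_sub by (rule subset_trans)
    moreover have "?e \<subseteq> span (insert (r x *\<^sub>R v x) ?w)"
      using span_superset w_sub[unfolded span_w[OF that]] by (rule subset_trans)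
    moreover have "r x *\<^sub>R v x \<in> span (insert (e m x) ?e)"
      unfolding v_def by (intro span_scale span_diff span_base[of "e m x"] subsetD[OF e_sub] sum_in) simp
    moreover have "e m x \<in> span (insert (r x *\<^sub>R v x) ?w)"
    proof -
      have "e m x = inverse (r x) *\<^sub>R (r x *\<^sub>R v x) + ?z"
        using r[OF that] by (simp add: v_def)
      moreover have "inverse (r x) *\<^sub>R (r x *\<^sub>R v x) + ?z \<in> span (insert (r x *\<^sub>R v x) ?w)"
        by (intro span_add span_scale[of "r x *\<^sub>R v x"] span_base[of "r x *\<^sub>R v x"] subsetD[OF w_sub] sum_in) simp
      ultimately show ?thesis by (simp only:)
    qed
    ultimately have "insert (r x *\<^sub>R v x) ?w \<subseteq> span (insert (e m x) ?e)"
      "insert (e m x) ?e \<subseteq> span (insert (r x *\<^sub>R v x) ?w)" by simp_all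
    then show ?thesis
      unfolding img by (intro subset_antisym span_minimal subspace_span)
  qed
  ultimately show ?case by blast
qed

end

text \<open>The map \<open>T x\<close> sends \<open>y\<close> to the vector whose inner products
  with the frame at \<open>x0\<close> are those of \<open>y\<close> with the frame at
  \<open>x\<close>. It carries \<open>f x\<close> to \<open>f x0\<close> and is the identity at
  \<open>x0\<close>, so its matrix is the \<open>\<Theta>\<close> of
  \<open>linear_family\<close>.\<close>

lemma spray_deriv_distortion_orthonormal_frames:
  fixes f :: "real^'n::finite \<Rightarrow> real^'n \<Rightarrow> real" and L :: "real \<Rightarrow> real \<Rightarrow> real"
  assumes "inner_product_family h W x0" and W: "open W"
    and w: "inner_product_family.orthonormal_frame h W x0 n1 w1"
      "inner_product_family.orthonormal_frame h W x0 n2 w2" "1 \<le> n1" "1 \<le> n2"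
    and w1_w2: "\<And>i j. i < n1 \<Longrightarrow> j < n2 \<Longrightarrow> h x0 (w1 i x0) (w2 j x0) = 0"
    and expansion: "\<And>y. y = (\<Sum>i<n1. h x0 y (w1 i x0) *\<^sub>R w1 i x0) + (\<Sum>j<n2. h x0 y (w2 j x0) *\<^sub>R w2 j x0)"
    and f: "\<And>x y. x \<in> W \<Longrightarrow> f x y = sqrt (L (\<Sum>i<n1. (h x y (w1 i x))\<^sup>2) (\<Sum>j<n2. (h x y (w2 j x))\<^sup>2))"
    and mink: "minkowski_norm (f x0)"
    and landsberg: "\<And>y p q r. y \<noteq> 0 \<Longrightarrow> (\<Sum>i\<in>UNIV. \<Sum>j\<in>UNIV. y $ j * g_mat f x0 y $ i $ j *
      dy r (dy q (dy p (spray_coeff f i))) x0 y) = 0"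
    and y: "y \<noteq> 0"
  shows "spray_deriv f (distortion f) x0 y = 0"
proof -
  interpret inner_product_family h W x0 by fact
  let ?P = "\<lambda>y. \<Sum>i<n1. h x0 y (w1 i x0) *\<^sub>R w1 i x0" and ?Q = "\<lambda>y. \<Sum>j<n2. h x0 y (w2 j x0) *\<^sub>R w2 j x0"
  define T where "T x y = (\<Sum>i<n1. h x y (w1 i x) *\<^sub>R w1 i x0) + (\<Sum>j<n2. h x y (w2 j x) *\<^sub>R w2 j x0)" for x y
  have lin_T: "linear (T x)" if "x \<in> W" for x
    using that by (intro linearI) (simp_all add: T_def h_simps scaleR_add_left scaleR_add_right sum.distrib scaleR_sum_right)
  have T_mult: "matrix (T x) *v y = T x y" if "x \<in> W" for x y
    using lin_T[OF that] by (intro matrix_works) (simp add: linear_matrix_vector_mul_eq)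
  have w2_w1: "h x0 (w2 j x0) (w1 i x0) = 0" if "i < n1" "j < n2" for i j
    using w1_w2[OF that] h_commute[OF x0] by simp
  have comp1: "h x0 (\<Sum>i<n1. s i *\<^sub>R w1 i x0) (w1 i x0) = s i"
    "h x0 (\<Sum>j<n2. t j *\<^sub>R w2 j x0) (w1 i x0) = 0" if "i < n1" for s t i
    using orthonormal_frame_sum[OF w(1) x0 that] w2_w1[OF that] by (simp_all add: h_simps x0)
  have comp2: "h x0 (\<Sum>i<n1. s i *\<^sub>R w1 i x0) (w2 j x0) = 0"
    "h x0 (\<Sum>j<n2. t j *\<^sub>R w2 j x0) (w2 j x0) = t j" if "j < n2" for s t j
    using orthonormal_frame_sum[OF w(2) x0 that] w1_w2[OF _ that] by (simp_all add: h_simps x0)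
  have comp_T: "h x0 (T x y) (w1 i x0) = h x y (w1 i x)" if "i < n1" for x y i
    using comp1[OF that] by (simp add: T_def h_simps(1)[OF x0])
  have comp_T': "h x0 (T x y) (w2 j x0) = h x y (w2 j x)" if "j < n2" for x y j
    using comp2[OF that] by (simp add: T_def h_simps(1)[OF x0])
  have diff_T: "(\<lambda>x. matrix (T x)) differentiable (at x0)"
  proof -
    have *: "(\<lambda>x. h x y (w1 i x)) differentiable (at x0)" if "i < n1" for y i
      using w(1) that by (intro differentiable_h) (auto simp: orthonormal_frame_def)
    have **: "(\<lambda>x. h x y (w2 i x)) differentiable (at x0)" if "i < n2" for y i
      using w(2) that by (intro differentiable_h) (auto simp: orthonormal_frame_def)
    have "(\<lambda>x. T x (axis b 1) $ a) differentiable (at x0)" for a b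
      unfolding T_def by (simp, intro differentiable_add differentiable_sum ballI differentiable_mult differentiable_const)
        (auto intro: * **)
    then show ?thesis
      by (subst differentiable_componentwise_within) (auto simp: Basis_vec_def inner_axis matrix_def)
  qed
  have h0: "h x0 (?P y) z = h x0 y (?P z)" for y z
    using h_commute[OF x0, of _ z] by (simp add: h_simps x0 mult.commute)
  have norm_P: "h x0 (?P y) (?P y) = (\<Sum>i<n1. (h x0 y (w1 i x0))\<^sup>2)" for y
    using comp1(1)[of _ "\<lambda>i. h x0 y (w1 i x0)"]
    by (subst linear_sum[OF linear_h'[OF x0]], intro sum.cong) (simp_all add: linear_cmul[OF linear_h'[OF x0]] power2_eq_square)
  have norm_Q: "h x0 (?Q y) (?Q y) = (\<Sum>j<n2. (h x0 y (w2 j x0))\<^sup>2)" for y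
    using comp2(2)[of _ "\<lambda>i. h x0 y (w2 i x0)"]
    by (subst linear_sum[OF linear_h'[OF x0]], intro sum.cong) (simp_all add: linear_cmul[OF linear_h'[OF x0]] power2_eq_square)
  have Q: "y - ?P y = ?Q y" for y
    unfolding diff_eq_eq add.commute[of "?Q y"] by (rule expansion)
  have P_w1: "?P (w1 0 x0) = w1 0 x0" "w1 0 x0 \<noteq> 0"
  proof -
    have "?P (w1 0 x0) = (\<Sum>i<n1. if i = 0 then w1 i x0 else 0)"
      using w(1,3) x0 by (intro sum.cong) (auto simp: orthonormal_frame_def)
    then show "?P (w1 0 x0) = w1 0 x0" using w(3) by simp
    have "h x0 (w1 0 x0) (w1 0 x0) = 1" using w(1,3) x0 by (simp add: orthonormal_frame_def)
    then show "w1 0 x0 \<noteq> 0" using linear_0[OF linear_h[OF x0]] by force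
  qed
  have P_w2: "?P (w2 0 x0) = 0" "w2 0 x0 \<noteq> 0"
  proof -
    show "?P (w2 0 x0) = 0" using w2_w1 w(4) by simp
    have "h x0 (w2 0 x0) (w2 0 x0) = 1" using w(2,4) x0 by (simp add: orthonormal_frame_def)
    then show "w2 0 x0 \<noteq> 0" using linear_0[OF linear_h[OF x0]] by force
  qed
  interpret landsberg_family "f x0" f x0 W "\<lambda>x. matrix (T x)" "frechet_derivative (\<lambda>x. matrix (T x)) (at x0)"
    "h x0" ?P "\<lambda>s t. sqrt (L s t)"
  proof (intro landsberg_family.intro linear_family.intro minkowski.intro
      linear_family_axioms.intro landsberg_family_axioms.intro)
    show "f x y = f x0 (matrix (T x) *v y)" if "x \<in> W" for x y
      using that comp_T comp_T' by (simp add: T_mult f x0)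
    show "matrix (T x0) = mat 1"
      unfolding matrix_eq using T_mult[OF x0] expansion by (simp add: T_def)
    show "f x0 y = sqrt (L (h x0 (?P y) (?P y)) (h x0 (y - ?P y) (y - ?P y)))" for y
      unfolding Q norm_P norm_Q by (simp add: f x0)
    show "linear ?P"
      by (rule linearI) (simp_all add: h_simps x0 scaleR_add_left sum.distrib scaleR_sum_right)
    show "?P (?P y) = ?P y" for y
      using comp1(1) by (intro sum.cong) auto
    show "((\<lambda>x. matrix (T x)) has_derivative frechet_derivative (\<lambda>x. matrix (T x)) (at x0)) (at x0)"
      using diff_T by (simp add: frechet_derivative_works)
    show "\<exists>u. u \<noteq> 0 \<and> ?P u = u" using P_w1 by blast
    show "\<exists>v. v \<noteq> 0 \<and> ?P v = 0" using P_w2 by blast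
    show "h x0 (?P y) z = h x0 y (?P z)" for y z by (rule h0)
  qed (use mink W x0 linear_h h_commute h_pos landsberg in auto)
  show ?thesis by (rule spray_deriv_distortion_eq_0[OF y])
qed

section \<open>Tangent spaces in coordinates\<close>

locale manifold =
  fixes X :: "'m topology" and A :: "('m, 'n::finite) chart set"
  assumes manifold: "smooth_manifold X A"
begin

lemma is_chart: "c \<in> A \<Longrightarrow> is_chart X c"
  using manifold by (simp add: smooth_manifold_def)

lemma topspace_chart:
  assumes "c \<in> A"
  shows "topspace (subtopology X (chart_dom c)) = chart_dom c"
  using is_chart[OF assms] openin_subset unfolding is_chart_def by fastforce

lemma inj_on_chart:
  assumes "c \<in> A"
  shows "inj_on (chart_map c) (chart_dom c)"
  using is_chart[OF assms] homeomorphic_imp_injective_map topspace_chart[OF assms]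
  unfolding is_chart_def by metis

lemma chart_inv_chart_map [simp]: "c \<in> A \<Longrightarrow> q \<in> chart_dom c \<Longrightarrow> chart_inv c (chart_map c q) = q"
  using inj_on_chart by (rule inv_into_f_f)

lemma open_chart_img: "c \<in> A \<Longrightarrow> open (chart_img c)"
  using is_chart by (simp add: is_chart_def)

lemma open_chart_image:
  assumes "c \<in> A" "openin X S"
  shows "open (chart_map c ` (chart_dom c \<inter> S))"
proof -
  have "open_map (subtopology X (chart_dom c)) (top_of_set (chart_img c)) (chart_map c)"
    using is_chart[OF assms(1)] homeomorphic_imp_open_map unfolding is_chart_def by blast
  moreover have "openin (subtopology X (chart_dom c)) (chart_dom c \<inter> S)"
    using assms(2) by (auto simp: openin_subtopology)
  ultimately have "openin (top_of_set (chart_img c)) (chart_map c ` (chart_dom c \<inter> S))"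
    by (auto simp: open_map_def)
  then show ?thesis using open_chart_img[OF assms(1)] by (simp add: openin_open_eq)
qed

lemma openin_chart_dom: "c \<in> A \<Longrightarrow> openin X (chart_dom c)"
  using is_chart by (simp add: is_chart_def)

lemma charts_atD: "c \<in> charts_at A q \<Longrightarrow> c \<in> A" "c \<in> charts_at A q \<Longrightarrow> q \<in> chart_dom c"
  by (simp_all add: charts_at_def)

lemma transition_chart_map:
  "c \<in> A \<Longrightarrow> q \<in> chart_dom c \<Longrightarrow> transition c d (chart_map c q) = chart_map d q"
  by (simp add: transition_def)

abbreviation dtransition :: "('m, 'n) chart \<Rightarrow> ('m, 'n) chart \<Rightarrow> 'm \<Rightarrow> real^'n \<Rightarrow> real^'n" where
  "dtransition c d q \<equiv> frechet_derivative (transition c d) (at (chart_map c q))"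

lemma transition_has_derivative:
  assumes "c \<in> charts_at A q" "d \<in> charts_at A q"
  shows "(transition c d has_derivative dtransition c d q) (at (chart_map c q))"
proof -
  have "compatible c d"
    using manifold charts_atD assms by (auto simp: smooth_manifold_def)
  then show ?thesis
    using assms by (intro smooth_on_has_derivative) (auto simp: compatible_def charts_at_def)
qed

lemma linear_dtransition:
  "c \<in> charts_at A q \<Longrightarrow> d \<in> charts_at A q \<Longrightarrow> linear (dtransition c d q)"
  using transition_has_derivative has_derivative_linear by blast

lemma dtransition_self:
  assumes "c \<in> charts_at A q"
  shows "dtransition c c q y = y"
proof -
  have c: "c \<in> A" "q \<in> chart_dom c" using assms charts_atD by blast+
  have "(transition c c has_derivative (\<lambda>y. y)) (at (chart_map c q))"
    by (rule has_derivative_transform_within_open[OF has_derivative_ident open_chart_img[OF c(1)]])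
      (use c transition_chart_map[OF c(1), of _ c] in auto)
  from frechet_derivative_at[OF this] show ?thesis by metis
qed

text \<open>The cocycle rule is the chain rule on the open image of the common domain of the three
  charts; it makes \<open>coord_vec\<close> obey the transformation rule of tangent vectors.\<close>

lemma dtransition_compose:
  assumes "c \<in> charts_at A q" "d \<in> charts_at A q" "e \<in> charts_at A q"
  shows "dtransition d e q (dtransition c d q y) = dtransition c e q y"
proof -
  have c: "c \<in> A" "q \<in> chart_dom c" and d: "d \<in> A" "q \<in> chart_dom d" and e: "e \<in> A" "q \<in> chart_dom e"
    using assms charts_atD by blast+
  let ?S = "chart_map c ` (chart_dom c \<inter> (chart_dom d \<inter> chart_dom e))"
  have S: "open ?S" "chart_map c q \<in> ?S"
    using c d e openin_chart_dom[OF d(1)] openin_chart_dom[OF e(1)] by (auto intro!: open_chart_image openin_Int)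
  have "((\<lambda>z. transition d e (transition c d z)) has_derivative (\<lambda>y. dtransition d e q (dtransition c d q y)))
      (at (chart_map c q))"
    using has_derivative_compose[OF transition_has_derivative[OF assms(1,2)], of "transition d e" "dtransition d e q"]
      transition_has_derivative[OF assms(2,3)] transition_chart_map[OF c] by simp
  then have "(transition c e has_derivative (\<lambda>y. dtransition d e q (dtransition c d q y))) (at (chart_map c q))"
    by (rule has_derivative_transform_within_open[OF _ S]) (use transition_chart_map[OF c(1), of _ d] transition_chart_map[OF c(1), of _ e]
        transition_chart_map[OF d(1), of _ e] in auto)
  from frechet_derivative_at[OF this] show ?thesis by metis
qed

lemma components_coord_vec:
  "d \<in> charts_at A q \<Longrightarrow> components (coord_vec A c q y) d = dtransition c d q y"
  by (simp add: coord_vec_def)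

lemma components_coord_vec_self [simp]:
  "c \<in> charts_at A q \<Longrightarrow> components (coord_vec A c q y) c = y"
  by (simp add: coord_vec_def dtransition_self)

lemma coord_vec_tangent [simp]: "c \<in> charts_at A q \<Longrightarrow> coord_vec A c q y \<in> tangent_space A q"
  by (simp add: tangent_space_def coord_vec_def dtransition_compose)

lemma coord_vec_components [simp]:
  assumes "c \<in> charts_at A q" "u \<in> tangent_space A q"
  shows "coord_vec A c q (components u c) = u"
  unfolding tvec_eq_iff
proof
  fix d
  show "components (coord_vec A c q (components u c)) d = components u d"
  proof (cases "d \<in> charts_at A q")
    case True
    then have "components u d = dtransition c d q (components u c)"
      using assms unfolding tangent_space_def by blast
    then show ?thesis by (simp only: components_coord_vec[OF True])
  next
    case False
    then have "components u d = 0" using assms(2) unfolding tangent_space_def by blast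
    with False show ?thesis by (simp add: coord_vec_def)
  qed
qed

lemma linear_coord_vec:
  assumes "c \<in> charts_at A q"
  shows "linear (coord_vec A c q)"
proof (rule linearI)
  show "coord_vec A c q (y + z) = coord_vec A c q y + coord_vec A c q z" for y z
    using linear_add[OF linear_dtransition[OF assms]] by (auto simp: coord_vec_def plus_tvec_def tvec_eq_iff)
  show "coord_vec A c q (r *\<^sub>R y) = r *\<^sub>R coord_vec A c q y" for r y
    using linear_cmul[OF linear_dtransition[OF assms]] by (auto simp: coord_vec_def scaleR_tvec_def tvec_eq_iff)
qed

end

section \<open>Adapted orthonormal frames in a chart\<close>

locale riemannian = manifold X A for X :: "'m topology" and A :: "('m, 'n::finite) chart set" +
  fixes a :: "'m \<Rightarrow> ('m, 'n) tvec \<Rightarrow> ('m, 'n) tvec \<Rightarrow> real"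
  assumes riemannian: "riemannian_metric X A a"
begin

definition metric_in_chart :: "('m, 'n) chart \<Rightarrow> real^'n \<Rightarrow> real^'n \<Rightarrow> real^'n \<Rightarrow> real" where
  "metric_in_chart c x y z =
    a (chart_inv c x) (coord_vec A c (chart_inv c x) y) (coord_vec A c (chart_inv c x) z)"

lemma chart_inv_in_charts_at: "c \<in> A \<Longrightarrow> x \<in> chart_img c \<Longrightarrow> c \<in> charts_at A (chart_inv c x)"
  by (auto simp: charts_at_def)

lemma charts_at_topspace: "c \<in> charts_at A q \<Longrightarrow> q \<in> topspace X"
  by (rule subsetD[OF openin_subset[OF openin_chart_dom[OF charts_atD(1)]] charts_atD(2)])

lemma metric_simps:
  assumes "q \<in> topspace X" "u \<in> tangent_space A q" "v \<in> tangent_space A q" "w \<in> tangent_space A q"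
  shows "a q u v = a q v u" "a q (u + v) w = a q u w + a q v w" "a q (r *\<^sub>R u) v = r * a q u v"
    "u \<noteq> 0 \<Longrightarrow> 0 < a q u u"
  using riemannian assms unfolding riemannian_metric_def by blast+

lemma inner_product_family_metric:
  assumes "c \<in> A" "open W" "W \<subseteq> chart_img c" "x0 \<in> W"
  shows "inner_product_family (metric_in_chart c) W x0"
proof (intro inner_product_family.intro)
  note cq = chart_inv_in_charts_at[OF assms(1) subsetD[OF assms(3)]]
  note m = metric_simps[OF charts_at_topspace[OF cq] coord_vec_tangent[OF cq] coord_vec_tangent[OF cq] coord_vec_tangent[OF cq]]
  note l = linear_add[OF linear_coord_vec[OF cq]] linear_cmul[OF linear_coord_vec[OF cq]]
  show lin: "linear (\<lambda>y. metric_in_chart c x y z)" if "x \<in> W" for x z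
    using that by (intro linearI) (simp_all add: metric_in_chart_def l m)
  show comm: "metric_in_chart c x y z = metric_in_chart c x z y" if "x \<in> W" for x y z
    using that m(1) by (simp add: metric_in_chart_def)
  show "metric_in_chart c x y y > 0" if "x \<in> W" "y \<noteq> 0" for x y
  proof -
    have "coord_vec A c (chart_inv c x) y \<noteq> 0"
    proof
      assume "coord_vec A c (chart_inv c x) y = 0"
      then have "y = components (0 :: ('m, 'n) tvec) c"
        using components_coord_vec_self[OF cq[OF that(1)], of y] by simp
      then show False using that(2) by (simp add: zero_tvec_def)
    qed
    then show ?thesis unfolding metric_in_chart_def using m(4)[OF that(1) that(1) that(1) that(1)] by blast
  qed
  show "(\<lambda>x. metric_in_chart c x (f x) (g x)) differentiable at x0"
    if "f differentiable (at x0)" "g differentiable (at x0)" for f g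
  proof -
    let ?H = "\<lambda>i j x. metric_in_chart c x (axis i 1) (axis j 1)"
    have H: "?H i j differentiable (at x0)" for i j
    proof -
      have "smooth_on (chart_img c) (?H i j)"
        using riemannian assms(1) by (simp add: riemannian_metric_def metric_in_chart_def)
      then show ?thesis using assms(3,4) smooth_on_differentiable by blast
    qed
    have nth: "(\<lambda>x. f x $ i) differentiable (at x0)" if "f differentiable (at x0)" for f :: "real^'n \<Rightarrow> real^'n" and i
      using that unfolding differentiable_def by (blast intro: bounded_linear.has_derivative[OF bounded_linear_vec_nth])
    \<comment> \<open>\<open>riemannian_metric\<close> gives regularity on coordinate vectors;
      bilinearity transfers it to arbitrary differentiable fields.\<close>
    let ?s = "\<lambda>x. \<Sum>i\<in>UNIV. f x $ i * (\<Sum>j\<in>UNIV. g x $ j * ?H j i x)"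
    have "?s differentiable (at x0)"
      by (intro differentiable_sum ballI differentiable_mult nth that H finite)
    moreover have "?s x = metric_in_chart c x (f x) (g x)" if "x \<in> W" for x
    proof -
      have "metric_in_chart c x (f x) (g x) = (\<Sum>i\<in>UNIV. f x $ i * metric_in_chart c x (axis i 1) (g x))"
        by (rule linear_axis_sum[OF lin[OF that]])
      also have "\<dots> = (\<Sum>i\<in>UNIV. f x $ i * metric_in_chart c x (g x) (axis i 1))"
        using comm[OF that, of "g x"] by simp
      also have "\<dots> = ?s x"
        by (intro sum.cong refl) (subst linear_axis_sum[OF lin[OF that], of "g x"], rule refl)
      finally show ?thesis by simp
    qed
    ultimately show ?thesis
      unfolding differentiable_def by (metis (no_types, lifting) has_derivative_transform_within_open[OF _ assms(2,4)])
  qed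
qed (use assms in auto)

text \<open>\<open>W\<close> is quantified after \<open>W'\<close> because
  \<open>orthonormal_frame\<close> depends on the set, and the frames of both subbundles have to
  live on one common \<open>W\<close> inside the intersection of their neighbourhoods.\<close>

lemma orthonormal_frame_subbundle:
  assumes "smooth_subbundle X A k V" "c \<in> charts_at A p"
  shows "\<exists>W'. openin X W' \<and> p \<in> W' \<and>
    (\<forall>W. W \<subseteq> chart_map c ` (chart_dom c \<inter> W') \<longrightarrow> open W \<longrightarrow> chart_map c p \<in> W \<longrightarrow>
      (\<exists>w. inner_product_family.orthonormal_frame (metric_in_chart c) W (chart_map c p) k w \<and>
        (\<forall>x\<in>W. V (chart_inv c x) = coord_vec A c (chart_inv c x) ` span ((\<lambda>i. w i x) ` {..<k}))))"
proof -
  have c: "c \<in> A" "p \<in> chart_dom c" using assms charts_atD by blast+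
  obtain W' E where W': "openin X W'" "p \<in> W'" and smooth: "\<And>i. i < k \<Longrightarrow> smooth_vector_field A W' (E i)"
    and E: "\<And>q. q \<in> W' \<Longrightarrow> inj_on (\<lambda>i. E i q) {..<k} \<and> independent ((\<lambda>i. E i q) ` {..<k}) \<and>
           V q = span ((\<lambda>i. E i q) ` {..<k})"
    using assms(1) charts_at_topspace[OF assms(2)] unfolding smooth_subbundle_def by metis
  show ?thesis
  proof (intro exI[of _ W'] conjI allI impI W')
    fix W assume W: "W \<subseteq> chart_map c ` (chart_dom c \<inter> W')" "open W" "chart_map c p \<in> W"
    have q: "c \<in> charts_at A (chart_inv c x)" "chart_inv c x \<in> W'" if "x \<in> W" for x
      using that W(1) c(1) by (auto simp: charts_at_def)
    interpret inner_product_family "metric_in_chart c" W "chart_map c p"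
      using W by (intro inner_product_family_metric c) auto
    define e where "e i x = components (E i (chart_inv c x)) c" for i x
    have E_tangent: "E i (chart_inv c x) \<in> tangent_space A (chart_inv c x)" if "x \<in> W" "i < k" for x i
      using smooth[OF that(2)] q(2)[OF that(1)] by (simp add: smooth_vector_field_def)
    have E_e: "E i (chart_inv c x) = coord_vec A c (chart_inv c x) (e i x)" if "x \<in> W" "i < k" for x i
      using coord_vec_components[OF q(1) E_tangent] that by (simp add: e_def)
    have span_E: "span ((\<lambda>i. E i (chart_inv c x)) ` {..<m}) = coord_vec A c (chart_inv c x) ` span ((\<lambda>i. e i x) ` {..<m})"
      if "x \<in> W" "m \<le> k" for x m
    proof -
      have "(\<lambda>i. E i (chart_inv c x)) ` {..<m} = coord_vec A c (chart_inv c x) ` (\<lambda>i. e i x) ` {..<m}"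
        unfolding image_image using E_e[OF that(1)] that(2) by (intro image_cong) auto
      then show ?thesis by (simp add: linear_span_image linear_coord_vec[OF q(1)[OF that(1)]])
    qed
    have "\<exists>w. orthonormal_frame k w \<and> (\<forall>x\<in>W. span ((\<lambda>i. w i x) ` {..<k}) = span ((\<lambda>i. e i x) ` {..<k}))"
    proof (rule gram_schmidt)
      show "e i differentiable at (chart_map c p)" if "i < k" for i
        using smooth[OF that] c W' unfolding smooth_vector_field_def e_def[abs_def]
        by (intro smooth_on_differentiable[of "chart_map c ` (chart_dom c \<inter> W')"]) auto
      show "e i x \<notin> span ((\<lambda>i. e i x) ` {..<i})" if "x \<in> W" "i < k" for x i
      proof
        assume "e i x \<in> span ((\<lambda>i. e i x) ` {..<i})"
        then have "E i (chart_inv c x) \<in> span ((\<lambda>i. E i (chart_inv c x)) ` {..<i})"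
          unfolding E_e[OF that] using span_E[OF that(1), of i] that(2) by auto
        \<comment> \<open>As \<open>independent\<close> speaks of a set, it is injectivity of the
          family that keeps the \<open>i\<close>-th vector apart from its predecessors.\<close>
        moreover have "(\<lambda>i. E i (chart_inv c x)) ` {..<i} \<subseteq> (\<lambda>i. E i (chart_inv c x)) ` {..<k} - {E i (chart_inv c x)}"
          using E[OF q(2)[OF that(1)]] that(2) unfolding inj_on_def by force
        ultimately have "dependent ((\<lambda>i. E i (chart_inv c x)) ` {..<k})"
          unfolding dependent_def using that(2) span_mono by blast
        then show False using E[OF q(2)[OF that(1)]] by blast
      qed
    qed
    then show "\<exists>w. orthonormal_frame k w \<and>
        (\<forall>x\<in>W. V (chart_inv c x) = coord_vec A c (chart_inv c x) ` span ((\<lambda>i. w i x) ` {..<k}))"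
      using E q(2) span_E[OF _ order_refl] by metis
  qed
qed

text \<open>The definite description in \<open>orth_proj\<close> is resolved by the frame expansion
  \<open>?z\<close>: it has the required property, and the difference of two candidates is
  orthogonal to itself.\<close>

lemma alpha_part_orthonormal:
  assumes c: "c \<in> A" and W: "W \<subseteq> chart_img c" "open W" "x0 \<in> W" and x: "x \<in> W"
    and frame: "inner_product_family.orthonormal_frame (metric_in_chart c) W x0 k w"
    and V: "V (chart_inv c x) = coord_vec A c (chart_inv c x) ` span ((\<lambda>i. w i x) ` {..<k})"
  shows "(alpha_part a V (chart_inv c x, coord_vec A c (chart_inv c x) y))\<^sup>2
    = (\<Sum>i<k. (metric_in_chart c x y (w i x))\<^sup>2)"
proof -
  let ?q = "chart_inv c x" and ?h = "metric_in_chart c x"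
  let ?C = "coord_vec A c ?q"
  let ?z = "\<Sum>i<k. ?h y (w i x) *\<^sub>R w i x"
  interpret inner_product_family "metric_in_chart c" W x0
    by (rule inner_product_family_metric[OF c W(2,1,3)])
  have cq: "c \<in> charts_at A ?q" using chart_inv_in_charts_at[OF c] W(1) x by blast
  have aC: "a ?q (?C b) (?C d) = ?h b d" for b d by (simp add: metric_in_chart_def)
  have C_diff: "?C b - ?C d = ?C (b - d)" for b d using linear_diff[OF linear_coord_vec[OF cq]] by simp
  have h_z: "?h ?z (w j x) = ?h y (w j x)" if "j < k" for j
    using orthonormal_frame_sum[OF frame x that] by (simp add: h_simps x)
  have z_span: "?z \<in> span ((\<lambda>i. w i x) ` {..<k})"
    by (intro span_sum span_scale span_base) auto
  have orth: "?h (y - ?z) b = 0" if "b \<in> span ((\<lambda>i. w i x) ` {..<k})" for b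
    using that
  proof (induction rule: span_induct_alt)
    case base
    then show ?case by (simp add: h_simps x)
  next
    case (step r b d)
    then show ?case using h_z by (auto simp: linear_add[OF linear_h'[OF x]] linear_cmul[OF linear_h'[OF x]]
          linear_diff[OF linear_h[OF x]])
  qed
  have "orth_proj a V ?q (?C y) = ?C ?z"
    unfolding orth_proj_def
  proof (rule the_equality)
    show "?C ?z \<in> V ?q \<and> (\<forall>b\<in>V ?q. a ?q (?C y - ?C ?z) b = 0)"
      unfolding V using z_span orth by (auto simp: C_diff aC)
    fix s assume s: "s \<in> V ?q \<and> (\<forall>b\<in>V ?q. a ?q (?C y - s) b = 0)"
    then obtain b where b: "b \<in> span ((\<lambda>i. w i x) ` {..<k})" "s = ?C b" unfolding V by blast
    have d: "b - ?z \<in> span ((\<lambda>i. w i x) ` {..<k})" using b(1) z_span by (rule span_diff)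
    then have "?h (y - b) (b - ?z) = 0"
      using s unfolding b(2) V by (auto simp: C_diff aC)
    moreover have "?h (y - ?z) (b - ?z) = 0" by (rule orth[OF d])
    ultimately have "?h (b - ?z) (b - ?z) = 0"
      by (simp only: linear_diff[OF linear_h[OF x]])
    then have "b = ?z" using h_pos[OF x, of "b - ?z"] by force
    then show "s = ?C ?z" using b(2) by simp
  qed
  moreover have "?h ?z ?z = (\<Sum>i<k. (?h y (w i x))\<^sup>2)"
    by (subst linear_sum[OF linear_h'[OF x]], intro sum.cong refl)
      (simp only: linear_cmul[OF linear_h'[OF x]] h_z lessThan_iff power2_eq_square real_scaleR_def)
  ultimately show ?thesis
    by (simp add: alpha_part_def aC sum_nonneg)
qed

end

text \<open>The claim is local. In the given chart, frames on a common neighbourhood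
  \<open>W\<close> express \<open>F\<close> through squared frame coefficients, which is the setting
  of \<open>spray_deriv_distortion_orthonormal_frames\<close>.\<close>

theorem theorem1p1:
  fixes X :: "'m topology"
    and A :: "('m, 'n::finite) chart set"
    and a :: "'m \<Rightarrow> ('m, 'n) tvec \<Rightarrow> ('m, 'n) tvec \<Rightarrow> real"
    and n1 n2 :: nat
    and V1 V2 :: "'m \<Rightarrow> ('m, 'n) tvec set"
    and L :: "real \<Rightarrow> real \<Rightarrow> real"
    and F :: "'m \<times> ('m, 'n) tvec \<Rightarrow> real"
  assumes "smooth_manifold X A"
    and "alpha12_metric X A a n1 n2 V1 V2 L F"
    and "landsberg_metric A F"
  shows "\<forall>(p, v)\<in>slit_tangent_bundle X A. \<forall>c\<in>charts_at A p. S_curvature A c F (p, v) = 0"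
proof clarify
  fix p v c assume pv: "(p, v) \<in> slit_tangent_bundle X A" and cp: "c \<in> charts_at A p"
  have metric: "riemannian_metric X A a" "1 \<le> n1" "1 \<le> n2" "orthogonal_decomposition X A a n1 n2 V1 V2"
      "finsler_metric X A F"
    and F: "\<And>v. v \<in> tangent_bundle X A \<Longrightarrow> F v = sqrt (L ((alpha_part a V1 v)\<^sup>2) ((alpha_part a V2 v)\<^sup>2))"
    using assms(2) by (auto simp: alpha12_metric_def)
  interpret riemannian X A a
    by unfold_locales (rule assms(1), rule metric(1))
  have c: "c \<in> A" "p \<in> chart_dom c" using cp charts_atD by blast+
  let ?x0 = "chart_map c p" and ?f = "in_chart A c F" and ?h = "metric_in_chart c"
  have xp: "?x0 \<in> chart_img c" "chart_inv c ?x0 = p" using c by auto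
  have subbundles: "smooth_subbundle X A n1 V1" "smooth_subbundle X A n2 V2"
    using metric(4) by (auto simp: orthogonal_decomposition_def)
  obtain W1 where W1: "openin X W1" "p \<in> W1"
    "\<forall>W. W \<subseteq> chart_map c ` (chart_dom c \<inter> W1) \<longrightarrow> open W \<longrightarrow> ?x0 \<in> W \<longrightarrow>
      (\<exists>w. inner_product_family.orthonormal_frame ?h W ?x0 n1 w \<and>
        (\<forall>x\<in>W. V1 (chart_inv c x) = coord_vec A c (chart_inv c x) ` span ((\<lambda>i. w i x) ` {..<n1})))"
    using orthonormal_frame_subbundle[OF subbundles(1) cp] by blast
  obtain W2 where W2: "openin X W2" "p \<in> W2"
    "\<forall>W. W \<subseteq> chart_map c ` (chart_dom c \<inter> W2) \<longrightarrow> open W \<longrightarrow> ?x0 \<in> W \<longrightarrow>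
      (\<exists>w. inner_product_family.orthonormal_frame ?h W ?x0 n2 w \<and>
        (\<forall>x\<in>W. V2 (chart_inv c x) = coord_vec A c (chart_inv c x) ` span ((\<lambda>i. w i x) ` {..<n2})))"
    using orthonormal_frame_subbundle[OF subbundles(2) cp] by blast
  define W where "W = chart_map c ` (chart_dom c \<inter> (W1 \<inter> W2))"
  have W: "open W" "?x0 \<in> W" "W \<subseteq> chart_img c"
    unfolding W_def using W1(1,2) W2(1,2) c by (auto intro: open_chart_image)
  have "W \<subseteq> chart_map c ` (chart_dom c \<inter> W1)" "W \<subseteq> chart_map c ` (chart_dom c \<inter> W2)"
    unfolding W_def by auto
  then obtain w1 w2 where w1: "inner_product_family.orthonormal_frame ?h W ?x0 n1 w1"
      "\<And>x. x \<in> W \<Longrightarrow> V1 (chart_inv c x) = coord_vec A c (chart_inv c x) ` span ((\<lambda>i. w1 i x) ` {..<n1})"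
    and w2: "inner_product_family.orthonormal_frame ?h W ?x0 n2 w2"
      "\<And>x. x \<in> W \<Longrightarrow> V2 (chart_inv c x) = coord_vec A c (chart_inv c x) ` span ((\<lambda>i. w2 i x) ` {..<n2})"
    using W1(3) W2(3) W(1,2) by meson
  have h: "inner_product_family ?h W ?x0"
    by (rule inner_product_family_metric[OF c(1) W(1,3,2)])
  interpret inner_product_family ?h W ?x0 by (rule h)
  let ?C = "coord_vec A c p"
  have V: "V1 p = ?C ` span ((\<lambda>i. w1 i ?x0) ` {..<n1})" "V2 p = ?C ` span ((\<lambda>i. w2 i ?x0) ` {..<n2})"
    using w1(2)[OF W(2)] w2(2)[OF W(2)] xp(2) by simp_all
  have aC: "a p (?C y) (?C z) = ?h ?x0 y z" for y z by (simp add: metric_in_chart_def xp)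
  have p: "p \<in> topspace X" using charts_at_topspace[OF cp] .
  have orth: "?h ?x0 y z = 0" if "y \<in> span ((\<lambda>i. w1 i ?x0) ` {..<n1})" "z \<in> span ((\<lambda>i. w2 i ?x0) ` {..<n2})" for y z
  proof -
    have "?C y \<in> V1 p" "?C z \<in> V2 p" unfolding V using that by (auto intro: imageI)
    then have "a p (?C y) (?C z) = 0"
      using metric(4) p unfolding orthogonal_decomposition_def by blast
    then show ?thesis by (simp only: aC)
  qed
  \<comment> \<open>Both sides are linear in \<open>y\<close> and agree on the frame, hence on its
    span.\<close>
  have expand: "y = (\<Sum>i<k. ?h ?x0 y (w i ?x0) *\<^sub>R w i ?x0)"
    if w: "orthonormal_frame k w" and y: "y \<in> span ((\<lambda>i. w i ?x0) ` {..<k})" for k w y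
  proof -
    let ?l = "\<lambda>y. \<Sum>i<k. ?h ?x0 y (w i ?x0) *\<^sub>R w i ?x0"
    have "linear (\<lambda>y. y)" by (rule linear_ident)
    moreover have "linear ?l"
      by (rule linearI) (simp_all add: linear_add[OF linear_h[OF W(2)]] linear_cmul[OF linear_h[OF W(2)]]
          scaleR_add_left sum.distrib scaleR_sum_right)
    moreover have "b = ?l b" if b: "b \<in> (\<lambda>i. w i ?x0) ` {..<k}" for b
    proof -
      obtain j where j: "j < k" "b = w j ?x0" using b by blast
      have "?l (w j ?x0) = (\<Sum>i<k. if i = j then w i ?x0 else 0)"
        using w j(1) W(2) by (intro sum.cong) (auto simp: orthonormal_frame_def)
      then show ?thesis using j by simp
    qed
    ultimately show ?thesis using y by (rule linear_eq_on_span)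
  qed
  have in_span: "w1 i ?x0 \<in> span ((\<lambda>i. w1 i ?x0) ` {..<n1})" if "i < n1" for i
    using that by (intro span_base) auto
  have in_span': "w2 j ?x0 \<in> span ((\<lambda>i. w2 i ?x0) ` {..<n2})" if "j < n2" for j
    using that by (intro span_base) auto
  have components_v: "components v c \<noteq> 0"
  proof
    assume "components v c = 0"
    moreover have "coord_vec A c p (components v c) = v"
      using pv cp by (auto simp: slit_tangent_bundle_def tangent_bundle_def)
    ultimately have "v = 0" using linear_0[OF linear_coord_vec[OF cp]] by simp
    then show False using pv by (simp add: slit_tangent_bundle_def)
  qed
  have "spray_deriv ?f (distortion ?f) ?x0 (components v c) = 0"
  proof (rule spray_deriv_distortion_orthonormal_frames[OF h W(1) w1(1) w2(1) metric(2,3) _ _ _ _ _ components_v])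
    show "?h ?x0 (w1 i ?x0) (w2 j ?x0) = 0" if "i < n1" "j < n2" for i j
      using orth in_span[OF that(1)] in_span'[OF that(2)] by blast
    show "y = (\<Sum>i<n1. ?h ?x0 y (w1 i ?x0) *\<^sub>R w1 i ?x0) + (\<Sum>j<n2. ?h ?x0 y (w2 j ?x0) *\<^sub>R w2 j ?x0)" for y
    proof -
      have "?C y \<in> {u + v | u v. u \<in> V1 p \<and> v \<in> V2 p}"
        using metric(4) p coord_vec_tangent[OF cp, of y] by (simp add: orthogonal_decomposition_def)
      then obtain y1 y2 where y12: "y1 \<in> span ((\<lambda>i. w1 i ?x0) ` {..<n1})" "y2 \<in> span ((\<lambda>i. w2 i ?x0) ` {..<n2})"
        "?C y = ?C y1 + ?C y2" unfolding V by blast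
      then have "?C y = ?C (y1 + y2)" using linear_add[OF linear_coord_vec[OF cp]] by simp
      then have y: "y = y1 + y2" by (metis components_coord_vec_self[OF cp])
      \<comment> \<open>The part of \<open>y\<close> in the other subbundle drops out by
        orthogonality.\<close>
      have 1: "?h ?x0 y (w1 i ?x0) = ?h ?x0 y1 (w1 i ?x0)" if "i < n1" for i
        unfolding y using orth[OF in_span[OF that] y12(2)] h_commute[OF W(2), of y2]
        by (simp add: linear_add[OF linear_h[OF W(2)]])
      have 2: "?h ?x0 y (w2 j ?x0) = ?h ?x0 y2 (w2 j ?x0)" if "j < n2" for j
        unfolding y using orth[OF y12(1) in_span'[OF that]]
        by (simp add: linear_add[OF linear_h[OF W(2)]])
      have "(\<Sum>i<n1. ?h ?x0 y (w1 i ?x0) *\<^sub>R w1 i ?x0) = y1"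
        by (rule trans[OF sum.cong[OF refl] expand[OF w1(1) y12(1), symmetric]]) (simp only: 1 lessThan_iff)
      moreover have "(\<Sum>j<n2. ?h ?x0 y (w2 j ?x0) *\<^sub>R w2 j ?x0) = y2"
        by (rule trans[OF sum.cong[OF refl] expand[OF w2(1) y12(2), symmetric]]) (simp only: 2 lessThan_iff)
      ultimately show ?thesis using y by (simp only:)
    qed
    show "?f x y = sqrt (L (\<Sum>i<n1. (?h x y (w1 i x))\<^sup>2) (\<Sum>j<n2. (?h x y (w2 j x))\<^sup>2))" if "x \<in> W" for x y
    proof -
      have cq: "c \<in> charts_at A (chart_inv c x)" using chart_inv_in_charts_at c(1) W(3) that by blast
      then have "(chart_inv c x, coord_vec A c (chart_inv c x) y) \<in> tangent_bundle X A"
        using charts_at_topspace[OF cq] by (simp add: tangent_bundle_def)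
      from F[OF this] show ?thesis
        unfolding in_chart_def
        using alpha_part_orthonormal[where V = V1 and w = w1, OF c(1) W(3,1,2) that w1(1) w1(2)[OF that]]
          alpha_part_orthonormal[where V = V2 and w = w2, OF c(1) W(3,1,2) that w2(1) w2(2)[OF that]] by simp
    qed
    show "minkowski_norm (?f ?x0)"
      using metric(5) p cp by (simp add: finsler_metric_def in_chart_def[abs_def] xp)
    show "(\<Sum>i\<in>UNIV. \<Sum>j\<in>UNIV. y $ j * g_mat ?f ?x0 y $ i $ j *
      dy r (dy q (dy p (spray_coeff ?f i))) ?x0 y) = 0" if "y \<noteq> 0" for y p q r
      using assms(3) c(1) xp(1) that by (auto simp: landsberg_metric_def Let_def)
  qed
  then show "S_curvature A c F (p, v) = 0"
    by (simp add: S_curvature_def)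
qed

end
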